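(* Let $D_1,D_2$ be bounded domains in $\mathbb{C}^n$ with Bergman kernels (on the diagonal) $K_1,K_2$, respectively. Assume that there exist a domain $\hat D\subseteq\mathbb{C}^n$ containing $D:=D_1\cup D_2$, a positive real-analytic function $K$ on $\hat D$, and a constant $\lambda>0$ such that: (a) $\omega:=i\partial\bar\partial\log K$ defines a positive-definite Kähler form on $\hat D$; (b) $K_1=K$ on $D_1$, and $K_2=\lambda K$ on $D_2$. Then $\lambda=1$, and the symmetric difference $D_1\Delta D_2$ has Lebesgue measure zero. If in addition $K$ admits a sesqui-holomorphic extension $\widetilde K(\cdot,\cdot)$ to $\hat D\times\hat D$, then $D_1\preceq_B D$ and $D_2\preceq_B D$, and thus $D_1$ and $D_2$ are Bergman equivalent.
   Context: A domain is a nonempty connected open set; complex manifolds are assumed connected (so the assertion $D_j\preceq_B D$ includes that $D$ is connected). $D_1\Delta D_2=(D_1\setminus D_2)\cup(D_2\setminus D_1)$. For an $n$-dimensional complex manifold $M$, $A^2_{(n,0)}(M)$ is the Hilbert space of holomorphic $(n,0)$-forms $f$ with $|\int_M f\wedge\overline f|<\infty$, with inner product $\langle f,g\rangle=(\sqrt{-1})^{n^2}\int_M f\wedge\overline g$. For a domain $\Omega\subseteq\mathbb{C}^n$ it is identified with the space $A^2(\Omega)$ of square-integrable holomorphic functions; the Bergman kernel is $K_\Omega(z,w)=\sum_k\phi_k(z)\overline{\phi_k(w)}$ for any orthonormal basis $\{\phi_k\}$ of $A^2(\Omega)$, and on the diagonal it is the function $z\mapsto K_\Omega(z,z)$. A function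 $\widetilde K(z,w)$ is sesqui-holomorphic if it is holomorphic in the first variable and anti-holomorphic in the second; it extends $K$ if $\widetilde K(z,z)=K(z)$ for all $z\in\hat D$. Let $M$ be a complex manifold with $A^2_{(n,0)}(M)\ne\{0\}$ (nontrivial Bergman space). A (possibly empty) closed proper subset $E\subseteq M$ is Bergman negligible if the restriction map $A^2_{(n,0)}(M)\to A^2_{(n,0)}(M\setminus E)$ is a unitary isomorphism. For complex manifolds $M_1,M_2$ with nontrivial Bergman spaces, $M_1\preceq_B M_2$ means that there is a Bergman negligible subset $E\subseteq M_2$ such that $M_1$ is biholomorphic to $M_2\setminus E$. $M_1$ and $M_2$ are Bergman equivalent if there is a finite sequence of complex manifolds $M_1=X_1,\dots,X_k=M_2$ such that for each $j=1,\dots,k-1$ either $X_j\preceq_B X_{j+1}$ or $X_{j+1}\preceq_B X_j$. *)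

theory Defs
  imports "HOL-Analysis.Analysis"
begin

section \<open>Several complex variables\<close>

text \<open>All sets on which the following notions are used are open, so derivatives are taken at \<open>at z\<close>.\<close>

definition cdomain :: "(complex^'n) set \<Rightarrow> bool" where
  "cdomain S \<longleftrightarrow> S \<noteq> {} \<and> open S \<and> connected S"

definition holo_on :: "(complex^'n \<Rightarrow> complex) \<Rightarrow> (complex^'n) set \<Rightarrow> bool" where
  "holo_on f S \<longleftrightarrow>
     (\<forall>z\<in>S. \<exists>L. (f has_derivative L) (at z) \<and> (\<forall>c v. L (c *s v) = c * L v))"

definition antiholo_on :: "(complex^'n \<Rightarrow> complex) \<Rightarrow> (complex^'n) set \<Rightarrow> bool" where
  "antiholo_on f S \<longleftrightarrow> holo_on (\<lambda>z. cnj (f z)) S"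

definition holo_vec_on :: "(complex^'n \<Rightarrow> complex^'m) \<Rightarrow> (complex^'n) set \<Rightarrow> bool" where
  "holo_vec_on F S \<longleftrightarrow> (\<forall>i. holo_on (\<lambda>z. F z $ i) S)"

definition holo_jacobian :: "(complex^'n \<Rightarrow> complex^'n) \<Rightarrow> complex^'n \<Rightarrow> complex" where
  "holo_jacobian F z = det (matrix (frechet_derivative F (at z)))"

definition sesqui_holo_on ::
    "(complex^'n \<Rightarrow> complex^'n \<Rightarrow> complex) \<Rightarrow> (complex^'n) set \<Rightarrow> bool" where
  "sesqui_holo_on F S \<longleftrightarrow>
     (\<forall>w\<in>S. holo_on (\<lambda>z. F z w) S) \<and> (\<forall>z\<in>S. antiholo_on (\<lambda>w. F z w) S)"

text \<open>Local expansion in a real power series. The multi-indices are the extensional functions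
  from \<open>Basis\<close> to \<open>nat\<close>; for \<open>complex^'n\<close> the coordinates \<open>x \<bullet> b\<close> are the real and
  imaginary parts of the components.\<close>

definition real_analytic_on :: "('a::euclidean_space \<Rightarrow> real) \<Rightarrow> 'a set \<Rightarrow> bool" where
  "real_analytic_on f S \<longleftrightarrow>
     (\<forall>a\<in>S. \<exists>c :: ('a \<Rightarrow> nat) \<Rightarrow> real. \<exists>r>0. \<forall>x\<in>ball a r.
        ((\<lambda>\<alpha>. c \<alpha> * (\<Prod>b\<in>Basis. ((x - a) \<bullet> b) ^ \<alpha> b)) has_sum f x) (Basis \<rightarrow>\<^sub>E UNIV))"


section \<open>The form \<open>i \<partial>\<partial>\<close>-bar and Kaehler forms\<close>

definition d_z :: "'n \<Rightarrow> (complex^'n \<Rightarrow> complex) \<Rightarrow> complex^'n \<Rightarrow> complex" where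
  "d_z j f z = (frechet_derivative f (at z) (axis j 1)
                - \<i> * frechet_derivative f (at z) (axis j \<i>)) / 2"

definition d_zbar :: "'n \<Rightarrow> (complex^'n \<Rightarrow> complex) \<Rightarrow> complex^'n \<Rightarrow> complex" where
  "d_zbar j f z = (frechet_derivative f (at z) (axis j 1)
                   + \<i> * frechet_derivative f (at z) (axis j \<i>)) / 2"

text \<open>The two-form with components \<open>i u\<^bsub>jk\<^esub> dz\<^sub>j \<and> d\<close>-bar\<open>z\<^sub>k\<close>, where \<open>u\<^bsub>jk\<^esub>\<close> is the complex Hessian
  of \<open>u\<close>, evaluated at the point \<open>z\<close> on two tangent vectors \<open>v\<close> and \<open>w\<close>.\<close>

definition i_ddbar ::
    "(complex^'n \<Rightarrow> real) \<Rightarrow> complex^'n \<Rightarrow> complex^'n \<Rightarrow> complex^'n \<Rightarrow> complex" where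
  "i_ddbar u z v w =
     \<i> * (\<Sum>j\<in>UNIV. \<Sum>k\<in>UNIV. d_z j (d_zbar k (\<lambda>x. complex_of_real (u x))) z
            * (v $ j * cnj (w $ k) - w $ j * cnj (v $ k)))"

text \<open>For open \<open>S\<close> the greatest such predicate is infinite differentiability.\<close>

coinductive smooth_on :: "'a::real_normed_vector set \<Rightarrow> ('a \<Rightarrow> 'b::real_normed_vector) \<Rightarrow> bool"
  for S :: "'a set" where
  "(\<forall>z\<in>S. f differentiable (at z)) \<Longrightarrow>
   (\<forall>v. smooth_on S (\<lambda>z. frechet_derivative f (at z) v)) \<Longrightarrow> smooth_on S f"

text \<open>A smooth closed real two-form of type (1,1) which is positive definite. The exterior
  derivative is evaluated on constant vector fields. For forms \<open>i_ddbar u\<close> with \<open>u\<close> smooth,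
  every clause except positivity holds automatically.\<close>

definition kaehler_form_on ::
    "(complex^'n \<Rightarrow> complex^'n \<Rightarrow> complex^'n \<Rightarrow> complex) \<Rightarrow> (complex^'n) set \<Rightarrow> bool" where
  "kaehler_form_on \<omega> S \<longleftrightarrow>
     (\<forall>v w. smooth_on S (\<lambda>z. \<omega> z v w)) \<and>
     (\<forall>z\<in>S.
        bilinear (\<omega> z) \<and>
        (\<forall>v. \<omega> z v v = 0) \<and>
        (\<forall>v w. \<omega> z v w \<in> \<real>) \<and>
        (\<forall>v w. \<omega> z (\<i> *s v) (\<i> *s w) = \<omega> z v w) \<and>
        (\<forall>u v w. frechet_derivative (\<lambda>x. \<omega> x v w) (at z) u
                 - frechet_derivative (\<lambda>x. \<omega> x u w) (at z) v
                 + frechet_derivative (\<lambda>x. \<omega> x u v) (at z) w = 0) \<and>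
        (\<forall>v. v \<noteq> 0 \<longrightarrow> 0 < Re (\<omega> z v (\<i> *s v))))"


section \<open>Bergman space and Bergman kernel of an open set in complex Euclidean space\<close>

text \<open>Elements are normalized to vanish off \<open>S\<close>, so that equality of functions is equality
  in the Hilbert space.\<close>

definition bergman_fns :: "(complex^'n) set \<Rightarrow> (complex^'n \<Rightarrow> complex) set" where
  "bergman_fns S = {f. holo_on f S \<and> (\<forall>z. z \<notin> S \<longrightarrow> f z = 0) \<and>
                       set_integrable lborel S (\<lambda>z. (cmod (f z))\<^sup>2)}"

definition l2_inner ::
    "(complex^'n) set \<Rightarrow> (complex^'n \<Rightarrow> complex) \<Rightarrow> (complex^'n \<Rightarrow> complex) \<Rightarrow> complex" where
  "l2_inner S f g = (LINT z:S|lborel. f z * cnj (g z))"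

definition bergman_onb :: "(complex^'n) set \<Rightarrow> (complex^'n \<Rightarrow> complex) set \<Rightarrow> bool" where
  "bergman_onb S B \<longleftrightarrow>
     B \<subseteq> bergman_fns S \<and>
     (\<forall>f\<in>B. \<forall>g\<in>B. l2_inner S f g = (if f = g then 1 else 0)) \<and>
     (\<forall>f\<in>bergman_fns S. \<forall>\<epsilon>>0. \<exists>F c. finite F \<and> F \<subseteq> B \<and>
        (LINT z:S|lborel. (cmod (f z - (\<Sum>g\<in>F. c g * g z)))\<^sup>2) < \<epsilon>)"

text \<open>The sum does not depend on the orthonormal basis and converges absolutely.\<close>

definition bergman_kernel :: "(complex^'n) set \<Rightarrow> complex^'n \<Rightarrow> complex^'n \<Rightarrow> complex" where
  "bergman_kernel S z w =
     (\<Sum>\<^sub>\<infinity>f\<in>(SOME B. bergman_onb S B). f z * cnj (f w))"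


section \<open>Complex manifolds\<close>

text \<open>A chart is a pair \<open>(U, \<phi>)\<close> of its domain and its coordinate map; the values of \<open>\<phi>\<close>
  outside \<open>U\<close> are irrelevant. Atlases are not required to be maximal.\<close>

type_synonym ('a, 'n) chart = "'a set \<times> ('a \<Rightarrow> complex^'n)"

datatype ('a, 'n) cmfd = CMfd (mtop: "'a topology") (atlas: "('a, 'n::finite) chart set")

abbreviation pts :: "('a, 'n::finite) cmfd \<Rightarrow> 'a set" where
  "pts M \<equiv> topspace (mtop M)"

definition is_chart :: "'a topology \<Rightarrow> ('a, 'n::finite) chart \<Rightarrow> bool" where
  "is_chart X = (\<lambda>(U, \<phi>). openin X U \<and> open (\<phi> ` U) \<and>
      homeomorphic_map (subtopology X U) (top_of_set (\<phi> ` U)) \<phi>)"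

definition chart_image :: "('a, 'n::finite) chart \<Rightarrow> (complex^'n) set" where
  "chart_image = (\<lambda>(U, \<phi>). \<phi> ` U)"

definition chart_inv :: "('a, 'n::finite) chart \<Rightarrow> complex^'n \<Rightarrow> 'a" where
  "chart_inv = (\<lambda>(U, \<phi>). inv_into U \<phi>)"

text \<open>The coordinate change from \<open>c\<close> to \<open>c'\<close>, meaningful on the image of the overlap under \<open>c\<close>.\<close>

definition transition ::
    "('a, 'n::finite) chart \<Rightarrow> ('a, 'n) chart \<Rightarrow> complex^'n \<Rightarrow> complex^'n" where
  "transition c c' = snd c' \<circ> chart_inv c"

definition complex_manifold :: "('a, 'n::finite) cmfd \<Rightarrow> bool" where
  "complex_manifold M \<longleftrightarrow>
     pts M \<noteq> {} \<and> connected_space (mtop M) \<and> Hausdorff_space (mtop M) \<and>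
     second_countable (mtop M) \<and>
     (\<forall>c\<in>atlas M. is_chart (mtop M) c) \<and>
     (\<Union>c\<in>atlas M. fst c) = pts M \<and>
     (\<forall>c\<in>atlas M. \<forall>c'\<in>atlas M.
        holo_vec_on (transition c c') (snd c ` (fst c \<inter> fst c')))"

definition holo_mfd_map ::
    "('a, 'n::finite) cmfd \<Rightarrow> ('b, 'm::finite) cmfd \<Rightarrow> ('a \<Rightarrow> 'b) \<Rightarrow> bool" where
  "holo_mfd_map M N F \<longleftrightarrow>
     continuous_map (mtop M) (mtop N) F \<and>
     (\<forall>c\<in>atlas M. \<forall>c'\<in>atlas N.
        holo_vec_on (snd c' \<circ> F \<circ> chart_inv c) (snd c ` {p\<in>fst c. F p \<in> fst c'}))"

definition biholomorphic :: "('a, 'n::finite) cmfd \<Rightarrow> ('b, 'n) cmfd \<Rightarrow> bool" where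
  "biholomorphic M N \<longleftrightarrow>
     (\<exists>F G. homeomorphic_maps (mtop M) (mtop N) F G \<and> holo_mfd_map M N F \<and> holo_mfd_map N M G)"

text \<open>Meant for open \<open>S\<close>.\<close>

definition open_submfd :: "('a, 'n::finite) cmfd \<Rightarrow> 'a set \<Rightarrow> ('a, 'n) cmfd" where
  "open_submfd M S =
     CMfd (subtopology (mtop M) S) ((\<lambda>(U, \<phi>). (U \<inter> S, \<phi>)) ` atlas M)"

definition domain_mfd :: "(complex^'n) set \<Rightarrow> (complex^'n, 'n::finite) cmfd" where
  "domain_mfd S = CMfd (top_of_set S) {(S, \<lambda>z. z)}"


section \<open>Holomorphic forms of top degree and the Bergman space of a manifold\<close>

text \<open>An \<open>(n,0)\<close>-form \<open>f\<close> is the family of its coefficients: in the chart \<open>c\<close> with coordinates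
  \<open>z\<close> it is \<open>f c dz\<^sub>1 \<and> \<dots> \<and> dz\<^sub>n\<close>. The coefficients are normalized to be \<open>0\<close> where they have no
  meaning, so that equality of forms is equality of families.\<close>

type_synonym ('a, 'n) nform = "('a, 'n) chart \<Rightarrow> complex^'n \<Rightarrow> complex"

definition holo_nform :: "('a, 'n::finite) cmfd \<Rightarrow> ('a, 'n) nform \<Rightarrow> bool" where
  "holo_nform M f \<longleftrightarrow>
     (\<forall>c\<in>atlas M. holo_on (f c) (chart_image c)) \<and>
     (\<forall>c\<in>atlas M. \<forall>c'\<in>atlas M. \<forall>z\<in>snd c ` (fst c \<inter> fst c').
        f c z = f c' (transition c c' z) * holo_jacobian (transition c c') z) \<and>
     (\<forall>c z. c \<notin> atlas M \<or> z \<notin> chart_image c \<longrightarrow> f c z = 0)"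

text \<open>Integration over \<open>M\<close>: the manifold is cut into countably many Borel pieces, each contained
  in a chart, and the integrals over the pieces are added up. By change of variables the result
  does not depend on the covering sequence of charts, which exists by second countability.\<close>

definition chart_seq :: "('a, 'n::finite) cmfd \<Rightarrow> nat \<Rightarrow> ('a, 'n) chart" where
  "chart_seq M = (SOME c. (\<forall>i. c i \<in> atlas M) \<and> (\<Union>i. fst (c i)) = pts M)"

definition chart_piece :: "('a, 'n::finite) cmfd \<Rightarrow> nat \<Rightarrow> (complex^'n) set" where
  "chart_piece M i =
     snd (chart_seq M i) ` (fst (chart_seq M i) - (\<Union>j<i. fst (chart_seq M j)))"

text \<open>In a chart, \<open>(\<surd>-1)\<^bsup>n\<^sup>2\<^esup> f \<and> g\<close>-bar is \<open>2\<^sup>n f(z) cnj (g(z))\<close> times Lebesgue measure, since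
  \<open>i dz \<and> d\<close>-bar\<open>z = 2 dx \<and> dy\<close> in each variable.\<close>

definition nform_inner ::
    "('a, 'n::finite) cmfd \<Rightarrow> ('a, 'n) nform \<Rightarrow> ('a, 'n) nform \<Rightarrow> complex" where
  "nform_inner M f g =
     2 ^ CARD('n) *
       (\<Sum>i. LINT z:chart_piece M i|lborel. f (chart_seq M i) z * cnj (g (chart_seq M i) z))"

definition bergman_forms :: "('a, 'n::finite) cmfd \<Rightarrow> ('a, 'n) nform set" where
  "bergman_forms M = {f. holo_nform M f \<and>
     (\<Sum>i. \<integral>\<^sup>+z\<in>chart_piece M i. ennreal ((cmod (f (chart_seq M i) z))\<^sup>2) \<partial>lborel) < \<infinity>}"

definition nontrivial_bergman :: "('a, 'n::finite) cmfd \<Rightarrow> bool" where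
  "nontrivial_bergman M \<longleftrightarrow> bergman_forms M \<noteq> {\<lambda>_ _. 0}"

text \<open>Several charts of \<open>M\<close> can induce the same chart \<open>(V, \<phi>)\<close> of the open submanifold; as they
  share the coordinate map \<open>\<phi>\<close>, the coefficients of a form in these charts agree on \<open>\<phi> ` V\<close>.\<close>

definition restrict_nform ::
    "('a, 'n::finite) cmfd \<Rightarrow> 'a set \<Rightarrow> ('a, 'n) nform \<Rightarrow> ('a, 'n) nform" where
  "restrict_nform M S f = (\<lambda>(V, \<phi>) z.
     if (V, \<phi>) \<in> atlas (open_submfd M S) \<and> z \<in> \<phi> ` V
     then f (SOME c. c \<in> atlas M \<and> fst c \<inter> S = V \<and> snd c = \<phi>) z else 0)"


section \<open>Bergman negligible sets and Bergman equivalence\<close>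

definition bergman_negligible :: "('a, 'n::finite) cmfd \<Rightarrow> 'a set \<Rightarrow> bool" where
  "bergman_negligible M E \<longleftrightarrow>
     nontrivial_bergman M \<and> closedin (mtop M) E \<and> E \<noteq> pts M \<and>
     bij_betw (restrict_nform M (pts M - E))
       (bergman_forms M) (bergman_forms (open_submfd M (pts M - E))) \<and>
     (\<forall>f\<in>bergman_forms M. \<forall>g\<in>bergman_forms M.
        nform_inner (open_submfd M (pts M - E))
          (restrict_nform M (pts M - E) f) (restrict_nform M (pts M - E) g)
        = nform_inner M f g)"

definition bergman_le ::
    "('a, 'n::finite) cmfd \<Rightarrow> ('b, 'n) cmfd \<Rightarrow> bool" (infix "\<preceq>\<^sub>B" 50) where
  "M \<preceq>\<^sub>B N \<longleftrightarrow>
     complex_manifold M \<and> complex_manifold N \<and>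
     nontrivial_bergman M \<and> nontrivial_bergman N \<and>
     (\<exists>E. bergman_negligible N E \<and> biholomorphic M (open_submfd N (pts N - E)))"

text \<open>All manifolds of the chain have their points in the type \<open>complex^'n\<close>, with an arbitrary
  topology and atlas. This is no restriction: a connected second countable manifold of positive
  dimension has the cardinality of the continuum, so each complex \<open>n\<close>-manifold is biholomorphic
  to one of this kind, and \<open>\<preceq>\<^sub>B\<close> is invariant under biholomorphisms.\<close>

definition bergman_equiv ::
    "(complex^'n, 'n::finite) cmfd \<Rightarrow> (complex^'n, 'n) cmfd \<Rightarrow> bool" where
  "bergman_equiv M N \<longleftrightarrow>
     complex_manifold M \<and> complex_manifold N \<and>
     nontrivial_bergman M \<and> nontrivial_bergman N \<and>
     (\<exists>Xs :: (complex^'n, 'n) cmfd list. Xs \<noteq> [] \<and> hd Xs = M \<and> last Xs = N \<and>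
        (\<forall>X\<in>set Xs. complex_manifold X) \<and>
        (\<forall>j. Suc j < length Xs \<longrightarrow> Xs ! j \<preceq>\<^sub>B Xs ! Suc j \<or> Xs ! Suc j \<preceq>\<^sub>B Xs ! j))"

end

theory Submission
  imports Defs "HOL-Complex_Analysis.Complex_Analysis" "HOL-Library.Function_Algebras"
begin

text \<open>Why the theorem holds. Let \<open>D\<close> be the larger domain, and let \<open>p\<close> be an entire function. In a
  Hilbert space of functions with reproducing kernel \<open>K\<^sub>1\<close>, the inequality \<open>\<parallel>p\<parallel>\<^sup>2 \<le> C\<close> says that the
  kernel \<open>C K\<^sub>1(z, w) - p(z) cnj (p(w))\<close> is positive semidefinite, and by density of kernel
  functions it suffices to test this at points of an arbitrarily small ball (\<open>psd_kernel_bergman\<close>,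
  \<open>l2_sqnorm_le_if_psd_kernel\<close>). Near each point of \<open>D\<close> the real-analytic function \<open>K\<close> is the
  diagonal of exactly one sesqui-holomorphic function (\<open>real_analytic_sesqui_extension\<close>,
  \<open>sesqui_zero_if_zero_on_diagonal\<close>), and positivity of a sesqui-holomorphic kernel near the centre
  of a ball implies positivity on the ball (\<open>psd_kernel_ball_extend\<close>). Hence positivity spreads from
  \<open>D1\<close> over the connected set \<open>D\<close> and reaches \<open>D2\<close>; this is Calabi's continuation argument. It shows
  that \<open>\<lambda> \<parallel>p\<parallel>\<^sup>2\<close>, computed on \<open>D2\<close>, is at most \<open>\<parallel>p\<parallel>\<^sup>2\<close>, computed on \<open>D1\<close>
  (\<open>l2_sqnorm_transport\<close>). Exchanging the domains gives equality. The two domains may well be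
  disjoint at this stage; what makes the comparison meaningful is that \<open>p\<close> is defined everywhere.

  Polarization gives \<open>\<integral> p cnj q\<close> over \<open>D1\<close> equal to \<open>\<lambda>\<close> times the same integral over \<open>D2\<close>, for all
  entire \<open>p\<close> and \<open>q\<close>. Products \<open>p cnj q\<close> span an algebra containing all real polynomials, so by
  Stone and Weierstrass Lebesgue measure on \<open>D1\<close> equals \<open>\<lambda>\<close> times Lebesgue measure on \<open>D2\<close>, at
  least on closed sets. Testing on the complements of the two domains shows that the symmetric
  difference is null, and comparison of the volumes gives \<open>\<lambda> = 1\<close> (\<open>null_differences\<close>,
  \<open>factors_eq\<close>).

  If \<open>K\<close> is the diagonal of a sesqui-holomorphic function on \<open>D \<times> D\<close>, that function restricts to
  the Bergman kernel of \<open>D1\<close> (\<open>sesqui_zero_if_zero_on_diagonal_connected\<close>), so the kernel functions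
  of \<open>D1\<close> extend to \<open>D1 \<union> D2\<close>. They are total, and extension across a null set preserves the norm;
  by completeness every element of the Bergman space of \<open>D1\<close> extends (\<open>bergman_fns_extend\<close>), which
  means that \<open>D2 - D1\<close> is Bergman negligible in the union (\<open>bergman_le_subdomain\<close>).

  One elementary device replaces much of the theory of several complex variables: the value of a
  bounded holomorphic function at a point of a disc is approximated, uniformly in the function, by
  a fixed linear combination of its values on a small circle (\<open>circle_interpolation\<close>). It yields
  the spreading of positivity, Osgood's lemma, and the mean value inequality on balls.\<close>

section \<open>Holomorphic functions of several variables on slices\<close>

lemma norm_vector_scalar_mult: "norm (c *s v) = cmod c * norm v" for v :: "complex^'n"
  by (simp add: norm_vec_def L2_set_def vector_scalar_mult_def norm_mult power_mult_distrib
      flip: sum_distrib_left real_sqrt_mult) (simp add: real_sqrt_mult flip: sum_distrib_left)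

lemma bounded_linear_scale_vec: "bounded_linear (\<lambda>t. t *s (v :: complex^'n))"
  by (rule bounded_linear_intro[where K = "norm v"])
    (auto simp: vec_eq_iff algebra_simps norm_vector_scalar_mult)

lemma isCont_slice: "isCont (\<lambda>t. z + t *s v) t" for v :: "complex^'n"
  by (intro continuous_intros bounded_linear.isCont[OF bounded_linear_scale_vec])

lemma continuous_on_slice [continuous_intros]:
  "continuous_on S (\<lambda>t. z + t *s v)" for v :: "complex^'n"
  using isCont_slice continuous_at_imp_continuous_on by blast

lemma open_slice: "open S \<Longrightarrow> open {t. z + t *s v \<in> S}" for v :: "complex^'n"
  using continuous_open_preimage[OF continuous_on_slice[of UNIV z v] open_UNIV, of S]
  by (simp add: vimage_def)

lemma holo_on_subset: "holo_on f S \<Longrightarrow> T \<subseteq> S \<Longrightarrow> holo_on f T"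
  unfolding holo_on_def by blast

lemma holo_on_imp_continuous_on: "holo_on f S \<Longrightarrow> continuous_on S f"
  unfolding holo_on_def
  by (meson continuous_at_imp_continuous_on has_derivative_continuous)

lemma holo_on_cong:
  assumes S: "open S" and eq: "\<And>z. z \<in> S \<Longrightarrow> f z = g z"
  shows "holo_on f S \<longleftrightarrow> holo_on g S"
proof -
  have "holo_on k S" if h: "holo_on h S" and hk: "\<And>z. z \<in> S \<Longrightarrow> h z = k z" for h k
    unfolding holo_on_def
  proof
    fix z assume z: "z \<in> S"
    then obtain L where L: "(h has_derivative L) (at z)" "\<forall>c v. L (c *s v) = c * L v"
      using h unfolding holo_on_def by blast
    have "(k has_derivative L) (at z)"
      by (rule has_derivative_transform_within_open[OF L(1) S z hk])
    then show "\<exists>L. (k has_derivative L) (at z) \<and> (\<forall>c v. L (c *s v) = c * L v)" using L(2) by blast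
  qed
  from this[of f g] this[of g f] show ?thesis using eq by metis
qed

lemma holo_on_const: "holo_on (\<lambda>_. c) S"
  unfolding holo_on_def by (auto intro!: exI[of _ "\<lambda>_. 0"])

lemma holo_on_add:
  assumes "holo_on f S" "holo_on g S" shows "holo_on (\<lambda>z. f z + g z) S"
  unfolding holo_on_def
proof
  fix z assume "z \<in> S"
  then obtain L M where "(f has_derivative L) (at z)" "\<forall>c v. L (c *s v) = c * L v"
    "(g has_derivative M) (at z)" "\<forall>c v. M (c *s v) = c * M v"
    using assms unfolding holo_on_def by blast
  then show "\<exists>L. ((\<lambda>z. f z + g z) has_derivative L) (at z) \<and> (\<forall>c v. L (c *s v) = c * L v)"
    by (intro exI[of _ "\<lambda>h. L h + M h"] conjI has_derivative_add) (simp_all add: distrib_left)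
qed

lemma holo_on_mult:
  assumes "holo_on f S" "holo_on g S" shows "holo_on (\<lambda>z. f z * g z) S"
  unfolding holo_on_def
proof
  fix z assume "z \<in> S"
  then obtain L M where "(f has_derivative L) (at z)" "\<forall>c v. L (c *s v) = c * L v"
    "(g has_derivative M) (at z)" "\<forall>c v. M (c *s v) = c * M v"
    using assms unfolding holo_on_def by blast
  then show "\<exists>L. ((\<lambda>z. f z * g z) has_derivative L) (at z) \<and> (\<forall>c v. L (c *s v) = c * L v)"
    using has_derivative_mult[of f L z UNIV g M]
    by (intro exI[of _ "\<lambda>h. f z * M h + L h * g z"] conjI) (simp_all add: distrib_left mult_ac)
qed

lemma holo_on_cmult: "holo_on f S \<Longrightarrow> holo_on (\<lambda>z. c * f z) S"
  by (intro holo_on_mult holo_on_const)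

lemma holo_on_diff: "holo_on f S \<Longrightarrow> holo_on g S \<Longrightarrow> holo_on (\<lambda>z. f z - g z) S"
  using holo_on_add[of f S "\<lambda>z. (-1) * g z"] holo_on_cmult[of g S "-1"] by simp

lemma holo_on_sum: "(\<And>i. i \<in> I \<Longrightarrow> holo_on (f i) S) \<Longrightarrow> holo_on (\<lambda>z. \<Sum>i\<in>I. f i z) S"
  by (induction I rule: infinite_finite_induct) (auto intro: holo_on_const holo_on_add)

lemma holo_on_prod: "(\<And>i. i \<in> I \<Longrightarrow> holo_on (f i) S) \<Longrightarrow> holo_on (\<lambda>z. \<Prod>i\<in>I. f i z) S"
  by (induction I rule: infinite_finite_induct) (auto intro: holo_on_const holo_on_mult)

lemma holo_on_power: "holo_on f S \<Longrightarrow> holo_on (\<lambda>z. f z ^ k) S"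
  by (induction k) (auto intro: holo_on_const holo_on_mult)

lemma holo_on_linear:
  assumes "bounded_linear L" "\<And>c v. L (c *s v) = c * L v"
  shows "holo_on L S"
  unfolding holo_on_def using assms by (blast intro: bounded_linear_imp_has_derivative)

lemma holo_on_component: "holo_on (\<lambda>z. z $ i) S"
  by (rule holo_on_linear) (auto simp: bounded_linear_vec_nth)

lemma has_field_derivative_slice:
  fixes v :: "complex^'n"
  assumes "(f has_derivative L) (at (z + t *s v))" "\<forall>c v. L (c *s v) = c * L v"
  shows "((\<lambda>t. f (z + t *s v)) has_field_derivative L v) (at t)"
proof -
  have "((\<lambda>t. z + t *s v) has_derivative (\<lambda>t. t *s v)) (at t)"
    using has_derivative_add[OF has_derivative_const[of z]
        bounded_linear_imp_has_derivative[OF bounded_linear_scale_vec[of v]]] by simp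
  from has_derivative_compose[OF this assms(1)]
  show ?thesis using assms(2)
    by (simp add: has_field_derivative_def mult.commute[of "L v"] mult_commute_abs)
qed

lemma holo_on_slice:
  fixes v :: "complex^'n"
  assumes "holo_on f S" "\<And>t. t \<in> T \<Longrightarrow> z + t *s v \<in> S"
  shows "(\<lambda>t. f (z + t *s v)) holomorphic_on T"
  unfolding holomorphic_on_def field_differentiable_def
proof
  fix t assume "t \<in> T"
  then obtain L where "(f has_derivative L) (at (z + t *s v))" "\<forall>c v. L (c *s v) = c * L v"
    using assms unfolding holo_on_def by blast
  then show "\<exists>f'. ((\<lambda>t. f (z + t *s v)) has_field_derivative f') (at t within T)"
    using has_field_derivative_slice has_field_derivative_at_within by blast
qed

text \<open>Cauchy's estimate on the slice in direction \<open>v\<close>.\<close>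

lemma holo_derivative_bound:
  fixes z :: "complex^'n"
  assumes f: "holo_on f S" and r: "0 < r" "ball z r \<subseteq> S"
    and M: "\<And>x. x \<in> S \<Longrightarrow> cmod (f x) \<le> M"
    and L: "(f has_derivative L) (at z)" "\<forall>c v. L (c *s v) = c * L v"
  shows "cmod (L v) \<le> 2 * M / r * norm v"
proof (cases "v = 0")
  case True
  then show ?thesis using L(2)[rule_format, of 0 v] by simp
next
  case False
  \<comment> \<open>half of the largest admissible radius, so that the closed disc stays inside the ball\<close>
  define q where "q = r / (2 * norm v)"
  have q: "q > 0" using r False by (simp add: q_def)
  have sub: "z + t *s v \<in> S" if "t \<in> cball 0 q" for t
  proof -
    have "cmod t * norm v \<le> q * norm v" using that by (intro mult_right_mono) auto
    also have "\<dots> < r" using False r by (simp add: q_def)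
    finally show ?thesis using r(2) by (auto simp: dist_norm norm_vector_scalar_mult)
  qed
  have hol: "(\<lambda>t. f (z + t *s v)) holomorphic_on cball 0 q"
    by (rule holo_on_slice[OF f sub])
  have "deriv (\<lambda>t. f (z + t *s v)) 0 = L v"
    using has_field_derivative_slice[of f L z 0 v] L by (simp add: DERIV_imp_deriv)
  moreover have "cmod ((deriv ^^ 1) (\<lambda>t. f (z + t *s v)) 0) \<le> fact 1 * M / q ^ 1"
    using hol holomorphic_on_imp_continuous_on[OF hol] q
    by (intro Cauchy_inequality) (auto intro!: M sub elim: holomorphic_on_subset)
  ultimately show ?thesis using False by (simp add: q_def field_simps)
qed

text \<open>The derivatives of the approximating functions converge as well, because on a smaller ball
  they are controlled by the functions themselves; this makes the limit differentiable.\<close>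

lemma holo_on_uniform_closure:
  fixes f :: "complex^'n \<Rightarrow> complex"
  assumes S: "open S"
    and approx: "\<And>e. e > 0 \<Longrightarrow> \<exists>g. holo_on g S \<and> (\<forall>z\<in>S. cmod (g z - f z) \<le> e)"
  shows "holo_on f S"
  unfolding holo_on_def
proof
  fix z assume "z \<in> S"
  then obtain r0 where r0: "r0 > 0" "ball z r0 \<subseteq> S" using S openE by blast
  define r where "r = r0 / 2"
  have r: "r > 0" using r0 by (simp add: r_def)
  have ballS: "ball x r \<subseteq> S" if "x \<in> ball z r" for x
    using that by (intro order_trans[OF _ r0(2)]) (auto simp: ball_subset_ball_iff r_def dist_commute)
  have "\<forall>n. \<exists>g. holo_on g S \<and> (\<forall>z\<in>S. cmod (g z - f z) \<le> 1 / Suc n)"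
    by (intro allI approx) simp
  then obtain g where g: "\<And>n. holo_on (g n) S"
    and gf: "\<And>n z. z \<in> S \<Longrightarrow> cmod (g n z - f z) \<le> 1 / Suc n" by metis
  have "\<forall>n. \<forall>x\<in>S. \<exists>L. (g n has_derivative L) (at x) \<and> (\<forall>c v. L (c *s v) = c * L v)"
    using g unfolding holo_on_def by blast
  then obtain g' where g': "\<And>n x. x \<in> S \<Longrightarrow> (g n has_derivative g' n x) (at x)"
    and g'c: "\<And>n x c v. x \<in> S \<Longrightarrow> g' n x (c *s v) = c * g' n x v" by metis
  have Scent: "x \<in> S" if "x \<in> ball z r" for x using ballS[OF that] r by auto
  have bnd: "cmod (g' n x v - g' m x v) \<le> 2 * (1 / Suc n + 1 / Suc m) / r * norm v"
    if x: "x \<in> ball z r" for n m x v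
  proof -
    have 1: "cmod (g n y - g m y) \<le> 1 / Suc n + 1 / Suc m" if "y \<in> S" for y
      using gf[OF that, of n] gf[OF that, of m] norm_triangle_ineq4[of "g n y - f y" "g m y - f y"]
      by simp
    have "((\<lambda>z. g n z - g m z) has_derivative (\<lambda>v. g' n x v - g' m x v)) (at x)"
      by (intro has_derivative_diff g' Scent x)
    then show ?thesis
      by (intro holo_derivative_bound[OF holo_on_diff[OF g g] r ballS[OF x] 1])
        (use g'c Scent x in \<open>auto simp: algebra_simps\<close>)
  qed
  have lim0: "(\<lambda>n. inverse (real (Suc n))) \<longlonglongrightarrow> 0" by (rule LIMSEQ_inverse_real_of_nat)
  have small: "\<exists>N. \<forall>n\<ge>N. 4 / Suc n / r < e" if "e > 0" for e
  proof -
    have "(\<lambda>n. 4 * inverse (real (Suc n)) / r) \<longlonglongrightarrow> 4 * 0 / r" using r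
      by (intro tendsto_intros lim0) auto
    then have "eventually (\<lambda>n. 4 * inverse (real (Suc n)) / r < e) sequentially"
      using that by (intro order_tendstoD) auto
    then show ?thesis by (simp add: eventually_sequentially field_simps)
  qed
  have lim_ex: "\<exists>l. (\<lambda>n. g' n x v) \<longlonglongrightarrow> l" if x: "x \<in> ball z r" for x v
  proof -
    have "Cauchy (\<lambda>n. g' n x v)"
    proof (rule metric_CauchyI)
      fix e :: real assume "e > 0"
      then have "e / (norm v + 1) > 0" by (simp add: add_nonneg_pos)
      then obtain N where N: "\<forall>n\<ge>N. 4 / Suc n / r < e / (norm v + 1)" using small by blast
      have "dist (g' m x v) (g' n x v) < e" if mn: "m \<ge> N" "n \<ge> N" for m n
      proof -
        have "1 / Suc m \<le> 1 / Suc N" "1 / Suc n \<le> 1 / Suc N" using mn by (auto simp: field_simps)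
        then have "2 * (1 / Suc m + 1 / Suc n) / r \<le> 4 / Suc N / r"
          using r by (intro divide_right_mono) auto
        then have "dist (g' m x v) (g' n x v) \<le> 4 / Suc N / r * norm v"
          using order_trans[OF bnd[OF x, of m v n] mult_right_mono[OF _ norm_ge_zero]]
          by (simp only: dist_norm)
        also have "\<dots> \<le> e / (norm v + 1) * norm v" using N
          by (intro mult_right_mono) (auto intro: less_imp_le)
        also have "\<dots> < e" using \<open>e > 0\<close>
          by (simp add: pos_divide_less_eq add_pos_nonneg add_nonneg_pos distrib_left)
        finally show ?thesis .
      qed
      then show "\<exists>M. \<forall>m\<ge>M. \<forall>n\<ge>M. dist (g' m x v) (g' n x v) < e" by blast
    qed
    then show ?thesis using Cauchy_convergent convergent_def by blast
  qed
  then obtain G where G: "\<And>x v. x \<in> ball z r \<Longrightarrow> (\<lambda>n. g' n x v) \<longlonglongrightarrow> G x v" by metis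
  have bndG: "cmod (g' n x v - G x v) \<le> 2 * (1 / Suc n) / r * norm v"
    if x: "x \<in> ball z r" for n x v
  proof (rule tendsto_le[OF trivial_limit_sequentially])
    show "(\<lambda>m. cmod (g' n x v - g' m x v)) \<longlonglongrightarrow> cmod (g' n x v - G x v)"
      by (intro tendsto_intros G x)
    have "(\<lambda>m. 2 * (1 / Suc n + inverse (Suc m)) / r * norm v)
           \<longlonglongrightarrow> 2 * (1 / Suc n + 0) / r * norm v"
      using r by (intro tendsto_intros lim0) auto
    then show "(\<lambda>m. 2 * (1 / Suc n + 1 / Suc m) / r * norm v) \<longlonglongrightarrow> 2 * (1 / Suc n) / r * norm v"
      by (simp add: inverse_eq_divide)
    show "\<forall>\<^sub>F m in sequentially. cmod (g' n x v - g' m x v)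
        \<le> 2 * (1 / Suc n + 1 / Suc m) / r * norm v"
      using bnd[OF x] by auto
  qed
  have "\<exists>h. \<forall>x\<in>ball z r. (\<lambda>n. g n x) \<longlonglongrightarrow> h x \<and> (h has_derivative G x) (at x within ball z r)"
  proof (rule has_derivative_sequence[where f = g and f' = g'])
    show "convex (ball z r)" by simp
    show "(g n has_derivative g' n x) (at x within ball z r)" if "x \<in> ball z r" for n x
      using g'[OF Scent[OF that]] has_derivative_at_withinI by blast
    show "\<forall>\<^sub>F n in sequentially. \<forall>x\<in>ball z r. \<forall>h. norm (g' n x h - G x h) \<le> e * norm h"
      if e: "e > 0" for e
    proof -
      obtain N where N: "\<forall>n\<ge>N. 4 / Suc n / r < e" using small e by blast
      have "norm (g' n x h - G x h) \<le> e * norm h" if "n \<ge> N" "x \<in> ball z r" for n x h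
      proof -
        have "2 * (1 / Suc n) / r \<le> 4 / Suc n / r" using r by (intro divide_right_mono) (auto simp: divide_simps)
        also have "\<dots> \<le> e" using N that by (auto intro: less_imp_le)
        finally show ?thesis using bndG[OF that(2), of n h]
          by (meson mult_right_mono norm_ge_zero order_trans)
      qed
      then show ?thesis unfolding eventually_sequentially by blast
    qed
    show "z \<in> ball z r" using r by simp
    have "(\<lambda>n. g n z - f z) \<longlonglongrightarrow> 0"
      by (rule Lim_null_comparison[OF _ lim0])
        (use gf[OF \<open>z \<in> S\<close>] in \<open>auto simp: inverse_eq_divide\<close>)
    then show "(\<lambda>n. g n z) \<longlonglongrightarrow> f z" by (simp add: LIM_zero_iff)
  qed
  then obtain h where h: "\<And>x. x \<in> ball z r \<Longrightarrow> (\<lambda>n. g n x) \<longlonglongrightarrow> h x"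
    "\<And>x. x \<in> ball z r \<Longrightarrow> (h has_derivative G x) (at x within ball z r)" by blast
  have "h x = f x" if "x \<in> ball z r" for x
  proof -
    have "(\<lambda>n. g n x - f x) \<longlonglongrightarrow> 0"
      by (rule Lim_null_comparison[OF _ lim0])
        (use gf[OF Scent[OF that]] in \<open>auto simp: inverse_eq_divide\<close>)
    then have "(\<lambda>n. g n x) \<longlonglongrightarrow> f x" by (simp add: LIM_zero_iff)
    then show ?thesis using h(1)[OF that] LIMSEQ_unique by blast
  qed
  moreover have zz: "z \<in> ball z r" using r by simp
  moreover have "(h has_derivative G z) (at z)" using h(2)[OF zz] at_within_open[OF zz] by simp
  ultimately have "(f has_derivative G z) (at z)"
    by (metis has_derivative_transform_within_open open_ball)
  moreover have "G z (c *s v) = c * G z v" for c v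
    using tendsto_mult_left[OF G[OF zz, of v], of c] G[OF zz, of "c *s v"] g'c[OF \<open>z \<in> S\<close>]
      LIMSEQ_unique by (simp add: LIMSEQ_unique)
  ultimately show "\<exists>L. (f has_derivative L) (at z) \<and> (\<forall>c v. L (c *s v) = c * L v)" by blast
qed

text \<open>The complex line through the centre and a given point of the ball meets the ball in a disc, to
  which the identity theorem in one variable applies.\<close>

lemma holo_on_zero_on_ball:
  fixes f :: "complex^'n \<Rightarrow> complex"
  assumes f: "holo_on f (ball b R)" and U: "open U" "b \<in> U"
    and 0: "\<And>z. z \<in> U \<Longrightarrow> f z = 0" and z: "z \<in> ball b R"
  shows "f z = 0"
proof -
  define T where "T = {t. b + t *s (z - b) \<in> ball b R}"
  have T: "T = ball 0 (R / norm (z - b))" if "z \<noteq> b"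
  proof -
    have "dist b (b + t *s (z - b)) = cmod t * norm (z - b)" for t
      using norm_vector_scalar_mult[of t "z - b"] by (simp add: dist_norm norm_minus_commute)
    then show ?thesis using that by (auto simp: T_def field_simps)
  qed
  define q where "q t = f (b + t *s (z - b))" for t
  have qhol: "q holomorphic_on T" unfolding q_def by (rule holo_on_slice[OF f]) (auto simp: T_def)
  show ?thesis
  proof (cases "z = b")
    case True then show ?thesis using U 0 by simp
  next
    case False
    have "R > 0" using z by (auto intro: le_less_trans[OF zero_le_dist])
    have "q 1 = 0"
    proof (rule analytic_continuation_open[where s = "T \<inter> {t. b + t *s (z - b) \<in> U}" and s' = T and f = q and g = "\<lambda>_. 0"])
      show "open (T \<inter> {t. b + t *s (z - b) \<in> U})"
        unfolding T_def by (intro open_Int open_slice U open_ball)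
      have "0 \<in> T \<inter> {t. b + t *s (z - b) \<in> U}"
        using U \<open>R > 0\<close> by (auto simp: T_def)
      then show "T \<inter> {t. b + t *s (z - b) \<in> U} \<noteq> {}" by blast
      show "open T" "connected T" using T[OF False] by auto
      show "1 \<in> T" using z by (simp add: T_def)
    qed (use qhol 0 in \<open>auto simp: q_def\<close>)
    then show ?thesis by (simp add: q_def)
  qed
qed

text \<open>The set of points near which \<open>f\<close> vanishes is open by definition. It is also closed in \<open>S\<close>,
  because a limit point lies in a ball around one of its members.\<close>

lemma holo_on_identity:
  fixes f :: "complex^'n \<Rightarrow> complex"
  assumes f: "holo_on f S" and S: "open S" "connected S"
    and U: "open U" "U \<noteq> {}" "U \<subseteq> S" and 0: "\<And>z. z \<in> U \<Longrightarrow> f z = 0" and z: "z \<in> S"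
  shows "f z = 0"
proof -
  define P where "P a \<longleftrightarrow> (\<exists>V. open V \<and> a \<in> V \<and> (\<forall>x\<in>V. f x = 0))" for a
  obtain a where a: "a \<in> U" using U(2) by blast
  have "P z"
  proof (rule connected_induction_simple[OF S(2) _ z, where a = a])
    fix b assume "b \<in> S"
    then obtain e where e: "e > 0" "ball b e \<subseteq> S" using S(1) by (metis openE)
    have "P y" if x: "x \<in> ball b (e/4)" "P x" and y: "y \<in> ball b (e/4)" for x y
    proof -
      obtain V where V: "open V" "x \<in> V" "\<forall>x\<in>V. f x = 0" using x(2) by (auto simp: P_def)
      have "ball x (e/2) \<subseteq> S"
        using x(1) e(1) by (intro order_trans[OF _ e(2)]) (auto simp: ball_subset_ball_iff dist_commute)
      then have "\<forall>y\<in>ball x (e/2). f y = 0"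
        using holo_on_zero_on_ball[OF holo_on_subset[OF f] V(1,2)] V(3) by blast
      moreover have "y \<in> ball x (e/2)" using x(1) y dist_triangle2[of x y b] by (auto simp: dist_commute)
      ultimately show ?thesis unfolding P_def by blast
    qed
    moreover have "openin (top_of_set S) (ball b (e/4))"
      using e by (intro open_subset) (auto simp: subset_iff)
    moreover have "b \<in> ball b (e/4)" using e(1) by simp
    ultimately show "\<exists>T. openin (top_of_set S) T \<and> b \<in> T \<and> (\<forall>x\<in>T. \<forall>y\<in>T. P x \<longrightarrow> P y)"
      by blast
  qed (use a U 0 in \<open>auto simp: P_def\<close>)
  then show ?thesis by (auto simp: P_def)
qed

section \<open>Extrapolation from small circles\<close>

lemma sum_roots_of_unity_power:
  fixes N m a :: nat
  assumes "a < N"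
  shows "(\<Sum>k<N. cis (2 * pi * real k / real N) ^ m / cis (2 * pi * real k / real N) ^ a)
    = (if m mod N = a then of_nat N else 0)"
proof -
  have N: "N > 0" using assms by simp
  define w where "w = cis (2 * pi * (real m - real a) / real N)"
  have term_eq: "cis (2 * pi * real k / real N) ^ m / cis (2 * pi * real k / real N) ^ a = w ^ k" for k
    unfolding w_def Complex.DeMoivre cis_divide
    by (rule arg_cong[of _ _ cis]) (simp add: algebra_simps diff_divide_distrib)
  have "w ^ N = cis (2 * pi * (real m - real a))"
    using N by (simp add: w_def Complex.DeMoivre)
  also have "\<dots> = cis (2 * pi * of_int (int m - int a))" by simp
  also have "\<dots> = 1" by (rule cis_multiple_2pi) (auto simp: Ints_of_int)
  finally have wN: "w ^ N = 1" .
  show ?thesis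
  proof (cases "m mod N = a")
    case True
    then have "real m - real a = real N * real (m div N)"
      by (metis add_diff_cancel_right' mult_div_mod_eq of_nat_add of_nat_mult)
    then have "2 * pi * (real m - real a) / real N = 2 * pi * real (m div N)" using N by simp
    then have "w = cis (2 * pi * real (m div N))" by (simp only: w_def)
    also have "\<dots> = 1" by (rule cis_multiple_2pi) auto
    finally have "w = 1" .
    then show ?thesis using True by (simp add: term_eq)
  next
    case False
    have "w \<noteq> 1"
    proof
      assume "w = 1"
      then have "cos (2 * pi * (real m - real a) / real N) = 1"
        by (metis w_def cis.sel(1) one_complex.sel(1))
      then obtain j :: int where "2 * pi * (real m - real a) / real N = of_int j * 2 * pi"
        by (auto simp: cos_one_2pi_int)
      then have "(2 * pi) * ((real m - real a) / real N) = (2 * pi) * of_int j"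
        by (simp only: mult_ac times_divide_eq_right times_divide_eq_left)
      then have "(real m - real a) / real N = of_int j" by (simp only: mult_cancel_left) simp
      then have "real m - real a = of_int j * real N" using N by (simp add: field_simps)
      then have "int m - int a = j * int N"
        by (metis of_int_diff of_int_eq_iff of_int_mult of_int_of_nat_eq)
      then have "int m = int a + j * int N" by simp
      then have "int m mod int N = int a mod int N" by simp
      then show False using False assms by (simp flip: of_nat_mod)
    qed
    then have "(\<Sum>k<N. w ^ k) = 0" using wN by (simp add: geometric_sum)
    then show ?thesis using False by (simp add: term_eq)
  qed
qed

text \<open>Evaluation of a bounded holomorphic function at points of a disc is recovered from finitely
  many values on an arbitrarily small circle: the interpolation polynomial at \<open>N\<close> equidistant nodes
  reproduces the first \<open>N\<close> powers and maps \<open>t\<^sup>m\<close> for \<open>m \<ge> N\<close> to a multiple of a monomial, bounded by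
  \<open>r\<^sup>m\<close> on the disc of radius \<open>r\<close>; so the error is controlled by a tail of the Taylor series.\<close>

lemma circle_interpolation:
  fixes \<delta> r R e :: real
  assumes "0 < \<delta>" "\<delta> \<le> r" "r < R" "0 < e"
  obtains N :: nat and x :: "nat \<Rightarrow> complex" and l :: "nat \<Rightarrow> complex \<Rightarrow> complex"
  where "0 < N" "\<And>k. cmod (x k) = \<delta>" "\<And>k. l k holomorphic_on UNIV" "\<And>k. l k 0 = 1 / of_nat N"
    "\<And>f M \<tau>. f holomorphic_on ball 0 R \<Longrightarrow> (\<And>t. t \<in> ball 0 R \<Longrightarrow> cmod (f t) \<le> M) \<Longrightarrow> cmod \<tau> \<le> r
      \<Longrightarrow> cmod (f \<tau> - (\<Sum>k<N. l k \<tau> * f (x k))) \<le> e * M"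
proof -
  \<comment> \<open>Cauchy's estimate needs a radius strictly between \<open>r\<close> and \<open>R\<close>; the Taylor coefficients are
    bounded by \<open>M / \<rho>\<^sup>m\<close>\<close>
  define \<rho> where "\<rho> = (r + R) / 2"
  have \<rho>: "r < \<rho>" "\<rho> < R" "0 < \<rho>" "0 < r" using assms by (auto simp: \<rho>_def)
  define q where "q = r / \<rho>"
  have q: "0 < q" "q < 1" using \<rho> by (auto simp: q_def)
  have "(\<lambda>N. 2 * q ^ N / (1 - q)) \<longlonglongrightarrow> 2 * 0 / (1 - q)"
    using q by (intro tendsto_intros LIMSEQ_power_zero) auto
  then have "eventually (\<lambda>N. 2 * q ^ N / (1 - q) < e) sequentially"
    using assms by (intro order_tendstoD) auto
  then have "eventually (\<lambda>N. 2 * q ^ N / (1 - q) < e \<and> N > 0) sequentially"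
    by (intro eventually_conj eventually_gt_at_top)
  then obtain N where N: "2 * q ^ N / (1 - q) < e" "N > 0"
    by (auto simp: eventually_sequentially)
  define \<zeta> where "\<zeta> k = cis (2 * pi * real k / real N)" for k
  define x where "x k = of_real \<delta> * \<zeta> k" for k
  define l where "l k \<tau> = (\<Sum>a<N. (\<tau> / x k) ^ a) / of_nat N" for k \<tau>
  have x: "cmod (x k) = \<delta>" for k using assms by (simp add: x_def \<zeta>_def norm_mult)
  have x0: "x k \<noteq> 0" for k using x[of k] assms by auto
  have l: "l k holomorphic_on UNIV" for k
    unfolding l_def using x0 by (intro holomorphic_intros) (auto simp: N)
  have l0: "l k 0 = 1 / of_nat N" for k
    using N(2) by (simp add: l_def power_0_left)
  have mono: "(\<Sum>k<N. l k \<tau> * x k ^ m) = \<tau> ^ (m mod N) * of_real \<delta> ^ (m - m mod N)" for \<tau> m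
  proof -
    have "(\<Sum>k<N. l k \<tau> * x k ^ m) = (\<Sum>k<N. \<Sum>a<N. \<tau> ^ a * (x k ^ m / x k ^ a) / of_nat N)"
      by (simp add: l_def sum_distrib_right sum_divide_distrib power_divide)
    also have "\<dots> = (\<Sum>a<N. \<Sum>k<N. \<tau> ^ a * (x k ^ m / x k ^ a) / of_nat N)" by (rule sum.swap)
    also have "\<dots> = (\<Sum>a<N. \<tau> ^ a * (of_real \<delta> ^ m / of_real \<delta> ^ a) *
        (\<Sum>k<N. \<zeta> k ^ m / \<zeta> k ^ a) / of_nat N)"
      by (simp add: x_def power_mult_distrib sum_distrib_left sum_divide_distrib mult.assoc)
    also have "\<dots> = (\<Sum>a<N. if m mod N = a then \<tau> ^ a * (of_real \<delta> ^ m / of_real \<delta> ^ a) else 0)"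
      unfolding \<zeta>_def using N by (intro sum.cong refl) (auto simp: sum_roots_of_unity_power)
    also have "\<dots> = \<tau> ^ (m mod N) * (of_real \<delta> ^ m / of_real \<delta> ^ (m mod N))"
      using N by (subst sum.delta') auto
    finally show ?thesis using assms by (simp add: power_diff)
  qed
  have "cmod (f \<tau> - (\<Sum>k<N. l k \<tau> * f (x k))) \<le> e * M"
    if f: "f holomorphic_on ball 0 R" and M: "\<And>t. t \<in> ball 0 R \<Longrightarrow> cmod (f t) \<le> M"
      and \<tau>: "cmod \<tau> \<le> r" for f M \<tau>
  proof -
    define c where "c m = (deriv ^^ m) f 0 / fact m" for m
    have "cmod (f 0) \<le> M" using M[of 0] \<rho> by simp
    then have M0: "M \<ge> 0" using norm_ge_zero order_trans by blast
    have c: "cmod (c m) \<le> M / \<rho> ^ m" for m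
    proof -
      have "cmod ((deriv ^^ m) f 0) \<le> fact m * M / \<rho> ^ m"
        using \<rho> M holomorphic_on_imp_continuous_on[OF f]
        by (intro Cauchy_inequality)
          (auto intro: holomorphic_on_subset[OF f] continuous_on_subset)
      then show ?thesis by (simp add: c_def norm_divide field_simps)
    qed
    have sums: "(\<lambda>m. c m * t ^ m) sums f t" if "t \<in> ball 0 R" for t
      using holomorphic_power_series[OF f that] by (simp add: c_def)
    have "(\<lambda>m. \<Sum>k<N. l k \<tau> * (c m * x k ^ m)) sums (\<Sum>k<N. l k \<tau> * f (x k))"
      by (intro sums_sum sums_mult sums) (use x assms in auto)
    moreover have "(\<Sum>k<N. l k \<tau> * (c m * x k ^ m))
        = c m * (\<tau> ^ (m mod N) * of_real \<delta> ^ (m - m mod N))" for m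
      using mono[of \<tau> m] by (simp add: sum_distrib_left mult_ac flip: mono)
    ultimately have diff: "(\<lambda>m. c m * \<tau> ^ m - c m * (\<tau> ^ (m mod N) * of_real \<delta> ^ (m - m mod N)))
        sums (f \<tau> - (\<Sum>k<N. l k \<tau> * f (x k)))"
      using \<tau> assms by (intro sums_diff sums) auto
    define d where "d m = c m * \<tau> ^ m - c m * (\<tau> ^ (m mod N) * of_real \<delta> ^ (m - m mod N))" for m
    have "d sums (f \<tau> - (\<Sum>k<N. l k \<tau> * f (x k)))" using diff by (simp only: d_def[abs_def])
    moreover have "(\<Sum>m<N. d m) = 0" by (simp add: d_def)
    ultimately have ds: "(\<lambda>m. d (m + N)) sums (f \<tau> - (\<Sum>k<N. l k \<tau> * f (x k)))"
      using sums_iff_shift'[of d N] sums_iff_shift[of d N] by simp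
    have dbound: "cmod (d m) \<le> 2 * M * q ^ m" for m
    proof -
      have "cmod (\<tau> ^ m) \<le> r ^ m" using \<tau> by (simp add: norm_power power_mono)
      moreover have "cmod (\<tau> ^ (m mod N) * of_real \<delta> ^ (m - m mod N)) \<le> r ^ m"
      proof -
        have "cmod (\<tau> ^ (m mod N) * of_real \<delta> ^ (m - m mod N)) \<le> r ^ (m mod N) * r ^ (m - m mod N)"
          using \<tau> assms by (auto simp: norm_mult norm_power intro!: mult_mono power_mono)
        also have "\<dots> = r ^ m" by (simp flip: power_add)
        finally show ?thesis .
      qed
      ultimately have "cmod (\<tau> ^ m - \<tau> ^ (m mod N) * of_real \<delta> ^ (m - m mod N)) \<le> 2 * r ^ m"
        by (intro order_trans[OF norm_triangle_ineq4]) auto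
      then have "cmod (c m) * cmod (\<tau> ^ m - \<tau> ^ (m mod N) * of_real \<delta> ^ (m - m mod N))
          \<le> M / \<rho> ^ m * (2 * r ^ m)"
        using c M0 \<rho> by (intro mult_mono) auto
      then show ?thesis
        by (simp add: d_def q_def power_divide norm_mult flip: right_diff_distrib) (simp add: mult_ac)
    qed
    have gs: "(\<lambda>m. 2 * M * q ^ N * q ^ m) sums (2 * M * q ^ N * (1 / (1 - q)))"
      using q by (intro sums_mult geometric_sums) auto
    have "cmod (f \<tau> - (\<Sum>k<N. l k \<tau> * f (x k))) = cmod (\<Sum>m. d (m + N))"
      using ds sums_unique by fastforce
    also have "\<dots> \<le> (\<Sum>m. 2 * M * q ^ N * q ^ m)"
      using dbound[of "_ + N"] sums_summable[OF gs]
      by (intro norm_suminf_le) (simp_all only: power_add mult_ac)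
    also have "\<dots> = 2 * q ^ N / (1 - q) * M"
      by (subst sums_unique[OF gs, symmetric]) simp
    also have "\<dots> \<le> e * M" using N M0 by (intro mult_right_mono) auto
    finally show ?thesis .
  qed
  then show thesis using that[of N x l] N(2) x l l0 by blast
qed

section \<open>Sesqui-holomorphic functions and the diagonal\<close>

lemma sesqui_holo_on_subset: "sesqui_holo_on F S \<Longrightarrow> T \<subseteq> S \<Longrightarrow> sesqui_holo_on F T"
  unfolding sesqui_holo_on_def antiholo_on_def by (meson holo_on_subset subsetD)

text \<open>Osgood's lemma, restricted to the diagonal: interpolation in the second variable approximates
  \<open>H\<close> uniformly by finite sums of products of holomorphic functions of one variable.\<close>

lemma holomorphic_on_separate_slice:
  fixes H :: "complex \<Rightarrow> complex \<Rightarrow> complex"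
  assumes R: "R > 0"
    and 1: "\<And>\<sigma>. \<sigma> \<in> ball 0 R \<Longrightarrow> (\<lambda>\<tau>. H \<tau> \<sigma>) holomorphic_on ball 0 R"
    and 2: "\<And>\<tau>. \<tau> \<in> ball 0 R \<Longrightarrow> (\<lambda>\<sigma>. H \<tau> \<sigma>) holomorphic_on ball 0 R"
    and M: "\<And>\<tau> \<sigma>. \<tau> \<in> ball 0 R \<Longrightarrow> \<sigma> \<in> ball 0 R \<Longrightarrow> cmod (H \<tau> \<sigma>) \<le> M"
  shows "(\<lambda>\<tau>. H \<tau> \<tau>) holomorphic_on ball 0 (R/2)"
proof -
  have "cmod (H 0 0) \<le> M" using M R by simp
  then have M0: "M \<ge> 0" using norm_ge_zero order_trans by blast
  have "\<exists>g. g holomorphic_on ball 0 R \<and> (\<forall>\<tau>\<in>cball 0 (R/2). cmod (g \<tau> - H \<tau> \<tau>) < 1 / Suc n)" for n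
  proof -
    define e where "e = 1 / (Suc n * (M + 1))"
    have e: "0 < e" using M0 by (simp add: e_def)
    have R': "0 < R/2" "R/2 \<le> R/2" "R/2 < R" using R by auto
    obtain N x l where x: "\<And>k::nat. cmod (x k) = R/2" and l: "\<And>k::nat. l k holomorphic_on UNIV"
      and appr: "\<And>f M \<tau>. f holomorphic_on ball 0 R \<Longrightarrow> (\<And>t. t \<in> ball 0 R \<Longrightarrow> cmod (f t) \<le> M) \<Longrightarrow>
          cmod \<tau> \<le> R/2 \<Longrightarrow> cmod (f \<tau> - (\<Sum>k<N. l k \<tau> * f (x k))) \<le> e * M"
      by (rule circle_interpolation[OF R' e]) blast
    have "cmod (H \<tau> \<tau> - (\<Sum>k<N. l k \<tau> * H \<tau> (x k))) < 1 / Suc n" if "\<tau> \<in> cball 0 (R/2)" for \<tau>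
    proof -
      have "\<tau> \<in> ball 0 R" using that R by auto
      then have "cmod (H \<tau> \<tau> - (\<Sum>k<N. l k \<tau> * H \<tau> (x k))) \<le> e * M"
        using that by (intro appr 2 M) auto
      also have "\<dots> = 1 / Suc n * (M / (M + 1))" by (simp add: e_def)
      also have "\<dots> < 1 / Suc n * 1" using M0 by (intro mult_strict_left_mono) auto
      also have "\<dots> = 1 / Suc n" by simp
      finally show ?thesis .
    qed
    moreover have "(\<lambda>\<tau>. \<Sum>k<N. l k \<tau> * H \<tau> (x k)) holomorphic_on ball 0 R"
      using R by (intro holomorphic_intros 1 holomorphic_on_subset[OF l]) (auto simp: x)
    ultimately show ?thesis by (auto simp: norm_minus_commute)
  qed
  then obtain g where g: "\<And>n. g n holomorphic_on ball 0 R"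
    "\<And>n \<tau>. \<tau> \<in> cball 0 (R/2) \<Longrightarrow> cmod (g n \<tau> - H \<tau> \<tau>) < 1 / Suc n" by metis
  have "uniform_limit (cball 0 (R/2)) g (\<lambda>\<tau>. H \<tau> \<tau>) sequentially"
  proof (rule uniform_limitI)
    fix e :: real assume "e > 0"
    then obtain N where N: "N > 0" "inverse (real N) < e" using ex_inverse_of_nat_less by blast
    have "dist (g n \<tau>) (H \<tau> \<tau>) < e" if "n \<ge> N" "\<tau> \<in> cball 0 (R/2)" for n \<tau>
    proof -
      have "1 / Suc n \<le> inverse (real N)" using that N by (simp add: field_simps)
      then show ?thesis using g(2)[OF that(2), of n] N by (simp add: dist_norm)
    qed
    then show "\<forall>\<^sub>F n in sequentially. \<forall>x\<in>cball 0 (R/2). dist (g n x) (H x x) < e"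
      unfolding eventually_sequentially by blast
  qed
  moreover have "\<forall>\<^sub>F n in sequentially. continuous_on (cball 0 (R/2)) (g n) \<and> g n holomorphic_on ball 0 (R/2)"
    using R by (intro always_eventually allI conjI holomorphic_on_imp_continuous_on
        holomorphic_on_subset[OF g(1)]) auto
  ultimately show ?thesis
    using holomorphic_uniform_limit[of 0 "R/2" g sequentially] by (metis trivial_limit_sequentially)
qed

lemma sesqui_holo_on_slice:
  fixes F :: "complex^'n \<Rightarrow> complex^'n \<Rightarrow> complex"
  assumes F: "sesqui_holo_on F S" and S: "open S"
    and M: "\<And>z w. z \<in> S \<Longrightarrow> w \<in> S \<Longrightarrow> cmod (F z w) \<le> M"
    and T: "T = {\<tau>. Z + \<tau> *s V \<in> S \<and> Z + cnj \<tau> *s V \<in> S}"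
  shows "(\<lambda>\<tau>. F (Z + \<tau> *s V) (Z + cnj \<tau> *s V)) holomorphic_on T"
proof -
  have open_pre: "open {\<tau>. Z + \<tau> *s V \<in> S}" by (rule open_slice[OF S])
  have "open ((\<lambda>\<tau>. cnj \<tau>) -` {\<tau>. Z + \<tau> *s V \<in> S})"
    by (rule open_vimage[OF open_pre]) (intro continuous_intros)
  then have oT: "open T" using open_pre unfolding T by (simp add: Collect_conj_eq open_Int vimage_def)
  have "\<exists>e>0. (\<lambda>\<tau>. F (Z + \<tau> *s V) (Z + cnj \<tau> *s V)) holomorphic_on ball \<tau>0 e" if "\<tau>0 \<in> T" for \<tau>0
  proof -
    obtain R where R: "R > 0" "ball \<tau>0 R \<subseteq> T" using oT \<open>\<tau>0 \<in> T\<close> openE by blast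
    have in1: "Z + (\<tau>0 + \<tau>) *s V \<in> S" "Z + cnj (\<tau>0 + \<tau>) *s V \<in> S" if "\<tau> \<in> ball 0 R" for \<tau>
    proof -
      have "\<tau>0 + \<tau> \<in> T" using that R(2) by (auto simp: dist_norm)
      then show "Z + (\<tau>0 + \<tau>) *s V \<in> S" "Z + cnj (\<tau>0 + \<tau>) *s V \<in> S" by (auto simp: T)
    qed
    define H where "H \<tau> \<sigma> = F (Z + (\<tau>0 + \<tau>) *s V) (Z + cnj (\<tau>0 + \<sigma>) *s V)" for \<tau> \<sigma>
    have h1: "(\<lambda>\<tau>. H \<tau> \<sigma>) holomorphic_on ball 0 R" if "\<sigma> \<in> ball 0 R" for \<sigma>
    proof -
      have "holo_on (\<lambda>z. F z (Z + cnj (\<tau>0 + \<sigma>) *s V)) S"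
        using F in1[OF that] by (simp add: sesqui_holo_on_def)
      from holo_on_slice[OF this, of "ball 0 R" "Z + \<tau>0 *s V" V] in1 show ?thesis
        by (simp add: H_def vector_sadd_rdistrib add.assoc)
    qed
    have h2: "(\<lambda>\<sigma>. H \<tau> \<sigma>) holomorphic_on ball 0 R" if "\<tau> \<in> ball 0 R" for \<tau>
    proof -
      have "holo_on (\<lambda>w. cnj (F (Z + (\<tau>0 + \<tau>) *s V) w)) S"
        using F in1[OF that] by (simp add: sesqui_holo_on_def antiholo_on_def)
      then have "(\<lambda>s. cnj (F (Z + (\<tau>0 + \<tau>) *s V) ((Z + cnj \<tau>0 *s V) + s *s V))) holomorphic_on ball 0 R"
      proof (rule holo_on_slice)
        fix s assume "s \<in> ball (0::complex) R"
        then have "cnj s \<in> ball 0 R" by simp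
        from in1(2)[OF this] show "Z + cnj \<tau>0 *s V + s *s V \<in> S"
          by (simp add: vector_sadd_rdistrib add.assoc)
      qed
      moreover have "cnj ` ball 0 R = ball 0 R"
        by (auto simp: image_iff intro!: bexI[of _ "cnj _"])
      ultimately have "(cnj \<circ> (\<lambda>s. cnj (F (Z + (\<tau>0 + \<tau>) *s V) ((Z + cnj \<tau>0 *s V) + s *s V))) \<circ> cnj)
          holomorphic_on ball 0 R"
        by (intro holomorphic_on_compose_cnj_cnj) auto
      then show ?thesis
        by (simp add: H_def o_def vector_sadd_rdistrib add.assoc)
    qed
    have hM: "cmod (H \<tau> \<sigma>) \<le> M" if "\<tau> \<in> ball 0 R" "\<sigma> \<in> ball 0 R" for \<tau> \<sigma>
      unfolding H_def by (intro M in1 that)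
    have "(\<lambda>\<tau>. H \<tau> \<tau>) holomorphic_on ball 0 (R/2)"
      by (rule holomorphic_on_separate_slice[OF R(1) h1 h2 hM])
    then have "((\<lambda>\<tau>. H \<tau> \<tau>) \<circ> (\<lambda>\<tau>. \<tau> - \<tau>0)) holomorphic_on ball \<tau>0 (R/2)"
      by (intro holomorphic_on_compose_gen[where t = "ball 0 (R/2)"] holomorphic_intros)
        (auto simp: dist_norm norm_minus_commute)
    then show ?thesis using R by (intro exI[of _ "R/2"]) (simp add: H_def o_def)
  qed
  then show ?thesis
    by (metis (mono_tags, lifting) analytic_imp_holomorphic analytic_on_def)
qed

text \<open>The points \<open>z, w\<close> lie on the curve \<open>\<tau> \<mapsto> (Z + \<tau>V, Z + cnj \<tau> V)\<close> at \<open>\<tau> = \<i>\<close>, where \<open>Z\<close> is their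
  midpoint; real \<open>\<tau>\<close> are mapped to the diagonal.\<close>

lemma sesqui_zero_if_zero_on_diagonal:
  fixes F :: "complex^'n \<Rightarrow> complex^'n \<Rightarrow> complex"
  assumes F: "sesqui_holo_on F S" and S: "open S" "convex S"
    and M: "\<And>z w. z \<in> S \<Longrightarrow> w \<in> S \<Longrightarrow> cmod (F z w) \<le> M"
    and diag: "\<And>z. z \<in> S \<Longrightarrow> F z z = 0" and zw: "z \<in> S" "w \<in> S"
  shows "F z w = 0"
proof -
  define Z where "Z = (1/2) *s (z + w)"
  define V where "V = (1/(2*\<i>)) *s (z - w)"
  define T where "T = {\<tau>. Z + \<tau> *s V \<in> S \<and> Z + cnj \<tau> *s V \<in> S}"
  have zV: "Z + \<i> *s V = z" "Z + cnj \<i> *s V = w" "Z - \<i> *s V = w"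
    by (auto simp: Z_def V_def vec_eq_iff field_simps)
  have "Z = (1/2) *\<^sub>R z + (1/2) *\<^sub>R w"
    by (simp add: Z_def vec_eq_iff scaleR_conv_of_real[where 'a = complex] field_simps)
  then have ZS: "Z \<in> S" using convexD[OF S(2) zw, of "1/2" "1/2"] by simp
  have open_pre: "open {\<tau>. Z + \<tau> *s V \<in> S}" by (rule open_slice[OF S(1)])
  have "open ((\<lambda>\<tau>. cnj \<tau>) -` {\<tau>. Z + \<tau> *s V \<in> S})"
    by (rule open_vimage[OF open_pre]) (intro continuous_intros)
  then have oT: "open T" using open_pre unfolding T_def by (simp add: Collect_conj_eq open_Int vimage_def)
  have "convex T"
    unfolding convex_alt
  proof (intro ballI allI impI)
    fix s t :: complex and u :: real
    assume st: "s \<in> T" "t \<in> T" and u: "0 \<le> u \<and> u \<le> 1"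
    have "Z + ((1 - u) *\<^sub>R s + u *\<^sub>R t) *s V = (1 - u) *\<^sub>R (Z + s *s V) + u *\<^sub>R (Z + t *s V)"
      "Z + cnj ((1 - u) *\<^sub>R s + u *\<^sub>R t) *s V
        = (1 - u) *\<^sub>R (Z + cnj s *s V) + u *\<^sub>R (Z + cnj t *s V)"
      by (simp_all add: vec_eq_iff scaleR_conv_of_real[where 'a = complex] algebra_simps)
    then show "(1 - u) *\<^sub>R s + u *\<^sub>R t \<in> T"
      using st u S(2) unfolding convex_alt T_def by auto
  qed
  then have cT: "connected T" by (rule convex_connected)
  have "0 \<in> T" "\<i> \<in> T" using ZS zw zV by (auto simp: T_def)
  obtain e where e: "e > 0" "ball 0 e \<subseteq> T" using oT \<open>0 \<in> T\<close> openE by blast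
  define U where "U = complex_of_real ` {-e<..<e}"
  have "F (Z + \<i> *s V) (Z + cnj \<i> *s V) = 0"
  proof (rule analytic_continuation[where f = "\<lambda>\<tau>. F (Z + \<tau> *s V) (Z + cnj \<tau> *s V)"
        and S = T and U = U and \<xi> = 0])
    show "(\<lambda>\<tau>. F (Z + \<tau> *s V) (Z + cnj \<tau> *s V)) holomorphic_on T"
      by (rule sesqui_holo_on_slice[OF F S(1) M T_def])
    have Ue: "U \<subseteq> ball 0 e" by (auto simp: U_def)
    then show "U \<subseteq> T" using e by auto
    show "0 islimpt U"
      unfolding islimpt_approachable
    proof (intro allI impI)
      fix d :: real assume "d > 0"
      then show "\<exists>x'\<in>U. x' \<noteq> 0 \<and> dist x' 0 < d" using e
        unfolding U_def
        by (intro bexI[of _ "of_real (min d e / 2)"] imageI) (auto simp: min_def)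
    qed
    fix t assume t: "t \<in> U"
    then have "cnj t = t" "t \<in> T" using Ue e by (auto simp: U_def)
    then show "F (Z + t *s V) (Z + cnj t *s V) = 0" using diag by (simp add: T_def)
  qed (use oT cT \<open>0 \<in> T\<close> \<open>\<i> \<in> T\<close> in auto)
  then show ?thesis using zV by simp
qed

section \<open>Positive semidefinite kernels\<close>

text \<open>Points may be repeated, so that finite combinations of point evaluations can be added freely.
  Real parts are compared; for Hermitian kernels the sum is real.\<close>

definition psd_kernel :: "('a \<Rightarrow> 'a \<Rightarrow> complex) \<Rightarrow> 'a set \<Rightarrow> bool" where
  "psd_kernel F U \<longleftrightarrow> (\<forall>(m::nat) z c. (\<forall>i<m. z i \<in> U) \<longrightarrow>
     0 \<le> Re (\<Sum>i<m. \<Sum>j<m. c i * cnj (c j) * F (z i) (z j)))"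

lemma psd_kernel_subset: "psd_kernel F U \<Longrightarrow> V \<subseteq> U \<Longrightarrow> psd_kernel F V"
  unfolding psd_kernel_def by (meson subsetD)

lemma psd_kernel_cong:
  assumes "\<And>z w. z \<in> U \<Longrightarrow> w \<in> U \<Longrightarrow> F z w = G z w" "psd_kernel F U"
  shows "psd_kernel G U"
  unfolding psd_kernel_def
proof (intro allI impI)
  fix m :: nat and z c assume z: "\<forall>i<m. z i \<in> U"
  then have "(\<Sum>i<m. \<Sum>j<m. c i * cnj (c j) * G (z i) (z j))
      = (\<Sum>i<m. \<Sum>j<m. c i * cnj (c j) * F (z i) (z j))"
    using assms(1) by (intro sum.cong refl) auto
  then show "0 \<le> Re (\<Sum>i<m. \<Sum>j<m. c i * cnj (c j) * G (z i) (z j))"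
    using assms(2) z by (simp only: psd_kernel_def)
qed

lemma psd_kernel_family:
  assumes F: "psd_kernel F U" and I: "finite I" "\<And>i. i \<in> I \<Longrightarrow> z i \<in> U"
  shows "0 \<le> Re (\<Sum>i\<in>I. \<Sum>j\<in>I. c i * cnj (c j) * F (z i) (z j))"
proof -
  obtain h where h: "bij_betw h {0..<card I} I" using ex_bij_betw_nat_finite[OF I(1)] by blast
  then have h': "bij_betw h {..<card I} I" by (simp add: atLeast0LessThan)
  have "(\<Sum>i\<in>I. \<Sum>j\<in>I. c i * cnj (c j) * F (z i) (z j))
     = (\<Sum>i<card I. \<Sum>j<card I. c (h i) * cnj (c (h j)) * F (z (h i)) (z (h j)))"
    by (simp flip: sum.reindex_bij_betw[OF h'])
  also have "0 \<le> Re \<dots>"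
    using F[unfolded psd_kernel_def, rule_format, of "card I" "\<lambda>i. z (h i)" "\<lambda>i. c (h i)"]
      I(2) bij_betwE[OF h'] by auto
  finally show ?thesis .
qed

text \<open>Calabi's principle that positivity of a sesqui-holomorphic kernel spreads: a quadratic form in
  values at points of the large ball is the limit of quadratic forms in values at points of the
  small ball, obtained by interpolation along the rays from the centre.\<close>

lemma psd_kernel_ball_extend:
  fixes F :: "complex^'n \<Rightarrow> complex^'n \<Rightarrow> complex"
  assumes F: "sesqui_holo_on F (ball b R)"
    and M: "\<And>z w. z \<in> ball b R \<Longrightarrow> w \<in> ball b R \<Longrightarrow> cmod (F z w) \<le> M"
    and psd: "psd_kernel F (ball b t)" and t: "0 < t"
  shows "psd_kernel F (ball b R)"
  unfolding psd_kernel_def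
proof (intro allI impI)
  fix m :: nat and z :: "nat \<Rightarrow> complex^'n" and c assume z: "\<forall>i<m. z i \<in> ball b R"
  \<comment> \<open>The rays are \<open>\<tau> \<mapsto> b + \<tau> v i\<close>, and \<open>\<tau> = 1\<close> is the given point. They stay in the large ball for
    \<open>\<bar>\<tau>\<bar> < \<rho>\<close> with some \<open>\<rho> > 1\<close>, and in the small one for \<open>\<bar>\<tau>\<bar> = \<delta>\<close>. \<open>B\<close> and \<open>B'\<close> bound the lengths of
    the \<open>v i\<close>; the entries \<open>1\<close> and \<open>R / 2\<close> only keep the bounds positive.\<close>
  define v where "v i = z i - b" for i
  define B where "B = Max (insert 1 ((\<lambda>i. norm (v i)) ` {..<m}))"
  define B' where "B' = Max (insert (R / 2) ((\<lambda>i. norm (v i)) ` {..<m}))"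
  show "0 \<le> Re (\<Sum>i<m. \<Sum>j<m. c i * cnj (c j) * F (z i) (z j))"
  proof (cases "m = 0")
    case False
    then have "z 0 \<in> ball b R" using z by simp
    then have R: "R > 0" by (metis dist_eq_0_iff less_irrefl mem_ball zero_le_dist order_le_less_trans)
    have "cmod (F b b) \<le> M" using M R by simp
    then have M0: "M \<ge> 0" using norm_ge_zero order_trans by blast
    have B: "B \<ge> 1" "\<And>i. i < m \<Longrightarrow> norm (v i) \<le> B" by (auto simp: B_def)
    have B': "B' \<ge> R/2" "\<And>i. i < m \<Longrightarrow> norm (v i) \<le> B'"
      unfolding B'_def by (intro Max_ge; simp)+
    have B'R: "B' < R" using R z unfolding B'_def
      by (subst Max_less_iff) (auto simp: v_def dist_norm norm_minus_commute)
    define \<rho> where "\<rho> = R / B'"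
    have \<rho>: "\<rho> > 1" using B' B'R R by (auto simp: \<rho>_def field_simps)
    define \<delta> where "\<delta> = min 1 (t / (2 * B))"
    have \<delta>: "0 < \<delta>" "\<delta> \<le> 1" using t B by (auto simp: \<delta>_def)
    have big: "b + \<tau> *s v i \<in> ball b R" if "\<tau> \<in> ball 0 \<rho>" "i < m" for \<tau> i
    proof -
      have B'0: "B' > 0" using B'(1) R by linarith
      have "cmod \<tau> * norm (v i) \<le> cmod \<tau> * B'" by (intro mult_left_mono B' that) auto
      also have "\<dots> < R" using that B'0 by (simp add: \<rho>_def field_simps)
      finally show ?thesis by (simp add: dist_norm norm_vector_scalar_mult)
    qed
    have small: "b + \<tau> *s v i \<in> ball b t" if "cmod \<tau> = \<delta>" "i < m" for \<tau> i
    proof -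
      have "cmod \<tau> * norm (v i) \<le> t / (2 * B) * B"
        using that t B by (intro mult_mono B) (auto simp: \<delta>_def)
      also have "\<dots> < t" using t B by (simp add: field_simps)
      finally show ?thesis by (simp add: dist_norm norm_vector_scalar_mult)
    qed
    define C where "C = (\<Sum>i<m. \<Sum>j<m. cmod (c i) * cmod (c j) * M)"
    have key: "- (C * (e + e * (1 + e))) \<le> Re (\<Sum>i<m. \<Sum>j<m. c i * cnj (c j) * F (z i) (z j))"
      if e: "e > 0" for e
    proof -
      obtain N x l where x: "\<And>k::nat. cmod (x k) = \<delta>" and "\<And>k::nat. l k holomorphic_on UNIV"
        and appr: "\<And>f M \<tau>. f holomorphic_on ball 0 \<rho> \<Longrightarrow> (\<And>t. t \<in> ball 0 \<rho> \<Longrightarrow> cmod (f t) \<le> M) \<Longrightarrow>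
            cmod \<tau> \<le> 1 \<Longrightarrow> cmod (f \<tau> - (\<Sum>k<N. l k \<tau> * f (x k))) \<le> e * M"
        by (rule circle_interpolation[OF \<delta> \<rho> e]) blast
      \<comment> \<open>the weights that recover the value at \<open>\<tau> = 1\<close>; the same weights serve for all rays\<close>
      define a where "a k = l k 1" for k
      have ap: "cmod (f 1 - (\<Sum>k<N. a k * f (x k))) \<le> e * M'"
        if "f holomorphic_on ball 0 \<rho>" "\<And>t. t \<in> ball 0 \<rho> \<Longrightarrow> cmod (f t) \<le> M'" for f M'
        using appr[OF that, of 1] by (simp add: a_def)
      have x\<rho>: "x k \<in> ball 0 \<rho>" for k using x[of k] \<delta> \<rho> by simp
      have one: "1 \<in> ball (0::complex) \<rho>" using \<rho> by simp
      have z1: "b + 1 *s v i = z i" for i by (simp add: v_def)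
      define G where "G i j = (\<Sum>k<N. \<Sum>k'<N. a k * cnj (a k') * F (b + x k *s v i) (b + x k' *s v j))" for i j
      have GF: "cmod (G i j - F (z i) (z j)) \<le> (e + e * (1 + e)) * M" if ij: "i < m" "j < m" for i j
      proof -
        define h where "h \<tau> = (\<Sum>k'<N. cnj (a k') * F (b + \<tau> *s v i) (b + x k' *s v j))" for \<tau>
        have hol1: "(\<lambda>\<tau>. F (b + \<tau> *s v i) w) holomorphic_on ball 0 \<rho>" if "w \<in> ball b R" for w
          using F that big[OF _ ij(1)] by (intro holo_on_slice) (auto simp: sesqui_holo_on_def)
        have hol2: "(\<lambda>\<tau>. cnj (F y (b + \<tau> *s v j))) holomorphic_on ball 0 \<rho>" if "y \<in> ball b R" for y
          using F that big[OF _ ij(2)]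
          by (intro holo_on_slice[where f = "\<lambda>w. cnj (F y w)"]) (auto simp: sesqui_holo_on_def antiholo_on_def)
        have h: "h holomorphic_on ball 0 \<rho>"
          unfolding h_def by (intro holomorphic_intros hol1 big x\<rho> ij)
        have hF: "cmod (h \<tau> - F (b + \<tau> *s v i) (z j)) \<le> e * M" if \<tau>: "\<tau> \<in> ball 0 \<rho>" for \<tau>
        proof -
          have "cmod (cnj (F (b + \<tau> *s v i) (b + 1 *s v j))
              - (\<Sum>k<N. a k * cnj (F (b + \<tau> *s v i) (b + x k *s v j)))) \<le> e * M"
            by (intro ap[of "\<lambda>\<sigma>. cnj (F (b + \<tau> *s v i) (b + \<sigma> *s v j))"] hol2 big \<tau> ij)
              (simp only: complex_mod_cnj, intro M big \<tau> ij)
          also have "cnj (F (b + \<tau> *s v i) (b + 1 *s v j))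
              - (\<Sum>k<N. a k * cnj (F (b + \<tau> *s v i) (b + x k *s v j)))
              = cnj (F (b + \<tau> *s v i) (z j) - h \<tau>)"
            by (simp add: h_def z1[simplified])
          finally show ?thesis by (simp only: complex_mod_cnj norm_minus_commute)
        qed
        have "cmod (h \<tau>) \<le> (1 + e) * M" if \<tau>: "\<tau> \<in> ball 0 \<rho>" for \<tau>
        proof -
          have "cmod (F (b + \<tau> *s v i) (z j)) \<le> M" using z ij by (intro M big \<tau>) auto
          then show ?thesis using hF[OF \<tau>] norm_triangle_sub[of "h \<tau>" "F (b + \<tau> *s v i) (z j)"]
            by (simp add: algebra_simps)
        qed
        then have "cmod (h 1 - (\<Sum>k<N. a k * h (x k))) \<le> e * ((1 + e) * M)" by (intro ap h)
        moreover have "(\<Sum>k<N. a k * h (x k)) = G i j"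
          by (simp add: G_def h_def sum_distrib_left mult.assoc)
        moreover have "cmod (h 1 - F (z i) (z j)) \<le> e * M" using hF[OF one] z1 by simp
        moreover have "G i j - F (z i) (z j) = (h 1 - F (z i) (z j)) - (h 1 - G i j)" by simp
        ultimately have "cmod (G i j - F (z i) (z j)) \<le> e * M + e * ((1 + e) * M)"
          by (smt (verit) norm_triangle_ineq4)
        then show ?thesis by (simp add: algebra_simps)
      qed
      have pairs: "(\<Sum>i<m. \<Sum>k<N. g i k) = (\<Sum>p\<in>{..<m}\<times>{..<N}. g (fst p) (snd p))"
        for g :: "nat \<Rightarrow> nat \<Rightarrow> complex"
        by (simp add: sum.cartesian_product case_prod_beta)
      have Gpos: "0 \<le> Re (\<Sum>i<m. \<Sum>j<m. c i * cnj (c j) * G i j)"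
      proof -
        have "(\<Sum>i<m. \<Sum>j<m. c i * cnj (c j) * G i j) =
            (\<Sum>i<m. \<Sum>j<m. \<Sum>k<N. \<Sum>k'<N. (c i * a k) * cnj (c j * a k') * F (b + x k *s v i) (b + x k' *s v j))"
          by (simp add: G_def sum_distrib_left mult_ac)
        also have "\<dots> = (\<Sum>i<m. \<Sum>k<N. \<Sum>j<m. \<Sum>k'<N. (c i * a k) * cnj (c j * a k') * F (b + x k *s v i) (b + x k' *s v j))"
          by (intro sum.cong refl sum.swap)
        also have "\<dots> = (\<Sum>p\<in>{..<m}\<times>{..<N}. \<Sum>p'\<in>{..<m}\<times>{..<N}.
            (c (fst p) * a (snd p)) * cnj (c (fst p') * a (snd p'))
              * F (b + x (snd p) *s v (fst p)) (b + x (snd p') *s v (fst p')))"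
          by (simp only: pairs)
        also have "0 \<le> Re \<dots>"
          by (rule psd_kernel_family[OF psd]) (auto intro!: small x simp del: mem_ball)
        finally show ?thesis .
      qed
      have "cmod ((\<Sum>i<m. \<Sum>j<m. c i * cnj (c j) * G i j) - (\<Sum>i<m. \<Sum>j<m. c i * cnj (c j) * F (z i) (z j)))
          = cmod (\<Sum>i<m. \<Sum>j<m. c i * cnj (c j) * (G i j - F (z i) (z j)))"
        by (simp add: right_diff_distrib sum_subtractf)
      also have "\<dots> \<le> (\<Sum>i<m. \<Sum>j<m. cmod (c i) * cmod (c j) * ((e + e * (1 + e)) * M))"
        by (intro sum_norm_le) (auto simp: norm_mult intro!: mult_left_mono GF)
      also have "\<dots> = C * (e + e * (1 + e))"
        by (simp add: C_def sum_distrib_left sum_distrib_right mult_ac)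
      finally show ?thesis using Gpos abs_Re_le_cmod[of "(\<Sum>i<m. \<Sum>j<m. c i * cnj (c j) * G i j) - (\<Sum>i<m. \<Sum>j<m. c i * cnj (c j) * F (z i) (z j))"]
        by (simp only: minus_complex.sel)
    qed
    define A where "A = Re (\<Sum>i<m. \<Sum>j<m. c i * cnj (c j) * F (z i) (z j))"
    have C0: "C \<ge> 0" unfolding C_def using M0 by (intro mult_nonneg_nonneg sum_nonneg) auto
    have "((\<lambda>e. - (C * (e + e * (1 + e)))) \<longlongrightarrow> - (C * (0 + 0 * (1 + 0)))) (at_right 0)"
      by (intro tendsto_intros)
    then have "- (C * (0 + 0 * (1 + 0))) \<le> A"
      by (rule tendsto_upperbound)
        (use key in \<open>auto simp: A_def eventually_at_right_field intro!: exI[of _ 1]\<close>)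
    then show ?thesis by (simp add: A_def)
  qed auto
qed

section \<open>Lebesgue measure and linear isometries\<close>

lemma nn_integral_lborel_translate:
  fixes f :: "'a::euclidean_space \<Rightarrow> ennreal"
  assumes [measurable]: "f \<in> borel_measurable borel"
  shows "(\<integral>\<^sup>+x. f (x + a) \<partial>lborel) = (\<integral>\<^sup>+x. f x \<partial>lborel)"
proof -
  have 1: "lborel = distr lborel borel (\<lambda>x. a + x)"
    using lborel_affine[of 1 a] by (simp add: density_1)
  have "(\<integral>\<^sup>+x. f x \<partial>lborel) = (\<integral>\<^sup>+x. f x \<partial>distr lborel borel (\<lambda>x. a + x))" using 1 by simp
  also have "\<dots> = (\<integral>\<^sup>+x. f (a + x) \<partial>lborel)" by (subst nn_integral_distr) auto
  finally show ?thesis by (simp add: add.commute)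
qed

text \<open>Translation invariance and Fubini's theorem, applied to
  \<open>\<integral>\<integral> 1\<^sub>B(x) 1\<^sub>E(T v + x) dx dv\<close> with the unit ball \<open>B\<close>, show that the image of Lebesgue measure
  under an isometry \<open>T\<close> is proportional to Lebesgue measure; the factor is \<open>1\<close> because \<open>T\<close>
  preserves \<open>B\<close>.\<close>

lemma distr_lborel_linear_isometry:
  fixes T :: "'a::euclidean_space \<Rightarrow> 'a"
  assumes T: "linear T" and n: "\<And>x. norm (T x) = norm x"
  shows "distr lborel borel T = lborel"
proof (rule measure_eqI)
  fix E assume "E \<in> sets (distr lborel borel T)"
  then have E[measurable]: "E \<in> sets borel" by simp
  have "inj T" using T n by (metis linear_injective_0 norm_eq_zero)
  then have "surj T" using T linear_injective_imp_surjective by blast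
  then obtain T' where T': "\<And>x. T (T' x) = x" by (metis surjD)
  have Tm[measurable]: "T \<in> borel_measurable borel"
    using T by (intro borel_measurable_continuous_onI linear_continuous_on linear_conv_bounded_linear[THEN iffD1])
  define B where "B = ball (0::'a) 1"
  have [measurable]: "B \<in> sets borel" by (simp add: B_def)
  have vB: "emeasure lborel (ball c 1 :: 'a set) = emeasure lborel B" for c :: 'a
  proof -
    have "(\<integral>\<^sup>+x. indicator B (x + (- c)) \<partial>lborel) = emeasure lborel B"
      by (subst nn_integral_lborel_translate) (auto intro!: borel_measurable_indicator)
    moreover have "indicator B (x + (- c)) = (indicator (ball c 1) x :: ennreal)" for x
      by (auto simp: B_def indicator_def dist_norm norm_minus_commute)
    ultimately show ?thesis by simp
  qed
  have "emeasure lborel B * emeasure (distr lborel borel T) E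
     = (\<integral>\<^sup>+x. indicator B x * emeasure (distr lborel borel T) E \<partial>lborel)"
    by (simp add: nn_integral_multc)
  also have "\<dots> = (\<integral>\<^sup>+x. indicator B x * (\<integral>\<^sup>+v. indicator E (T v) \<partial>lborel) \<partial>lborel)"
  proof -
    have "emeasure (distr lborel borel T) E = (\<integral>\<^sup>+v. indicator E v \<partial>distr lborel borel T)" by simp
    also have "\<dots> = (\<integral>\<^sup>+v. indicator E (T v) \<partial>lborel)" by (subst nn_integral_distr) auto
    finally show ?thesis by simp
  qed
  also have "\<dots> = (\<integral>\<^sup>+x. indicator B x * (\<integral>\<^sup>+v. indicator E (T v + x) \<partial>lborel) \<partial>lborel)"
  proof (intro nn_integral_cong)
    fix x :: 'a
    have "(\<integral>\<^sup>+v. indicator E (T (v + T' x)) \<partial>lborel) = (\<integral>\<^sup>+v. indicator E (T v) \<partial>lborel :: ennreal)"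
      by (rule nn_integral_lborel_translate) measurable
    then show "indicator B x * (\<integral>\<^sup>+v. indicator E (T v) \<partial>lborel) =
       (indicator B x * (\<integral>\<^sup>+v. indicator E (T v + x) \<partial>lborel) :: ennreal)"
      using T' by (simp add: linear_add[OF T])
  qed
  also have "\<dots> = (\<integral>\<^sup>+x. (\<integral>\<^sup>+v. indicator B x * indicator E (T v + x) \<partial>lborel) \<partial>lborel)"
    by (intro nn_integral_cong nn_integral_cmult[symmetric]) measurable
  also have "\<dots> = (\<integral>\<^sup>+v. (\<integral>\<^sup>+x. indicator B x * indicator E (T v + x) \<partial>lborel) \<partial>lborel)"
    by (rule lborel_pair.Fubini') measurable
  also have "\<dots> = (\<integral>\<^sup>+v. (\<integral>\<^sup>+x. indicator B (x - T v) * indicator E x \<partial>lborel) \<partial>lborel)"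
  proof (rule nn_integral_cong)
    fix v :: 'a
    have "(\<integral>\<^sup>+x. indicator B (x + T v - T v) * indicator E (x + T v) \<partial>lborel)
       = (\<integral>\<^sup>+x. indicator B (x - T v) * indicator E x \<partial>lborel :: ennreal)"
      by (rule nn_integral_lborel_translate[where f = "\<lambda>x. indicator B (x - T v) * indicator E x"]) measurable
    then show "(\<integral>\<^sup>+x. indicator B x * indicator E (T v + x) \<partial>lborel) =
       (\<integral>\<^sup>+x. indicator B (x - T v) * indicator E x \<partial>lborel :: ennreal)"
      by (simp add: add.commute)
  qed
  also have "\<dots> = (\<integral>\<^sup>+x. (\<integral>\<^sup>+v. indicator B (x - T v) * indicator E x \<partial>lborel) \<partial>lborel)"
    by (rule lborel_pair.Fubini') measurable
  also have "\<dots> = (\<integral>\<^sup>+x. emeasure lborel B * indicator E x \<partial>lborel)"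
  proof (intro nn_integral_cong)
    fix x :: 'a
    have "indicator B (x - T v) = (indicator (ball (T' x) 1) v :: ennreal)" for v
    proof -
      have "norm (x - T v) = norm (T (T' x - v))" using T T' by (simp add: linear_diff)
      then show ?thesis using n by (simp add: B_def indicator_def dist_norm norm_minus_commute)
    qed
    then show "(\<integral>\<^sup>+v. indicator B (x - T v) * indicator E x \<partial>lborel) = emeasure lborel B * indicator E x"
      by (simp only:) (subst nn_integral_multc; auto intro!: borel_measurable_indicator simp: vB)
  qed
  also have "\<dots> = emeasure lborel B * emeasure lborel E" by (simp add: nn_integral_cmult)
  finally have "emeasure lborel B * emeasure (distr lborel borel T) E
      = emeasure lborel B * emeasure lborel E" .
  moreover have "emeasure lborel B \<noteq> 0"
    using content_ball_pos[of 1 "0::'a"] by (auto simp: B_def measure_def)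
  moreover have "emeasure lborel B \<noteq> \<infinity>" using emeasure_lborel_ball_finite[of "0::'a" 1] by (auto simp: B_def)
  ultimately show "emeasure (distr lborel borel T) E = emeasure lborel E"
    by (simp add: ennreal_mult_cancel_left)
qed simp

section \<open>The Bergman space is complete\<close>

text \<open>Averaging over the rotations by all roots of unity leaves the integral over a ball unchanged
  and, by the interpolation estimate at the origin, turns the function into its value at the
  centre up to a small error.\<close>

lemma holo_mean_value_inequality:
  fixes f :: "complex^'n \<Rightarrow> complex"
  assumes f: "holo_on f S" and r: "0 < r" and sub: "cball x (2 * r) \<subseteq> S"
  shows "ennreal (cmod (f x)) * emeasure lborel (ball 0 r :: (complex^'n) set)
     \<le> (\<integral>\<^sup>+y\<in>ball x r. ennreal (cmod (f y)) \<partial>lborel)"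
proof -
  define g where "g v = ennreal (indicator (ball 0 r) v *\<^sub>R cmod (f (x + v)))" for v :: "complex^'n"
  have inS: "x + v \<in> S" if "norm v \<le> 2 * r" for v using that sub by (auto simp: dist_norm)
  have cont: "continuous_on (cball x (2 * r)) f"
    using holo_on_imp_continuous_on[OF f] sub continuous_on_subset by blast
  obtain M where "0 \<le> M" and M: "\<And>y. y \<in> cball x (2 * r) \<Longrightarrow> cmod (f y) \<le> M"
    by (rule continuous_on_compact_bound[OF compact_cball cont]) blast
  have g[measurable]: "g \<in> borel_measurable borel"
    unfolding g_def
  proof (intro measurable_compose[OF _ measurable_ennreal] borel_measurable_continuous_on_indicator)
    show "ball 0 r \<in> sets borel" by simp
    have "continuous_on (ball 0 r) (\<lambda>v. f (x + v))"
      by (rule continuous_on_compose2[OF cont]) (use r in \<open>auto intro!: continuous_intros simp: dist_norm\<close>)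
    then show "continuous_on (ball 0 r) (\<lambda>v. cmod (f (x + v)))" by (intro continuous_intros)
  qed
  define I where "I = (\<integral>\<^sup>+v. g v \<partial>lborel)"
  define V where "V = emeasure lborel (ball 0 r :: (complex^'n) set)"
  have rot: "(\<integral>\<^sup>+v. g (c *s v) \<partial>lborel) = I" if "cmod c = 1" for c
  proof -
    have T: "linear (\<lambda>v. c *s v :: complex^'n)"
      by (rule linearI) (auto simp: vec_eq_iff algebra_simps)
    have [measurable]: "(\<lambda>v. c *s v :: complex^'n) \<in> borel_measurable borel"
      using T by (intro borel_measurable_continuous_onI linear_continuous_on linear_conv_bounded_linear[THEN iffD1])
    have "I = (\<integral>\<^sup>+v. g v \<partial>distr lborel borel (\<lambda>v. c *s v))"
      unfolding I_def by (subst distr_lborel_linear_isometry[OF T]) (auto simp: norm_vector_scalar_mult that)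
    also have "\<dots> = (\<integral>\<^sup>+v. g (c *s v) \<partial>lborel)" by (subst nn_integral_distr) auto
    finally show ?thesis by simp
  qed
  have key: "ennreal (cmod (f x)) * V \<le> I + ennreal (e * M) * V" if e: "e > 0" for e
  proof -
    have 012: "0 < (1::real)" "1 \<le> (1::real)" "1 < (2::real)" by auto
    obtain N x' l where N: "0 < (N::nat)" and x': "\<And>k::nat. cmod (x' k) = 1"
      and "\<And>k::nat. l k holomorphic_on UNIV" and l0: "\<And>k. l k 0 = 1 / of_nat N"
      and appr: "\<And>f M \<tau>. f holomorphic_on ball 0 2 \<Longrightarrow> (\<And>t. t \<in> ball 0 2 \<Longrightarrow> cmod (f t) \<le> M) \<Longrightarrow>
          cmod \<tau> \<le> 1 \<Longrightarrow> cmod (f \<tau> - (\<Sum>k<N. l k \<tau> * f (x' k))) \<le> e * M"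
      by (rule circle_interpolation[OF 012 e]) blast
    have point: "ennreal (cmod (f x)) * indicator (ball 0 r) (v :: complex^'n) \<le>
        (\<Sum>k<N. ennreal (1 / N) * g (x' k *s v)) + ennreal (e * M) * indicator (ball 0 r) v" for v
    proof (cases "v \<in> ball 0 r")
      case True
      have ball: "x + t *s v \<in> cball x (2 * r)" if "t \<in> ball 0 2" for t
      proof -
        have "cmod t * norm v \<le> 2 * r" using that True by (intro mult_mono) auto
        then show ?thesis by (simp add: dist_norm norm_vector_scalar_mult)
      qed
      have "cmod (f (x + 0 *s v) - (\<Sum>k<N. l k 0 * f (x + x' k *s v))) \<le> e * M"
        using ball sub by (intro appr[of "\<lambda>t. f (x + t *s v)"] holo_on_slice[OF f] M) auto
      moreover have "x + 0 *s v = x" by simp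
      ultimately have "cmod (f x) \<le> cmod (\<Sum>k<N. l k 0 * f (x + x' k *s v)) + e * M"
        using norm_triangle_sub[of "f x" "\<Sum>k<N. l k 0 * f (x + x' k *s v)"] by simp
      also have "cmod (\<Sum>k<N. l k 0 * f (x + x' k *s v)) \<le> (\<Sum>k<N. 1 / N * cmod (f (x + x' k *s v)))"
        by (intro sum_norm_le) (simp add: l0 norm_mult norm_divide)
      finally have "ennreal (cmod (f x)) \<le> ennreal ((\<Sum>k<N. 1 / N * cmod (f (x + x' k *s v))) + e * M)"
        by (simp add: ennreal_leI)
      also have "\<dots> = (\<Sum>k<N. ennreal (1 / N * cmod (f (x + x' k *s v)))) + ennreal (e * M)"
        using e \<open>0 \<le> M\<close> by (subst ennreal_plus) (auto intro!: sum_nonneg simp: sum_ennreal)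
      also have "(\<Sum>k<N. ennreal (1 / N * cmod (f (x + x' k *s v))))
          = (\<Sum>k<N. ennreal (1 / N) * g (x' k *s v))"
        using True by (intro sum.cong refl, subst ennreal_mult)
          (auto simp: g_def norm_vector_scalar_mult x')
      finally show ?thesis using True by simp
    qed auto
    have [measurable]: "(\<lambda>v. g (x' k *s v)) \<in> borel_measurable borel" for k
    proof -
      have "linear (\<lambda>v. x' k *s v :: complex^'n)"
        by (rule linearI) (auto simp: vec_eq_iff algebra_simps)
      then have "(\<lambda>v. x' k *s v :: complex^'n) \<in> borel_measurable borel"
        by (intro borel_measurable_continuous_onI linear_continuous_on linear_conv_bounded_linear[THEN iffD1])
      from measurable_compose[OF this g] show ?thesis .
    qed
    have [measurable]: "(\<lambda>v::complex^'n. ennreal (e * M) * indicator (ball 0 r) v) \<in> borel_measurable borel"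
      by (intro borel_measurable_times_ennreal borel_measurable_const borel_measurable_indicator) auto
    have "ennreal (cmod (f x)) * V
        = (\<integral>\<^sup>+v. ennreal (cmod (f x)) * indicator (ball 0 r) (v :: complex^'n) \<partial>lborel)"
      by (subst nn_integral_cmult) (auto simp: V_def intro!: borel_measurable_indicator)
    also have "\<dots> \<le> (\<integral>\<^sup>+v. (\<Sum>k<N. ennreal (1 / N) * g (x' k *s v)) + ennreal (e * M) * indicator (ball 0 r) v \<partial>lborel)"
      by (intro nn_integral_mono point)
    also have "\<dots> = (\<Sum>k<N. ennreal (1 / N) * I) + ennreal (e * M) * V"
      by (subst nn_integral_add)
        (auto simp: nn_integral_sum nn_integral_cmult nn_integral_cmult_indicator rot x' V_def)
    also have "(\<Sum>k<N. ennreal (1 / N) * I) = I"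
    proof -
      have "(\<Sum>k<N. ennreal (1 / N) * I) = (of_nat N * ennreal (1 / N)) * I" by (simp add: mult.assoc)
      also have "of_nat N * ennreal (1 / N) = 1"
        using N by (simp add: ennreal_of_nat_eq_real_of_nat flip: ennreal_mult)
      finally show ?thesis by simp
    qed
    finally show ?thesis .
  qed
  have Vfin: "V < \<infinity>" using emeasure_lborel_ball_finite[of "0::complex^'n" r] by (simp add: V_def)
  have "((\<lambda>e. I + ennreal (e * M) * V) \<longlongrightarrow> I + ennreal (0 * M) * V) (at_right 0)"
    by (intro tendsto_intros ennreal_tendsto_cmult) (use Vfin in auto)
  then have "ennreal (cmod (f x)) * V \<le> I + ennreal (0 * M) * V"
    by (rule tendsto_lowerbound)
      (use key in \<open>auto simp: eventually_at_right_field intro!: exI[of _ 1]\<close>)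
  then have "ennreal (cmod (f x)) * V \<le> I" by simp
  also have "I = (\<integral>\<^sup>+y\<in>ball x r. ennreal (cmod (f y)) \<partial>lborel)"
  proof -
    have [measurable]: "(\<lambda>y. g (y - x)) \<in> borel_measurable borel" by measurable
    have "I = (\<integral>\<^sup>+y. g (y + x - x) \<partial>lborel)" by (simp add: I_def)
    also have "\<dots> = (\<integral>\<^sup>+y. g (y - x) \<partial>lborel)" by (rule nn_integral_lborel_translate) measurable
    also have "\<dots> = (\<integral>\<^sup>+y\<in>ball x r. ennreal (cmod (f y)) \<partial>lborel)"
      by (intro nn_integral_cong) (auto simp: g_def indicator_def dist_norm norm_minus_commute)
    finally show ?thesis .
  qed
  finally show ?thesis by (simp add: V_def)
qed

definition l2_sqnorm :: "(complex^'n) set \<Rightarrow> (complex^'n \<Rightarrow> complex) \<Rightarrow> real" where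
  "l2_sqnorm S f = (LINT z:S|lborel. (cmod (f z))\<^sup>2)"

definition ball_vol :: "'n::finite itself \<Rightarrow> real \<Rightarrow> real" where
  "ball_vol _ r = measure lborel (ball 0 r :: (complex^'n) set)"

lemma ball_vol_pos: "r > 0 \<Longrightarrow> ball_vol TYPE('n::finite) r > 0"
  unfolding ball_vol_def using content_ball_pos[of r "0 :: complex^'n"] by simp

lemma l2_sqnorm_nonneg: "l2_sqnorm S f \<ge> 0"
  unfolding l2_sqnorm_def set_lebesgue_integral_def by (intro integral_nonneg_AE) auto

lemma nn_integral_eq_l2_sqnorm:
  assumes "f \<in> bergman_fns S"
  shows "(\<integral>\<^sup>+z\<in>S. ennreal ((cmod (f z))\<^sup>2) \<partial>lborel) = ennreal (l2_sqnorm S f)"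
proof -
  have "integrable lborel (\<lambda>z. indicator S z *\<^sub>R (cmod (f z))\<^sup>2)"
    using assms by (simp add: bergman_fns_def set_integrable_def)
  from nn_integral_eq_integral[OF this] show ?thesis
    by (simp add: l2_sqnorm_def set_lebesgue_integral_def ennreal_mult' ennreal_indicator mult.commute)
qed

lemma holo_on_borel_measurable:
  fixes f :: "complex^'n \<Rightarrow> complex"
  assumes "holo_on f S" "open S"
  shows "(\<lambda>z. indicator S z *\<^sub>R f z) \<in> borel_measurable borel"
  using assms by (intro borel_measurable_continuous_on_indicator holo_on_imp_continuous_on) auto

lemma bergman_fns_measurable:
  assumes "f \<in> bergman_fns S" "open S"
  shows "f \<in> borel_measurable borel"
proof -
  have "f = (\<lambda>z. indicator S z *\<^sub>R f z)" using assms by (auto simp: bergman_fns_def indicator_def)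
  then show ?thesis using holo_on_borel_measurable[of f S] assms by (simp add: bergman_fns_def)
qed

lemma bergman_fnsI_nn_integral:
  assumes "open S" "holo_on f S" "\<And>z. z \<notin> S \<Longrightarrow> f z = 0"
    and "(\<integral>\<^sup>+z\<in>S. ennreal ((cmod (f z))\<^sup>2) \<partial>lborel) < \<infinity>"
  shows "f \<in> bergman_fns S"
proof -
  have "f = (\<lambda>z. indicator S z *\<^sub>R f z)" using assms(3) by (auto simp: indicator_def)
  then have [measurable]: "f \<in> borel_measurable borel"
    using holo_on_borel_measurable[OF assms(2,1)] by simp
  have [measurable]: "S \<in> sets borel" using assms by simp
  have "integrable lborel (\<lambda>z. indicator S z *\<^sub>R (cmod (f z))\<^sup>2)"
  proof (rule integrableI_bounded)
    show "(\<lambda>z. indicator S z *\<^sub>R (cmod (f z))\<^sup>2) \<in> borel_measurable lborel" by measurable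
    have "(\<integral>\<^sup>+z. ennreal (norm (indicator S z *\<^sub>R (cmod (f z))\<^sup>2)) \<partial>lborel)
        = (\<integral>\<^sup>+z\<in>S. ennreal ((cmod (f z))\<^sup>2) \<partial>lborel)"
      by (intro nn_integral_cong) (auto simp: indicator_def)
    then show "(\<integral>\<^sup>+z. ennreal (norm (indicator S z *\<^sub>R (cmod (f z))\<^sup>2)) \<partial>lborel) < \<infinity>"
      using assms(4) by simp
  qed
  then show ?thesis using assms by (simp add: bergman_fns_def set_integrable_def)
qed

text \<open>The mean value inequality is applied to the square of \<open>f\<close>, which is holomorphic as well.\<close>

lemma bergman_point_evaluation:
  fixes f :: "complex^'n \<Rightarrow> complex"
  assumes f: "f \<in> bergman_fns S" and r: "0 < r" "cball x (2 * r) \<subseteq> S"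
  shows "(cmod (f x))\<^sup>2 * ball_vol TYPE('n) r \<le> l2_sqnorm S f"
proof -
  have "ennreal (cmod ((f x)\<^sup>2)) * emeasure lborel (ball 0 r :: (complex^'n) set)
      \<le> (\<integral>\<^sup>+y\<in>ball x r. ennreal (cmod ((f y)\<^sup>2)) \<partial>lborel)"
    using f r by (intro holo_mean_value_inequality[where S = S] holo_on_power) (auto simp: bergman_fns_def)
  also have "\<dots> \<le> (\<integral>\<^sup>+y\<in>S. ennreal (cmod ((f y)\<^sup>2)) \<partial>lborel)"
    using r by (intro nn_integral_mono) (auto simp: indicator_def subset_iff)
  also have "\<dots> = ennreal (l2_sqnorm S f)"
    using nn_integral_eq_l2_sqnorm[OF f] by (simp add: norm_power)
  also have "emeasure lborel (ball 0 r :: (complex^'n) set) = ennreal (ball_vol TYPE('n) r)"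
    using emeasure_lborel_ball_finite[of "0::complex^'n" r] unfolding ball_vol_def
    by (intro emeasure_eq_ennreal_measure) auto
  finally have "ennreal ((cmod (f x))\<^sup>2) * ennreal (ball_vol TYPE('n) r) \<le> ennreal (l2_sqnorm S f)"
    by (simp add: norm_power)
  then show ?thesis
    by (simp add: l2_sqnorm_nonneg ball_vol_def flip: ennreal_mult')
qed

lemma bergman_fns_scale:
  assumes "f \<in> bergman_fns S" shows "(\<lambda>z. c * f z) \<in> bergman_fns S"
  using assms by (auto simp: bergman_fns_def norm_mult power_mult_distrib intro: holo_on_cmult)

lemma bergman_fns_add:
  assumes S: "open S" and f: "f \<in> bergman_fns S" and g: "g \<in> bergman_fns S"
  shows "(\<lambda>z. f z + g z) \<in> bergman_fns S"
proof -
  have [measurable]: "f \<in> borel_measurable borel" "g \<in> borel_measurable borel" "S \<in> sets borel"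
    using f g S by (auto intro: bergman_fns_measurable)
  have "set_integrable lborel S (\<lambda>z. 2 * (cmod (f z))\<^sup>2 + 2 * (cmod (g z))\<^sup>2)"
    using f g by (intro set_integral_add) (auto simp: bergman_fns_def)
  then have "set_integrable lborel S (\<lambda>z. (cmod (f z + g z))\<^sup>2)"
  proof (rule set_integrable_bound)
    show "set_borel_measurable lborel S (\<lambda>z. (cmod (f z + g z))\<^sup>2)"
      unfolding set_borel_measurable_def by measurable
    show "AE z in lborel. z \<in> S \<longrightarrow> norm ((cmod (f z + g z))\<^sup>2) \<le> norm (2 * (cmod (f z))\<^sup>2 + 2 * (cmod (g z))\<^sup>2)"
    proof (intro AE_I2 impI)
      fix z
      have "(cmod (f z + g z))\<^sup>2 \<le> (cmod (f z) + cmod (g z))\<^sup>2"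
        by (intro power_mono norm_triangle_ineq) auto
      also have "\<dots> \<le> 2 * (cmod (f z))\<^sup>2 + 2 * (cmod (g z))\<^sup>2"
        using sum_squares_bound[of "cmod (f z)" "cmod (g z)"] by (simp add: power2_sum)
      finally show "norm ((cmod (f z + g z))\<^sup>2) \<le> norm (2 * (cmod (f z))\<^sup>2 + 2 * (cmod (g z))\<^sup>2)" by simp
    qed
  qed
  then show ?thesis using f g by (auto simp: bergman_fns_def intro: holo_on_add)
qed

lemma bergman_fns_diff:
  assumes "open S" "f \<in> bergman_fns S" "g \<in> bergman_fns S"
  shows "(\<lambda>z. f z - g z) \<in> bergman_fns S"
  using bergman_fns_add[OF assms(1,2) bergman_fns_scale[OF assms(3), of "-1"]] by simp

text \<open>A Cauchy sequence converges locally uniformly by the bound on point evaluations, so the limit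
  is holomorphic; Fatou's lemma gives convergence in the norm.\<close>

theorem bergman_fns_complete:
  fixes f :: "nat \<Rightarrow> complex^'n \<Rightarrow> complex"
  assumes S: "open S" and f: "\<And>n. f n \<in> bergman_fns S"
    and Cauchy: "\<And>e. e > 0 \<Longrightarrow> \<exists>N. \<forall>m\<ge>N. \<forall>n\<ge>N. l2_sqnorm S (\<lambda>z. f m z - f n z) < e"
  obtains g where "g \<in> bergman_fns S" "(\<lambda>n. l2_sqnorm S (\<lambda>z. f n z - g z)) \<longlonglongrightarrow> 0"
proof -
  have fd: "(\<lambda>z. f m z - f n z) \<in> bergman_fns S" for m n by (intro bergman_fns_diff S f)
  have locball: "\<exists>r>0. ball x r \<subseteq> S \<and> (\<forall>e>0. \<exists>N. \<forall>m\<ge>N. \<forall>n\<ge>N. \<forall>y\<in>ball x r. cmod (f m y - f n y) < e)"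
    if "x \<in> S" for x
  proof -
    obtain r0 where r0: "r0 > 0" "cball x r0 \<subseteq> S" using S \<open>x \<in> S\<close> open_contains_cball by blast
    define r where "r = r0 / 3"
    have r: "r > 0" using r0 by (simp add: r_def)
    have sub: "cball y (2 * r) \<subseteq> S" if "y \<in> ball x r" for y
      using that by (intro order_trans[OF _ r0(2)]) (auto simp: cball_subset_cball_iff r_def dist_commute)
    have "\<exists>N. \<forall>m\<ge>N. \<forall>n\<ge>N. \<forall>y\<in>ball x r. cmod (f m y - f n y) < e" if e: "e > 0" for e
    proof -
      have v: "ball_vol TYPE('n) r > 0" by (rule ball_vol_pos[OF r])
      then obtain N where N: "\<And>m n. m \<ge> N \<Longrightarrow> n \<ge> N \<Longrightarrow>
          l2_sqnorm S (\<lambda>z. f m z - f n z) < e\<^sup>2 * ball_vol TYPE('n) r"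
        using Cauchy[of "e\<^sup>2 * ball_vol TYPE('n) r"] e by auto
      have "cmod (f m y - f n y) < e" if "m \<ge> N" "n \<ge> N" "y \<in> ball x r" for m n y
      proof -
        have "(cmod (f m y - f n y))\<^sup>2 * ball_vol TYPE('n) r < e\<^sup>2 * ball_vol TYPE('n) r"
          using bergman_point_evaluation[OF fd r sub[OF that(3)], of m n] N[OF that(1,2)] by linarith
        then have "(cmod (f m y - f n y))\<^sup>2 < e\<^sup>2" using v by simp
        then show ?thesis using e power2_less_imp_less by fastforce
      qed
      then show ?thesis by blast
    qed
    moreover have "ball x r \<subseteq> S" using r0 by (auto simp: r_def subset_iff)
    ultimately show ?thesis using r by blast
  qed
  have "\<exists>l. (\<lambda>n. f n x) \<longlonglongrightarrow> l" if "x \<in> S" for x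
  proof -
    obtain r where r: "r > 0" "\<forall>e>0. \<exists>N. \<forall>m\<ge>N. \<forall>n\<ge>N. \<forall>y\<in>ball x r. cmod (f m y - f n y) < e"
      using locball[OF \<open>x \<in> S\<close>] by blast
    have "Cauchy (\<lambda>n. f n x)"
    proof (rule metric_CauchyI)
      fix e :: real assume "e > 0"
      then obtain N where "\<forall>m\<ge>N. \<forall>n\<ge>N. \<forall>y\<in>ball x r. cmod (f m y - f n y) < e" using r by blast
      moreover have "x \<in> ball x r" using r by simp
      ultimately show "\<exists>M. \<forall>m\<ge>M. \<forall>n\<ge>M. dist (f m x) (f n x) < e"
        unfolding dist_norm by blast
    qed
    then show ?thesis using Cauchy_convergent convergent_def by blast
  qed
  then obtain g0 where g0: "\<And>x. x \<in> S \<Longrightarrow> (\<lambda>n. f n x) \<longlonglongrightarrow> g0 x" by metis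
  define g where "g x = (if x \<in> S then g0 x else 0)" for x
  have f0: "f n x = 0" if "x \<notin> S" for n x using f[of n] that by (simp add: bergman_fns_def)
  have lim: "(\<lambda>n. f n x) \<longlonglongrightarrow> g x" for x using g0 f0 by (simp add: g_def)
  have "holo_on g S"
    unfolding holo_on_def
  proof
    fix x assume "x \<in> S"
    then obtain r where r: "r > 0" "ball x r \<subseteq> S"
      "\<forall>e>0. \<exists>N. \<forall>m\<ge>N. \<forall>n\<ge>N. \<forall>y\<in>ball x r. cmod (f m y - f n y) < e" using locball by blast
    have "holo_on g (ball x r)"
    proof (rule holo_on_uniform_closure)
      fix e :: real assume "e > 0"
      then obtain N where N: "\<forall>m\<ge>N. \<forall>n\<ge>N. \<forall>y\<in>ball x r. cmod (f m y - f n y) < e" using r by blast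
      have "cmod (f N y - g y) \<le> e" if "y \<in> ball x r" for y
      proof (rule tendsto_upperbound)
        show "(\<lambda>n. cmod (f N y - f n y)) \<longlonglongrightarrow> cmod (f N y - g y)" by (intro tendsto_intros lim)
        show "\<forall>\<^sub>F n in sequentially. cmod (f N y - f n y) \<le> e"
          using N that by (auto simp: eventually_sequentially intro!: exI[of _ N] less_imp_le)
      qed auto
      moreover have "holo_on (f N) (ball x r)"
        using f[of N] r(2) holo_on_subset by (auto simp: bergman_fns_def)
      ultimately show "\<exists>h. holo_on h (ball x r) \<and> (\<forall>y\<in>ball x r. cmod (h y - g y) \<le> e)" by blast
    qed auto
    then show "\<exists>L. (g has_derivative L) (at x) \<and> (\<forall>c v. L (c *s v) = c * L v)"
      using r(1) unfolding holo_on_def by auto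
  qed
  have [measurable]: "S \<in> sets borel" using S by simp
  have fm[measurable]: "f n \<in> borel_measurable borel" for n using bergman_fns_measurable[OF f S] .
  have bound: "(\<integral>\<^sup>+z\<in>S. ennreal ((cmod (f n z - g z))\<^sup>2) \<partial>lborel) \<le> ennreal e"
    if e: "e > 0" and N: "\<forall>m\<ge>N. l2_sqnorm S (\<lambda>z. f m z - f n z) < e" for N n e
  proof -
    have "(\<integral>\<^sup>+z\<in>S. ennreal ((cmod (f n z - g z))\<^sup>2) \<partial>lborel)
       = (\<integral>\<^sup>+z. liminf (\<lambda>m. ennreal ((cmod (f n z - f m z))\<^sup>2) * indicator S z) \<partial>lborel)"
    proof (intro nn_integral_cong)
      fix z
      have "(\<lambda>m. ennreal ((cmod (f n z - f m z))\<^sup>2) * indicator S z)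
          \<longlonglongrightarrow> ennreal ((cmod (f n z - g z))\<^sup>2) * indicator S z"
        by (cases "z \<in> S") (auto intro!: tendsto_intros lim)
      then show "ennreal ((cmod (f n z - g z))\<^sup>2) * indicator S z
          = liminf (\<lambda>m. ennreal ((cmod (f n z - f m z))\<^sup>2) * indicator S z)"
        by (simp add: lim_imp_Liminf)
    qed
    also have "\<dots> \<le> liminf (\<lambda>m. \<integral>\<^sup>+z\<in>S. ennreal ((cmod (f n z - f m z))\<^sup>2) \<partial>lborel)"
      by (rule nn_integral_liminf) measurable
    also have "\<dots> \<le> ennreal e"
    proof (rule Liminf_le)
      show "\<forall>\<^sub>F m in sequentially. (\<integral>\<^sup>+z\<in>S. ennreal ((cmod (f n z - f m z))\<^sup>2) \<partial>lborel) \<le> ennreal e"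
        unfolding eventually_sequentially
      proof (intro exI[of _ N] allI impI)
        fix m assume "m \<ge> N"
        have "(\<integral>\<^sup>+z\<in>S. ennreal ((cmod (f n z - f m z))\<^sup>2) \<partial>lborel) = ennreal (l2_sqnorm S (\<lambda>z. f m z - f n z))"
          using nn_integral_eq_l2_sqnorm[OF fd] by (simp add: norm_minus_commute)
        then show "(\<integral>\<^sup>+z\<in>S. ennreal ((cmod (f n z - f m z))\<^sup>2) \<partial>lborel) \<le> ennreal e"
          using N \<open>m \<ge> N\<close> by (simp add: ennreal_leI less_imp_le)
      qed
    qed simp
    finally show ?thesis .
  qed
  have fg: "(\<lambda>z. f n z - g z) \<in> bergman_fns S" if "\<forall>m\<ge>N. l2_sqnorm S (\<lambda>z. f m z - f n z) < e" "e > 0" for n N e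
  proof (rule bergman_fnsI_nn_integral[OF S])
    show "holo_on (\<lambda>z. f n z - g z) S"
      using f[of n] \<open>holo_on g S\<close> by (intro holo_on_diff) (auto simp: bergman_fns_def)
    show "f n z - g z = 0" if "z \<notin> S" for z using that f0 by (simp add: g_def)
    show "(\<integral>\<^sup>+z\<in>S. ennreal ((cmod (f n z - g z))\<^sup>2) \<partial>lborel) < \<infinity>"
      by (rule order.strict_trans1[OF bound[OF that(2,1)]]) simp
  qed
  obtain N where N: "\<forall>m\<ge>N. \<forall>n\<ge>N. l2_sqnorm S (\<lambda>z. f m z - f n z) < 1" using Cauchy[of 1] by auto
  then have "(\<lambda>z. f N z - g z) \<in> bergman_fns S" by (intro fg[of N _ 1]) auto
  from bergman_fns_diff[OF S f[of N] this] have g: "g \<in> bergman_fns S" by simp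
  have "(\<lambda>n. l2_sqnorm S (\<lambda>z. f n z - g z)) \<longlonglongrightarrow> 0"
  proof (rule LIMSEQ_I)
    fix e :: real assume "e > 0"
    then obtain N where N: "\<forall>m\<ge>N. \<forall>n\<ge>N. l2_sqnorm S (\<lambda>z. f m z - f n z) < e / 2"
      using Cauchy[of "e/2"] by auto
    have "norm (l2_sqnorm S (\<lambda>z. f n z - g z) - 0) < e" if "n \<ge> N" for n
    proof -
      have *: "\<forall>m\<ge>N. l2_sqnorm S (\<lambda>z. f m z - f n z) < e / 2" using N that by blast
      have "ennreal (l2_sqnorm S (\<lambda>z. f n z - g z)) \<le> ennreal (e / 2)"
        using bound[OF _ *] nn_integral_eq_l2_sqnorm[OF fg[OF *]] \<open>e > 0\<close> by simp
      then show ?thesis using \<open>e > 0\<close> l2_sqnorm_nonneg[of S "\<lambda>z. f n z - g z"]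
        by (simp add: ennreal_le_iff)
    qed
    then show "\<exists>no. \<forall>n\<ge>no. norm (l2_sqnorm S (\<lambda>z. f n z - g z) - 0) < e" by blast
  qed
  with g show thesis using that by blast
qed

section \<open>Complete inner product spaces\<close>

text \<open>The vectors form a subspace \<open>V\<close> of an ambient vector space, so that the Bergman spaces of
  different open sets, all of them sets of functions on \<open>complex^'n\<close>, are instances.\<close>

locale hilbert_subspace = vector_space scale
  for scale :: "complex \<Rightarrow> 'v::ab_group_add \<Rightarrow> 'v" (infixr "\<odot>" 75) +
  fixes V :: "'v set" and ip :: "'v \<Rightarrow> 'v \<Rightarrow> complex"
  assumes subspace_V: "subspace V"
    and ip_add_left: "\<lbrakk>f \<in> V; g \<in> V; h \<in> V\<rbrakk> \<Longrightarrow> ip (f + g) h = ip f h + ip g h"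
    and ip_scale_left: "\<lbrakk>f \<in> V; h \<in> V\<rbrakk> \<Longrightarrow> ip (c \<odot> f) h = c * ip f h"
    and ip_cnj: "\<lbrakk>f \<in> V; h \<in> V\<rbrakk> \<Longrightarrow> ip h f = cnj (ip f h)"
    and ip_pos: "\<lbrakk>f \<in> V; f \<noteq> 0\<rbrakk> \<Longrightarrow> 0 < Re (ip f f)"
    and complete: "\<lbrakk>\<And>n. u n \<in> V;
        \<And>e. e > 0 \<Longrightarrow> \<exists>N. \<forall>m\<ge>N. \<forall>n\<ge>N. Re (ip (u m - u n) (u m - u n)) < e\<rbrakk>
      \<Longrightarrow> \<exists>g\<in>V. (\<lambda>n. Re (ip (u n - g) (u n - g))) \<longlonglongrightarrow> 0"
begin

lemma V_add: "f \<in> V \<Longrightarrow> g \<in> V \<Longrightarrow> f + g \<in> V" using subspace_add[OF subspace_V] .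
lemma V_diff: "f \<in> V \<Longrightarrow> g \<in> V \<Longrightarrow> f - g \<in> V" using subspace_diff[OF subspace_V] .
lemma V_scale: "f \<in> V \<Longrightarrow> c \<odot> f \<in> V" using subspace_scale[OF subspace_V] .
lemma V_0: "0 \<in> V" using subspace_0[OF subspace_V] .
lemma V_sum: "(\<And>i. i \<in> I \<Longrightarrow> f i \<in> V) \<Longrightarrow> (\<Sum>i\<in>I. f i) \<in> V"
  using subspace_sum[OF subspace_V] by blast

lemmas V_closed = V_add V_diff V_scale V_0 V_sum

definition sq :: "'v \<Rightarrow> real" where "sq f = Re (ip f f)"

lemma ip_diff_left: "\<lbrakk>f \<in> V; g \<in> V; h \<in> V\<rbrakk> \<Longrightarrow> ip (f - g) h = ip f h - ip g h"
  using ip_add_left[of "f - g" g h] by (simp add: V_diff)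

lemma ip_add_right: "\<lbrakk>f \<in> V; g \<in> V; h \<in> V\<rbrakk> \<Longrightarrow> ip h (f + g) = ip h f + ip h g"
  using ip_cnj[of "f + g" h] ip_cnj[of f h] ip_cnj[of g h] ip_add_left[of f g h] by (simp add: V_add)

lemma ip_diff_right: "\<lbrakk>f \<in> V; g \<in> V; h \<in> V\<rbrakk> \<Longrightarrow> ip h (f - g) = ip h f - ip h g"
  using ip_cnj[of "f - g" h] ip_cnj[of f h] ip_cnj[of g h] ip_diff_left[of f g h] by (simp add: V_diff)

lemma ip_scale_right: "\<lbrakk>f \<in> V; h \<in> V\<rbrakk> \<Longrightarrow> ip h (c \<odot> f) = cnj c * ip h f"
  using ip_cnj[of "c \<odot> f" h] ip_cnj[of f h] ip_scale_left[of f h c] by (simp add: V_scale)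

lemma ip_0_left: "h \<in> V \<Longrightarrow> ip 0 h = 0"
  using ip_diff_left[of 0 0 h] V_0 by simp

lemma ip_0_right: "h \<in> V \<Longrightarrow> ip h 0 = 0"
  using ip_diff_right[of 0 0 h] V_0 by simp

lemma ip_sum_left:
  "\<lbrakk>\<And>i. i \<in> I \<Longrightarrow> f i \<in> V; h \<in> V\<rbrakk> \<Longrightarrow> ip (\<Sum>i\<in>I. f i) h = (\<Sum>i\<in>I. ip (f i) h)"
  by (induction I rule: infinite_finite_induct) (auto simp: ip_0_left ip_add_left V_sum)

lemma ip_sum_right:
  "\<lbrakk>\<And>i. i \<in> I \<Longrightarrow> f i \<in> V; h \<in> V\<rbrakk> \<Longrightarrow> ip h (\<Sum>i\<in>I. f i) = (\<Sum>i\<in>I. ip h (f i))"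
  by (induction I rule: infinite_finite_induct) (auto simp: ip_0_right ip_add_right V_sum)

lemma sq_0: "sq 0 = 0" by (simp add: sq_def ip_0_left V_0)

lemma sq_nonneg: "f \<in> V \<Longrightarrow> sq f \<ge> 0"
  using ip_pos[of f] sq_0 by (cases "f = 0") (auto simp: sq_def)

lemma sq_eq_0: "f \<in> V \<Longrightarrow> sq f = 0 \<Longrightarrow> f = 0"
  using ip_pos[of f] by (auto simp: sq_def)

lemma ip_self: "f \<in> V \<Longrightarrow> ip f f = of_real (sq f)"
  using ip_cnj[of f f] by (simp add: sq_def complex_eq_iff)

lemma sq_add: "f \<in> V \<Longrightarrow> g \<in> V \<Longrightarrow> sq (f + g) = sq f + 2 * Re (ip f g) + sq g"
  using ip_cnj[of f g] by (simp add: sq_def ip_add_left ip_add_right V_add)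

lemma sq_diff: "f \<in> V \<Longrightarrow> g \<in> V \<Longrightarrow> sq (f - g) = sq f - 2 * Re (ip f g) + sq g"
  using ip_cnj[of f g] by (simp add: sq_def ip_diff_left ip_diff_right V_diff)

lemma sq_scale: "f \<in> V \<Longrightarrow> sq (c \<odot> f) = (cmod c)\<^sup>2 * sq f"
proof -
  assume f: "f \<in> V"
  have "ip (c \<odot> f) (c \<odot> f) = (c * cnj c) * ip f f"
    using f by (simp add: ip_scale_left ip_scale_right V_scale mult.assoc)
  also have "\<dots> = of_real ((cmod c)\<^sup>2 * sq f)" using f complex_norm_square[of c] by (simp add: ip_self)
  finally show ?thesis by (simp add: sq_def)
qed

lemma sq_minus_component:
  assumes "f \<in> V" "g \<in> V" "sq g \<noteq> 0"
  shows "sq (f - (ip f g / of_real (sq g)) \<odot> g) = sq f - (cmod (ip f g))\<^sup>2 / sq g"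
proof -
  have "ip f ((ip f g / of_real (sq g)) \<odot> g) = cnj (ip f g) * ip f g / of_real (sq g)"
    using assms by (simp add: ip_scale_right)
  also have "\<dots> = of_real ((cmod (ip f g))\<^sup>2 / sq g)"
    using complex_norm_square[of "ip f g"] by (simp add: mult.commute)
  finally have "Re (ip f ((ip f g / of_real (sq g)) \<odot> g)) = (cmod (ip f g))\<^sup>2 / sq g" by simp
  moreover have "sq ((ip f g / of_real (sq g)) \<odot> g) = (cmod (ip f g))\<^sup>2 / sq g"
    using assms by (simp add: sq_scale norm_divide power_divide power2_eq_square)
  ultimately show ?thesis using assms by (simp add: sq_diff V_scale)
qed

lemma Cauchy_Schwarz:
  assumes "f \<in> V" "g \<in> V" shows "(cmod (ip f g))\<^sup>2 \<le> sq f * sq g"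
proof (cases "sq g = 0")
  case True
  then have "g = 0" using assms sq_eq_0 by blast
  then show ?thesis using assms by (simp add: ip_0_right sq_0)
next
  case False
  then have pos: "sq g > 0" using assms sq_nonneg[of g] by linarith
  have "0 \<le> sq f - (cmod (ip f g))\<^sup>2 / sq g"
    using sq_minus_component[OF assms False] sq_nonneg[of "f - (ip f g / of_real (sq g)) \<odot> g"] assms
    by (simp add: V_closed)
  then show ?thesis using pos by (simp add: field_simps)
qed

lemma sq_add_le: "f \<in> V \<Longrightarrow> g \<in> V \<Longrightarrow> sq (f + g) \<le> 2 * sq f + 2 * sq g"
  using sq_nonneg[of "f - g"] by (simp add: sq_add sq_diff V_diff)

lemma sq_diff_commute: "f \<in> V \<Longrightarrow> g \<in> V \<Longrightarrow> sq (f - g) = sq (g - f)"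
  using ip_cnj[of f g] by (simp add: sq_diff)

lemma sq_tendsto:
  assumes u: "\<And>n. u n \<in> V" and g: "g \<in> V" and lim: "(\<lambda>n. sq (u n - g)) \<longlonglongrightarrow> 0"
  shows "(\<lambda>n. sq (u n)) \<longlonglongrightarrow> sq g"
proof -
  have "(\<lambda>n. cmod (ip (u n - g) g)) \<longlonglongrightarrow> 0"
  proof (rule tendsto_sandwich[OF _ _ tendsto_const])
    show "\<forall>\<^sub>F n in sequentially. 0 \<le> cmod (ip (u n - g) g)" by simp
    show "\<forall>\<^sub>F n in sequentially. cmod (ip (u n - g) g) \<le> sqrt (sq (u n - g) * sq g)"
      using Cauchy_Schwarz[OF V_diff[OF u g] g] by (intro always_eventually allI real_le_rsqrt)
    have "(\<lambda>n. sqrt (sq (u n - g) * sq g)) \<longlonglongrightarrow> sqrt (0 * sq g)" by (intro tendsto_intros lim)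
    then show "(\<lambda>n. sqrt (sq (u n - g) * sq g)) \<longlonglongrightarrow> 0" by simp
  qed
  then have "(\<lambda>n. ip (u n - g) g) \<longlonglongrightarrow> 0" by (rule tendsto_norm_zero_cancel)
  then have "(\<lambda>n. sq (u n - g) + 2 * Re (ip (u n - g) g) + sq g) \<longlonglongrightarrow> 0 + 2 * Re 0 + sq g"
    by (intro tendsto_intros lim)
  moreover have "sq (u n) = sq (u n - g) + 2 * Re (ip (u n - g) g) + sq g" for n
    using sq_add[OF V_diff[OF u g] g, of n] by simp
  ultimately show ?thesis by simp
qed

text \<open>The orthogonal projection to the closure of a subspace, as the limit of a minimizing sequence.\<close>

lemma projection:
  assumes W: "subspace W" "W \<subseteq> V" and f: "f \<in> V"
  obtains g where "g \<in> V" "\<And>e. e > 0 \<Longrightarrow> \<exists>w\<in>W. sq (g - w) < e" "\<And>w. w \<in> W \<Longrightarrow> ip (f - g) w = 0"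
proof -
  define d where "d = Inf ((\<lambda>w. sq (f - w)) ` W)"
  have WV: "w \<in> V" if "w \<in> W" for w using that W by blast
  have bdd: "bdd_below ((\<lambda>w. sq (f - w)) ` W)"
    using sq_nonneg V_diff[OF f WV] by (intro bdd_belowI[of _ 0]) auto
  have ne: "W \<noteq> {}" using subspace_0[OF W(1)] by blast
  have d_le: "d \<le> sq (f - w)" if "w \<in> W" for w
    unfolding d_def using that by (intro cInf_lower bdd) auto
  have "\<exists>w\<in>W. sq (f - w) < d + 1 / Suc n" for n
    using cInf_lessD[of "(\<lambda>w. sq (f - w)) ` W" "d + 1 / Suc n"] ne by (auto simp: d_def)
  then obtain w where w: "\<And>n. w n \<in> W" and wd: "\<And>n. sq (f - w n) < d + 1 / Suc n" by metis
  have wV: "w n \<in> V" for n using w WV by blast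
  have close: "sq (w m - w n) \<le> 2 / Suc m + 2 / Suc n" for m n
  proof -
    let ?a = "f - w m" and ?b = "f - w n"
    have ab: "?a \<in> V" "?b \<in> V" using wV f by (auto intro: V_diff)
    have "(1/2) \<odot> (w m + w n) \<in> W"
      using w W(1) by (intro subspace_scale subspace_add)
    then have "d \<le> sq (f - (1/2) \<odot> (w m + w n))" by (rule d_le)
    also have "f - (1/2) \<odot> (w m + w n) = (1/2) \<odot> (?a + ?b)"
    proof -
      have "(1/2) \<odot> (?a + ?b) = (1/2) \<odot> (f + f) - (1/2) \<odot> (w m + w n)"
        by (simp add: scale_right_distrib scale_right_diff_distrib)
      also have "(1/2) \<odot> (f + f) = f"
        using scale_left_distrib[of "1/2" "1/2" f] by (simp add: scale_right_distrib)
      finally show ?thesis by simp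
    qed
    also have "sq \<dots> = (1/4) * sq (?a + ?b)" using ab by (simp add: sq_scale V_add norm_divide power_divide)
    finally have "4 * d \<le> sq (?a + ?b)" by simp
    moreover have "sq (?a + ?b) + sq (?a - ?b) = 2 * sq ?a + 2 * sq ?b"
      using sq_add[OF ab] sq_diff[OF ab] by linarith
    moreover have "?a - ?b = w n - w m" by simp
    ultimately have "sq (w n - w m) \<le> 2 / Suc m + 2 / Suc n" using wd[of m] wd[of n] by simp
    then show ?thesis using sq_diff_commute wV by metis
  qed
  have small: "\<exists>N. \<forall>n\<ge>N. 1 / real (Suc n) < e" if "e > 0" for e
    using order_tendstoD(2)[OF LIMSEQ_inverse_real_of_nat that]
    by (simp add: eventually_sequentially inverse_eq_divide)
  have "\<exists>g\<in>V. (\<lambda>n. Re (ip (w n - g) (w n - g))) \<longlonglongrightarrow> 0"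
  proof (rule complete[OF wV])
    fix e :: real assume "e > 0"
    then obtain N where N: "\<forall>n\<ge>N. 1 / real (Suc n) < e / 4" using small[of "e/4"] by auto
    have "sq (w m - w n) < e" if "m \<ge> N" "n \<ge> N" for m n
      using close[of m n] N[rule_format, OF that(1)] N[rule_format, OF that(2)] by simp
    then show "\<exists>N. \<forall>m\<ge>N. \<forall>n\<ge>N. Re (ip (w m - w n) (w m - w n)) < e" unfolding sq_def by blast
  qed
  then obtain g where g: "g \<in> V" and lim: "(\<lambda>n. sq (w n - g)) \<longlonglongrightarrow> 0" by (auto simp: sq_def)
  define h where "h = f - g"
  have h: "h \<in> V" using f g by (simp add: h_def V_diff)
  have lim_t: "(\<lambda>n. sq (f - w n - x)) \<longlonglongrightarrow> sq (h - x)" if x: "x \<in> V" for x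
  proof (rule sq_tendsto)
    have *: "(f - w n - x) - (h - x) = g - w n" for n by (simp add: h_def)
    show "(\<lambda>n. sq (f - w n - x - (h - x))) \<longlonglongrightarrow> 0"
      unfolding * using lim sq_diff_commute[OF g wV] by simp
  qed (use f wV x h in \<open>auto intro!: V_diff\<close>)
  have sqh: "sq h \<le> d"
  proof (rule LIMSEQ_le)
    show "(\<lambda>n. sq (f - w n)) \<longlonglongrightarrow> sq h" using lim_t[OF V_0] by simp
    have "(\<lambda>n. d + inverse (real (Suc n))) \<longlonglongrightarrow> d + 0"
      by (intro tendsto_intros LIMSEQ_inverse_real_of_nat)
    then show "(\<lambda>n. d + 1 / Suc n) \<longlonglongrightarrow> d" by (simp add: inverse_eq_divide)
    show "\<exists>N. \<forall>n\<ge>N. sq (f - w n) \<le> d + 1 / Suc n" using wd less_imp_le by blast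
  qed
  have "ip h x = 0" if x: "x \<in> W" for x
  proof (rule ccontr)
    assume ne: "ip h x \<noteq> 0"
    have xV: "x \<in> V" using x WV by blast
    have "sq x \<noteq> 0"
    proof
      assume "sq x = 0"
      then have "x = 0" using xV sq_eq_0 by blast
      then show False using ne h by (simp add: ip_0_right)
    qed
    then have pos: "sq x > 0" using xV sq_nonneg[of x] by linarith
    define y where "y = (ip h x / of_real (sq x)) \<odot> x"
    have y: "y \<in> W" using x W(1) by (simp add: y_def subspace_scale)
    have "d \<le> sq (h - y)"
    proof (rule LIMSEQ_le_const[OF lim_t[OF WV[OF y]]])
      have "d \<le> sq (f - w n - y)" for n
        using d_le[OF subspace_add[OF W(1) w y]] by (simp add: diff_diff_eq)
      then show "\<exists>N. \<forall>n\<ge>N. d \<le> sq (f - w n - y)" by blast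
    qed
    also have "sq (h - y) = sq h - (cmod (ip h x))\<^sup>2 / sq x"
      unfolding y_def by (rule sq_minus_component[OF h xV \<open>sq x \<noteq> 0\<close>])
    finally have "(cmod (ip h x))\<^sup>2 / sq x \<le> 0" using sqh by simp
    then show False using pos ne by (simp add: divide_le_0_iff)
  qed
  moreover have "\<exists>w\<in>W. sq (g - w) < e" if "e > 0" for e
  proof -
    have "\<forall>\<^sub>F n in sequentially. sq (w n - g) < e" using order_tendstoD(2)[OF lim that] .
    then obtain n where "sq (w n - g) < e" by (auto simp: eventually_sequentially)
    then show ?thesis using w sq_diff_commute[OF g wV, of n] by metis
  qed
  ultimately show thesis using that[of g] g by (simp add: h_def)
qed

lemma dense_if_annihilator_trivial:
  assumes W: "subspace W" "W \<subseteq> V" and f: "f \<in> V" and e: "e > 0"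
    and triv: "\<And>h. h \<in> V \<Longrightarrow> (\<And>w. w \<in> W \<Longrightarrow> ip h w = 0) \<Longrightarrow> h = 0"
  shows "\<exists>w\<in>W. sq (f - w) < e"
proof -
  obtain g where g: "g \<in> V" "\<And>e. e > 0 \<Longrightarrow> \<exists>w\<in>W. sq (g - w) < e" "\<And>w. w \<in> W \<Longrightarrow> ip (f - g) w = 0"
    using projection[OF W f] by blast
  have "f - g = 0" using triv[of "f - g"] f g by (auto intro: V_diff)
  then show ?thesis using g(2)[OF e] by simp
qed

text \<open>The representing vector spans the orthogonal complement of the null space of \<open>L\<close>.\<close>

lemma Riesz_representation:
  assumes add: "\<And>f g. f \<in> V \<Longrightarrow> g \<in> V \<Longrightarrow> L (f + g) = L f + L g"
    and scale: "\<And>c f. f \<in> V \<Longrightarrow> L (c \<odot> f) = c * L f"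
    and bound: "\<And>f. f \<in> V \<Longrightarrow> (cmod (L f))\<^sup>2 \<le> C * sq f"
  obtains k where "k \<in> V" "\<And>f. f \<in> V \<Longrightarrow> L f = ip f k"
proof (cases "\<forall>f\<in>V. L f = 0")
  case True
  then show thesis using that[of 0] V_0 by (auto simp: ip_0_right)
next
  case False
  then obtain f0 where f0: "f0 \<in> V" "L f0 \<noteq> 0" by blast
  define W where "W = {f\<in>V. L f = 0}"
  have L0: "L 0 = 0" using scale[OF V_0, of 0] by simp
  have Ldiff: "L (f - g) = L f - L g" if "f \<in> V" "g \<in> V" for f g
    using add[of "f - g" g] that by (simp add: V_diff)
  have W: "subspace W" "W \<subseteq> V"
    unfolding W_def subspace_def using V_closed L0 by (auto simp: add scale)
  obtain g where g: "g \<in> V" "\<And>e. e > 0 \<Longrightarrow> \<exists>w\<in>W. sq (g - w) < e" "\<And>w. w \<in> W \<Longrightarrow> ip (f0 - g) w = 0"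
    using projection[OF W f0(1)] by blast
  have "L g = 0"
  proof (rule ccontr)
    assume ne: "L g \<noteq> 0"
    define e where "e = (cmod (L g))\<^sup>2 / (\<bar>C\<bar> + 1)"
    have "e > 0" using ne by (simp add: e_def)
    then obtain w where w: "w \<in> W" "sq (g - w) < e" using g(2) by blast
    have wV: "w \<in> V" "L w = 0" using w by (auto simp: W_def)
    have "(cmod (L g))\<^sup>2 = (cmod (L (g - w)))\<^sup>2" using wV g by (simp add: Ldiff)
    also have "\<dots> \<le> C * sq (g - w)" using wV g by (intro bound V_diff)
    also have "\<dots> \<le> \<bar>C\<bar> * sq (g - w)" using wV g sq_nonneg[OF V_diff] by (intro mult_right_mono) auto
    also have "\<dots> \<le> \<bar>C\<bar> * e" using w by (intro mult_left_mono) auto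
    also have "\<dots> < (\<bar>C\<bar> + 1) * e" using \<open>e > 0\<close> by simp
    also have "\<dots> = (cmod (L g))\<^sup>2" by (simp add: e_def add_nonneg_eq_0_iff)
    finally show False by simp
  qed
  define h where "h = f0 - g"
  have h: "h \<in> V" "L h = L f0" using f0 g \<open>L g = 0\<close> by (auto simp: h_def Ldiff intro: V_diff)
  have "h \<noteq> 0" using h f0 L0 by auto
  then have sqh: "sq h \<noteq> 0" using sq_eq_0 h by blast
  define k where "k = (cnj (L h) / of_real (sq h)) \<odot> h"
  have "L f = ip f k" if f: "f \<in> V" for f
  proof -
    have "f - (L f / L h) \<odot> h \<in> W"
      using f h f0 by (simp add: W_def V_closed Ldiff scale)
    then have "ip h (f - (L f / L h) \<odot> h) = 0" using g(3) by (simp add: h_def)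
    then have "ip (f - (L f / L h) \<odot> h) h = 0"
      using ip_cnj[of h "f - (L f / L h) \<odot> h"] f h by (simp add: V_closed)
    then have "ip f h = (L f / L h) * of_real (sq h)"
      using f h by (simp add: ip_diff_left ip_scale_left V_closed ip_self)
    then show ?thesis using f h f0 sqh by (simp add: k_def ip_scale_right)
  qed
  moreover have "k \<in> V" using h by (simp add: k_def V_scale)
  ultimately show thesis using that by blast
qed

definition orthonormal :: "'v set \<Rightarrow> bool" where
  "orthonormal B \<longleftrightarrow> B \<subseteq> V \<and> (\<forall>f\<in>B. \<forall>g\<in>B. ip f g = (if f = g then 1 else 0))"

definition onb :: "'v set \<Rightarrow> bool" where
  "onb B \<longleftrightarrow> orthonormal B \<and>
    (\<forall>f\<in>V. \<forall>e>0. \<exists>F c. finite F \<and> F \<subseteq> B \<and> sq (f - (\<Sum>g\<in>F. c g \<odot> g)) < e)"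

lemma sq_minus_combination:
  assumes B: "orthonormal B" and F: "finite F" "F \<subseteq> B" and f: "f \<in> V"
  shows "sq (f - (\<Sum>g\<in>F. c g \<odot> g))
    = sq f - (\<Sum>g\<in>F. (cmod (ip f g))\<^sup>2) + (\<Sum>g\<in>F. (cmod (c g - ip f g))\<^sup>2)"
proof -
  have FV: "g \<in> V" if "g \<in> F" for g using that F B by (auto simp: orthonormal_def)
  have ipF: "ip g h = (if g = h then 1 else 0)" if "g \<in> F" "h \<in> F" for g h
    using that F B unfolding orthonormal_def by blast
  let ?s = "\<Sum>g\<in>F. c g \<odot> g"
  have s: "?s \<in> V" using FV by (intro V_sum V_scale)
  have 1: "ip f ?s = (\<Sum>g\<in>F. cnj (c g) * ip f g)"
    using FV f by (simp add: ip_sum_right ip_scale_right V_scale)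
  have gs: "ip g ?s = cnj (c g)" if "g \<in> F" for g
  proof -
    have "ip g ?s = (\<Sum>h\<in>F. cnj (c h) * ip g h)"
      using FV that by (simp add: ip_sum_right ip_scale_right V_scale)
    also have "\<dots> = (\<Sum>h\<in>F. if g = h then cnj (c h) else 0)"
      using ipF that by (intro sum.cong refl) auto
    also have "\<dots> = cnj (c g)" using that F by simp
    finally show ?thesis .
  qed
  have 2: "ip ?s ?s = (\<Sum>g\<in>F. c g * cnj (c g))"
    using FV s gs by (simp add: ip_sum_left ip_scale_left V_scale)
  have "sq (f - ?s) = sq f - 2 * (\<Sum>g\<in>F. Re (cnj (c g) * ip f g)) + (\<Sum>g\<in>F. Re (c g * cnj (c g)))"
    using f s by (simp add: sq_diff 1) (simp add: sq_def 2)
  also have "\<dots> = sq f + (\<Sum>g\<in>F. Re (c g * cnj (c g)) - 2 * Re (cnj (c g) * ip f g))"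
    by (simp add: sum_subtractf sum_distrib_left)
  also have "(\<Sum>g\<in>F. Re (c g * cnj (c g)) - 2 * Re (cnj (c g) * ip f g))
     = (\<Sum>g\<in>F. (cmod (c g - ip f g))\<^sup>2 - (cmod (ip f g))\<^sup>2)"
    by (intro sum.cong refl, simp add: cmod_power2) (simp add: power2_eq_square algebra_simps)
  finally show ?thesis by (simp add: sum_subtractf)
qed

text \<open>The partial sums are inner products of orthogonal projections to finite-dimensional subspaces;
  among all combinations of finitely many basis vectors the projection is the closest one.\<close>

theorem Parseval:
  assumes B: "onb B" and f: "f \<in> V" and h: "h \<in> V"
  shows "((\<lambda>g. ip f g * cnj (ip h g)) has_sum ip f h) B"
proof -
  have on: "orthonormal B" using B by (simp add: onb_def)
  have BV: "B \<subseteq> V" using on by (simp add: orthonormal_def)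
  define P where "P x F = (\<Sum>g\<in>F. ip x g \<odot> g)" for x F
  have PV: "P x F \<in> V" if "F \<subseteq> B" for x F
    unfolding P_def using that BV by (intro V_sum V_scale) auto
  have rest: "\<exists>F0. finite F0 \<and> F0 \<subseteq> B \<and> (\<forall>F. finite F \<longrightarrow> F0 \<subseteq> F \<longrightarrow> F \<subseteq> B \<longrightarrow> sq (x - P x F) < e)"
    if x: "x \<in> V" and e: "e > 0" for x e
  proof -
    obtain F0 c where F0: "finite F0" "F0 \<subseteq> B" "sq (x - (\<Sum>g\<in>F0. c g \<odot> g)) < e"
      using B x e unfolding onb_def by blast
    have "sq (x - P x F) < e" if F: "finite F" "F0 \<subseteq> F" "F \<subseteq> B" for F
    proof -
      have "sq (x - P x F) = sq x - (\<Sum>g\<in>F. (cmod (ip x g))\<^sup>2)"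
        unfolding P_def using sq_minus_combination[OF on F(1,3) x] by simp
      also have "\<dots> \<le> sq x - (\<Sum>g\<in>F0. (cmod (ip x g))\<^sup>2)"
        using F sum_mono2[OF F(1,2), of "\<lambda>g. (cmod (ip x g))\<^sup>2"] by simp
      also have "\<dots> \<le> sq (x - (\<Sum>g\<in>F0. c g \<odot> g))"
        by (simp add: sq_minus_combination[OF on F0(1,2) x] sum_nonneg)
      finally show ?thesis using F0 by simp
    qed
    then show ?thesis using F0 by blast
  qed
  have eq: "ip (f - P f F) (h - P h F) = ip f h - (\<Sum>g\<in>F. ip f g * cnj (ip h g))" if F: "finite F" "F \<subseteq> B" for F
  proof -
    have FV: "g \<in> V" if "g \<in> F" for g using that F BV by auto
    have ipF: "ip g h = (if g = h then 1 else 0)" if "g \<in> F" "h \<in> F" for g h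
      using that F on unfolding orthonormal_def by blast
    have PP: "ip (P f F) g = ip f g" if "g \<in> F" for g
    proof -
      have "ip (P f F) g = (\<Sum>g'\<in>F. ip f g' * ip g' g)"
        unfolding P_def using FV that by (simp add: ip_sum_left ip_scale_left V_scale)
      also have "\<dots> = (\<Sum>g'\<in>F. if g' = g then ip f g' else 0)"
        using ipF that by (intro sum.cong refl) auto
      finally show ?thesis using that F by simp
    qed
    have 1: "ip x (P h F) = (\<Sum>g\<in>F. cnj (ip h g) * ip x g)" if "x \<in> V" for x
      unfolding P_def using FV that by (simp add: ip_sum_right ip_scale_right V_scale)
    have "ip (P f F) (P h F) = ip f (P h F)" using PV[OF F(2)] f PP by (simp add: 1)
    then have "ip (f - P f F) (h - P h F) = ip f h - ip (P f F) h"
      using f h PV[OF F(2)] by (simp add: ip_diff_left ip_diff_right V_diff)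
    also have "ip (P f F) h = (\<Sum>g\<in>F. ip f g * ip g h)"
      unfolding P_def using FV h by (simp add: ip_sum_left ip_scale_left V_scale)
    also have "\<dots> = (\<Sum>g\<in>F. ip f g * cnj (ip h g))"
      using FV h by (intro sum.cong refl) (metis ip_cnj)
    finally show ?thesis .
  qed
  show ?thesis
    unfolding has_sum_def tendsto_iff eventually_finite_subsets_at_top
  proof (intro allI impI)
    fix e :: real assume e: "e > 0"
    obtain F1 where F1: "finite F1" "F1 \<subseteq> B" "\<forall>F. finite F \<longrightarrow> F1 \<subseteq> F \<longrightarrow> F \<subseteq> B \<longrightarrow> sq (f - P f F) < e"
      using rest[OF f e] by blast
    obtain F2 where F2: "finite F2" "F2 \<subseteq> B" "\<forall>F. finite F \<longrightarrow> F2 \<subseteq> F \<longrightarrow> F \<subseteq> B \<longrightarrow> sq (h - P h F) < e"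
      using rest[OF h e] by blast
    have "dist (\<Sum>g\<in>F. ip f g * cnj (ip h g)) (ip f h) < e"
      if F: "finite F" "F1 \<union> F2 \<subseteq> F" "F \<subseteq> B" for F
    proof -
      have V: "f - P f F \<in> V" "h - P h F \<in> V" using PV F f h by (auto intro: V_diff)
      have "sq (f - P f F) < e" "sq (h - P h F) < e" using F1 F2 F by auto
      then have "sq (f - P f F) * sq (h - P h F) < e * e"
        using V sq_nonneg by (intro mult_strict_mono') auto
      then have "(cmod (ip (f - P f F) (h - P h F)))\<^sup>2 < e\<^sup>2"
        using Cauchy_Schwarz[OF V] by (simp add: power2_eq_square)
      then have "cmod (ip (f - P f F) (h - P h F)) < e" using e by (intro power2_less_imp_less[of _ e]) auto
      then show ?thesis using eq[OF F(1,3)] by (simp add: dist_norm norm_minus_commute)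
    qed
    then show "\<exists>X. finite X \<and> X \<subseteq> B \<and> (\<forall>Y. finite Y \<and> X \<subseteq> Y \<and> Y \<subseteq> B \<longrightarrow>
        dist (\<Sum>g\<in>Y. ip f g * cnj (ip h g)) (ip f h) < e)"
      using F1 F2 by (intro exI[of _ "F1 \<union> F2"]) auto
  qed
qed

text \<open>A maximal orthonormal set has dense span, since a nonzero vector orthogonal to it could be
  normalized and added.\<close>

theorem onb_exists: "\<exists>B. onb B"
proof -
  have "\<exists>M\<in>{B. orthonormal B}. \<forall>X\<in>{B. orthonormal B}. M \<subseteq> X \<longrightarrow> X = M"
  proof (rule subset_Zorn')
    fix C assume C: "subset.chain {B. orthonormal B} C"
    show "\<Union>C \<in> {B. orthonormal B}"
      unfolding mem_Collect_eq orthonormal_def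
    proof (intro conjI ballI)
      show "\<Union>C \<subseteq> V" using C by (auto simp: subset.chain_def orthonormal_def)
      fix f g assume "f \<in> \<Union>C" "g \<in> \<Union>C"
      then obtain X Y where XY: "X \<in> C" "Y \<in> C" "f \<in> X" "g \<in> Y" by blast
      then have "X \<subseteq> Y \<or> Y \<subseteq> X" using C by (auto simp: subset.chain_def)
      then obtain Z where "Z \<in> C" "f \<in> Z" "g \<in> Z" using XY by blast
      then show "ip f g = (if f = g then 1 else 0)"
        using C by (auto simp: subset.chain_def orthonormal_def)
    qed
  qed
  then obtain B where B: "orthonormal B" and max: "\<And>X. orthonormal X \<Longrightarrow> B \<subseteq> X \<Longrightarrow> X = B" by blast
  have BV: "B \<subseteq> V" using B by (simp add: orthonormal_def)
  have sub: "subspace (span B)" "span B \<subseteq> V"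
    using BV subspace_V by (auto simp: span_minimal)
  have triv: "h = 0" if h: "h \<in> V" and orth: "\<And>w. w \<in> span B \<Longrightarrow> ip h w = 0" for h
  proof (rule ccontr)
    assume "h \<noteq> 0"
    then have pos: "sq h > 0" using ip_pos h by (simp add: sq_def)
    define u where "u = complex_of_real (1 / sqrt (sq h)) \<odot> h"
    have u: "u \<in> V" using h by (simp add: u_def V_scale)
    have "sq u = (cmod (complex_of_real (1 / sqrt (sq h))))\<^sup>2 * sq h"
      unfolding u_def using h by (rule sq_scale)
    also have "\<dots> = 1" using pos by (simp only: norm_of_real) (simp add: power_divide)
    finally have uu: "ip u u = 1" using u by (simp add: ip_self)
    have ug: "ip u g = 0" if "g \<in> B" for g
      using orth[OF span_base[OF that]] that BV h by (auto simp: u_def ip_scale_left)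
    then have gu: "ip g u = 0" if "g \<in> B" for g using ip_cnj[of u g] that BV u by auto
    have "orthonormal (insert u B)"
      using B u uu ug gu unfolding orthonormal_def by auto
    then have "u \<in> B" using max by blast
    then show False using ug uu by simp
  qed
  have "\<exists>F c. finite F \<and> F \<subseteq> B \<and> sq (f - (\<Sum>g\<in>F. c g \<odot> g)) < e" if "f \<in> V" "e > 0" for f e
  proof -
    have "\<exists>w\<in>span B. sq (f - w) < e" by (rule dense_if_annihilator_trivial[OF sub that triv])
    then obtain w where w: "w \<in> span B" "sq (f - w) < e" by blast
    then obtain F c where "finite F" "F \<subseteq> B" "w = (\<Sum>g\<in>F. c g \<odot> g)"
      using span_explicit by auto
    then show ?thesis using w by blast
  qed
  then show ?thesis using B unfolding onb_def by blast
qed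

text \<open>The norm of \<open>f\<close> can be read off from the Gram kernel of a family \<open>k\<close> and the coefficients of
  \<open>f\<close> with respect to it: \<open>sq f\<close> is the least \<open>C\<close> for which the kernel below is positive
  semidefinite, provided that the family is total.\<close>

lemma psd_kernel_sq:
  assumes f: "f \<in> V" and k: "\<And>z. z \<in> U \<Longrightarrow> k z \<in> V"
  shows "psd_kernel (\<lambda>z w. of_real (sq f) * ip (k w) (k z) - ip f (k z) * cnj (ip f (k w))) U"
  unfolding psd_kernel_def
proof (intro allI impI)
  fix m :: nat and z c assume z: "\<forall>i<m. z i \<in> U"
  define I where "I = {..<m}"
  have kV: "k (z i) \<in> V" if "i \<in> I" for i using k z that by (simp add: I_def)
  define g where "g = (\<Sum>i\<in>I. cnj (c i) \<odot> k (z i))"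
  have g: "g \<in> V" unfolding g_def using kV by (intro V_sum V_scale) auto
  have fg: "ip f g = (\<Sum>i\<in>I. c i * ip f (k (z i)))"
    unfolding g_def using kV f by (simp add: ip_sum_right ip_scale_right V_scale)
  have "ip g g = (\<Sum>i\<in>I. c i * (\<Sum>j\<in>I. cnj (c j) * ip (k (z j)) (k (z i))))"
    unfolding g_def using kV
    by (simp add: ip_sum_left ip_sum_right ip_scale_left ip_scale_right V_scale V_sum)
  then have gg: "ip g g = (\<Sum>i\<in>I. \<Sum>j\<in>I. c i * cnj (c j) * ip (k (z j)) (k (z i)))"
    by (simp add: sum_distrib_left mult.assoc)
  have "(\<Sum>i\<in>I. \<Sum>j\<in>I. c i * cnj (c j) *
      (of_real (sq f) * ip (k (z j)) (k (z i)) - ip f (k (z i)) * cnj (ip f (k (z j)))))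
    = (\<Sum>i\<in>I. \<Sum>j\<in>I. of_real (sq f) * (c i * cnj (c j) * ip (k (z j)) (k (z i)))
        - (c i * ip f (k (z i))) * cnj (c j * ip f (k (z j))))"
    by (intro sum.cong refl) (simp add: algebra_simps)
  also have "\<dots> = of_real (sq f) * ip g g - ip f g * cnj (ip f g)"
    by (simp only: sum_subtractf sum_distrib_left[symmetric] sum_distrib_right[symmetric] gg fg cnj_sum)
  also have "\<dots> = of_real (sq f * sq g - (cmod (ip f g))\<^sup>2)"
    using g complex_norm_square[of "ip f g"] by (simp add: ip_self)
  finally show "0 \<le> Re (\<Sum>i<m. \<Sum>j<m. c i * cnj (c j) *
      (of_real (sq f) * ip (k (z j)) (k (z i)) - ip f (k (z i)) * cnj (ip f (k (z j)))))"
    using Cauchy_Schwarz[OF f g] by (simp add: I_def)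
qed

lemma span_approximation:
  assumes f: "f \<in> V" and k: "k ` U \<subseteq> V"
    and total: "\<And>h. h \<in> V \<Longrightarrow> (\<And>z. z \<in> U \<Longrightarrow> ip h (k z) = 0) \<Longrightarrow> h = 0"
  obtains u where "\<And>n::nat. u n \<in> span (k ` U)" "\<And>n. u n \<in> V" "(\<lambda>n. sq (u n - f)) \<longlonglongrightarrow> 0"
proof -
  have sub: "subspace (span (k ` U))" "span (k ` U) \<subseteq> V"
    using k subspace_V by (auto simp: span_minimal)
  have "\<exists>w\<in>span (k ` U). sq (f - w) < e" if "e > 0" for e
  proof (rule dense_if_annihilator_trivial[OF sub f that])
    fix h assume "h \<in> V" "\<And>w. w \<in> span (k ` U) \<Longrightarrow> ip h w = 0"
    then show "h = 0" using total span_base by blast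
  qed
  then have "\<forall>n. \<exists>w\<in>span (k ` U). sq (f - w) < inverse (real (Suc n))" by simp
  then obtain u where u: "\<And>n. u n \<in> span (k ` U)" "\<And>n. sq (f - u n) < inverse (real (Suc n))" by metis
  have uV: "u n \<in> V" for n using u(1) sub(2) by blast
  have "(\<lambda>n. sq (u n - f)) \<longlonglongrightarrow> 0"
  proof (rule tendsto_sandwich[OF _ _ tendsto_const LIMSEQ_inverse_real_of_nat])
    show "\<forall>\<^sub>F n in sequentially. 0 \<le> sq (u n - f)"
      using sq_nonneg[OF V_diff[OF uV f]] by simp
    show "\<forall>\<^sub>F n in sequentially. sq (u n - f) \<le> inverse (real (Suc n))"
      using u(2) sq_diff_commute[OF f uV] by (auto intro!: always_eventually less_imp_le)
  qed
  then show thesis using that u(1) uV by blast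
qed

text \<open>Positivity says that \<open>\<bar>ip f g\<bar>\<^sup>2 \<le> C sq g\<close> for all \<open>g\<close> in the span of the family. As
  \<open>g\<close> tends to \<open>f\<close> it becomes \<open>(sq f)\<^sup>2 \<le> C sq f\<close>.\<close>

lemma sq_le_if_psd_kernel:
  assumes f: "f \<in> V" and k: "\<And>z. z \<in> U \<Longrightarrow> k z \<in> V" and C: "0 \<le> C"
    and total: "\<And>h. h \<in> V \<Longrightarrow> (\<And>z. z \<in> U \<Longrightarrow> ip h (k z) = 0) \<Longrightarrow> h = 0"
    and psd: "psd_kernel (\<lambda>z w. of_real C * ip (k w) (k z) - ip f (k z) * cnj (ip f (k w))) U"
  shows "sq f \<le> C"
proof -
  have kU: "k ` U \<subseteq> V" using k by blast
  obtain u where u: "\<And>n::nat. u n \<in> span (k ` U)" "\<And>n. u n \<in> V" "(\<lambda>n. sq (u n - f)) \<longlonglongrightarrow> 0"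
    using span_approximation[OF f kU total] by blast
  have key: "(cmod (ip f g))\<^sup>2 \<le> C * sq g" if "g \<in> span (k ` U)" for g
  proof -
    obtain t r where t: "finite t" "t \<subseteq> k ` U" "g = (\<Sum>a\<in>t. r a \<odot> a)"
      using \<open>g \<in> span (k ` U)\<close> span_explicit by auto
    then have "\<forall>a\<in>t. \<exists>z\<in>U. k z = a" by blast
    then obtain z where z: "\<And>a. a \<in> t \<Longrightarrow> z a \<in> U" "\<And>a. a \<in> t \<Longrightarrow> k (z a) = a" by metis
    have tV: "a \<in> V" if "a \<in> t" for a using that t kU by blast
    have g: "g \<in> V" unfolding t(3) using tV by (intro V_sum V_scale)
    have fg: "ip f g = (\<Sum>a\<in>t. cnj (r a) * ip f a)"
      unfolding t(3) using tV f by (simp add: ip_sum_right ip_scale_right V_scale)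
    have "ip g g = (\<Sum>a\<in>t. cnj (r a) * (\<Sum>b\<in>t. r b * ip b a))"
      unfolding t(3) using tV
      by (simp add: ip_sum_left ip_sum_right ip_scale_left ip_scale_right V_scale V_sum)
    then have gg: "ip g g = (\<Sum>a\<in>t. \<Sum>b\<in>t. cnj (r a) * r b * ip b a)"
      by (simp add: sum_distrib_left mult.assoc)
    have "0 \<le> Re (\<Sum>a\<in>t. \<Sum>b\<in>t. cnj (r a) * cnj (cnj (r b)) *
        (of_real C * ip (k (z b)) (k (z a)) - ip f (k (z a)) * cnj (ip f (k (z b)))))"
      by (rule psd_kernel_family[OF psd t(1) z(1)])
    also have "(\<Sum>a\<in>t. \<Sum>b\<in>t. cnj (r a) * cnj (cnj (r b)) *
        (of_real C * ip (k (z b)) (k (z a)) - ip f (k (z a)) * cnj (ip f (k (z b)))))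
      = (\<Sum>a\<in>t. \<Sum>b\<in>t. of_real C * (cnj (r a) * r b * ip b a)
          - (cnj (r a) * ip f a) * cnj (cnj (r b) * ip f b))"
      using z by (intro sum.cong refl) (simp add: algebra_simps)
    also have "\<dots> = of_real C * ip g g - ip f g * cnj (ip f g)"
      by (simp only: sum_subtractf sum_distrib_left[symmetric] sum_distrib_right[symmetric] gg fg cnj_sum)
    also have "\<dots> = of_real (C * sq g - (cmod (ip f g))\<^sup>2)"
      using g complex_norm_square[of "ip f g"] by (simp add: ip_self)
    finally show ?thesis by simp
  qed
  have "(\<lambda>n. sq (u n)) \<longlonglongrightarrow> sq f" by (rule sq_tendsto[OF u(2) f u(3)])
  then have lim1: "(\<lambda>n. C * sq (u n)) \<longlonglongrightarrow> C * sq f" by (intro tendsto_intros)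
  have "Re (ip f (u n)) = (sq f + sq (u n) - sq (u n - f)) / 2" for n
    using sq_diff[OF f u(2), of n] sq_diff_commute[OF f u(2), of n] by simp
  then have eq: "(\<lambda>n. Re (ip f (u n))) = (\<lambda>n. (sq f + sq (u n) - sq (u n - f)) / 2)" by (rule ext)
  have "(\<lambda>n. (sq f + sq (u n) - sq (u n - f)) / 2) \<longlonglongrightarrow> (sq f + sq f - 0) / 2"
    by (intro tendsto_intros sq_tendsto[OF u(2) f u(3)] u(3)) auto
  then have "(\<lambda>n. Re (ip f (u n))) \<longlonglongrightarrow> sq f" unfolding eq by simp
  then have lim2: "(\<lambda>n. (Re (ip f (u n)))\<^sup>2) \<longlonglongrightarrow> (sq f)\<^sup>2" by (intro tendsto_intros)
  have "(sq f)\<^sup>2 \<le> C * sq f"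
  proof (rule LIMSEQ_le[OF lim2 lim1])
    have "(Re (ip f (u n)))\<^sup>2 \<le> C * sq (u n)" for n
      using key[OF u(1), of n] zero_le_power2[of "Im (ip f (u n))"]
      unfolding cmod_power2 by linarith
    then show "\<exists>N. \<forall>n\<ge>N. (Re (ip f (u n)))\<^sup>2 \<le> C * sq (u n)" by blast
  qed
  then show ?thesis using C sq_nonneg[OF f] by (cases "sq f = 0") (auto simp: power2_eq_square)
qed

end

section \<open>The Bergman kernel\<close>

definition fscale :: "complex \<Rightarrow> ('a \<Rightarrow> complex) \<Rightarrow> 'a \<Rightarrow> complex" where
  "fscale c f = (\<lambda>z. c * f z)"

lemma vector_space_fscale: "vector_space fscale"
  by unfold_locales (auto simp: fscale_def fun_eq_iff algebra_simps)

lemma bergman_fns_set_integrable: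
  assumes S: "open S" and f: "f \<in> bergman_fns S" and g: "g \<in> bergman_fns S"
  shows "set_integrable lborel S (\<lambda>z. f z * cnj (g z))"
proof -
  have [measurable]: "f \<in> borel_measurable borel" "g \<in> borel_measurable borel" "S \<in> sets borel"
    using f g S by (auto intro: bergman_fns_measurable)
  have [measurable]: "(\<lambda>z. cnj (g z)) \<in> borel_measurable borel"
    by (rule measurable_compose[of g _ borel]) (auto intro!: borel_measurable_continuous_onI continuous_intros)
  have "set_integrable lborel S (\<lambda>z. (cmod (f z))\<^sup>2 + (cmod (g z))\<^sup>2)"
    using f g by (intro set_integral_add) (auto simp: bergman_fns_def)
  then show ?thesis
  proof (rule set_integrable_bound)
    show "set_borel_measurable lborel S (\<lambda>z. f z * cnj (g z))"
      unfolding set_borel_measurable_def by measurable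
    show "AE z in lborel. z \<in> S \<longrightarrow> norm (f z * cnj (g z)) \<le> norm ((cmod (f z))\<^sup>2 + (cmod (g z))\<^sup>2)"
    proof (intro AE_I2 impI)
      fix z
      have "cmod (f z) * cmod (g z) \<le> (cmod (f z))\<^sup>2 + (cmod (g z))\<^sup>2"
        using sum_squares_bound[of "cmod (f z)" "cmod (g z)"]
          mult_nonneg_nonneg[OF norm_ge_zero norm_ge_zero, of "f z" "g z"] by linarith
      then show "norm (f z * cnj (g z)) \<le> norm ((cmod (f z))\<^sup>2 + (cmod (g z))\<^sup>2)"
        by (simp add: norm_mult)
    qed
  qed
qed

lemma l2_inner_self: "l2_inner S f f = of_real (l2_sqnorm S f)"
proof -
  have "l2_inner S f f = (LINT z|lborel. complex_of_real (indicator S z *\<^sub>R (cmod (f z))\<^sup>2))"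
    unfolding l2_inner_def set_lebesgue_integral_def
    by (intro Bochner_Integration.integral_cong refl) (simp add: indicator_def flip: complex_norm_square)
  also have "\<dots> = of_real (l2_sqnorm S f)"
    unfolding l2_sqnorm_def set_lebesgue_integral_def by (rule integral_complex_of_real)
  finally show ?thesis .
qed

lemma hilbert_bergman:
  fixes S :: "(complex^'n) set"
  assumes S: "open S"
  shows "hilbert_subspace fscale (bergman_fns S) (l2_inner S)"
proof -
  interpret vector_space fscale by (rule vector_space_fscale)
  have zero: "(\<lambda>z. 0) \<in> bergman_fns S"
    by (simp add: bergman_fns_def holo_on_const set_integrable_def)
  show ?thesis
  proof
    show "subspace (bergman_fns S)"
      unfolding subspace_def fscale_def plus_fun_def zero_fun_def
      using bergman_fns_add[OF S] bergman_fns_scale zero by blast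
    show "l2_inner S (f + g) h = l2_inner S f h + l2_inner S g h"
      if "f \<in> bergman_fns S" "g \<in> bergman_fns S" "h \<in> bergman_fns S" for f g h
      unfolding l2_inner_def using bergman_fns_set_integrable[OF S] that
      by (simp add: distrib_right set_integral_add)
    show "l2_inner S (fscale c f) h = c * l2_inner S f h" for c f h
      unfolding l2_inner_def fscale_def by (simp add: mult.assoc)
    show "l2_inner S h f = cnj (l2_inner S f h)" for f h
      unfolding l2_inner_def set_lebesgue_integral_def
      by (simp add: mult.commute flip: Bochner_Integration.integral_cnj)
    show "0 < Re (l2_inner S f f)" if f: "f \<in> bergman_fns S" "f \<noteq> 0" for f
    proof -
      obtain z where z: "f z \<noteq> 0" using f by (auto simp: fun_eq_iff)
      then have "z \<in> S" using f by (auto simp: bergman_fns_def)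
      then obtain e where e: "e > 0" "cball z e \<subseteq> S" using S open_contains_cball by blast
      have "(cmod (f z))\<^sup>2 * ball_vol TYPE('n) (e/2) \<le> l2_sqnorm S f"
        using e by (intro bergman_point_evaluation f) auto
      moreover have "(cmod (f z))\<^sup>2 * ball_vol TYPE('n) (e/2) > 0"
        using z e by (intro mult_pos_pos ball_vol_pos) auto
      ultimately show ?thesis by (simp add: l2_inner_self)
    qed
    show "\<exists>g\<in>bergman_fns S. (\<lambda>n. Re (l2_inner S (u n - g) (u n - g))) \<longlonglongrightarrow> 0"
      if u: "\<And>n. u n \<in> bergman_fns S"
        "\<And>e. e > 0 \<Longrightarrow> \<exists>N. \<forall>m\<ge>N. \<forall>n\<ge>N. Re (l2_inner S (u m - u n) (u m - u n)) < e" for u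
    proof -
      obtain g where "g \<in> bergman_fns S" "(\<lambda>n. l2_sqnorm S (\<lambda>z. u n z - g z)) \<longlonglongrightarrow> 0"
        by (rule bergman_fns_complete[OF S, of u]) (use u in \<open>auto simp: l2_inner_self fun_diff_def\<close>)
      then show ?thesis by (auto simp: l2_inner_self fun_diff_def)
    qed
  qed
qed

lemma sq_bergman: "open S \<Longrightarrow> hilbert_subspace.sq (l2_inner S) f = l2_sqnorm S f"
  using hilbert_subspace.sq_def[OF hilbert_bergman] by (metis Re_complex_of_real l2_inner_self)

lemma sum_fscale: "(\<Sum>g\<in>F. fscale (c g) g) = (\<lambda>z. \<Sum>g\<in>F. c g * g z)"
  by (induction F rule: infinite_finite_induct) (auto simp: fun_eq_iff fscale_def)

lemma bergman_onb_iff: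
  assumes "open S"
  shows "bergman_onb S B \<longleftrightarrow> hilbert_subspace.onb fscale (bergman_fns S) (l2_inner S) B"
proof -
  interpret H: hilbert_subspace fscale "bergman_fns S" "l2_inner S" by (rule hilbert_bergman[OF assms])
  have sq: "H.sq (f - (\<Sum>g\<in>F. fscale (c g) g)) = (LINT z:S|lborel. (cmod (f z - (\<Sum>g\<in>F. c g * g z)))\<^sup>2)" for f F c
    by (simp add: sq_bergman[OF assms] sum_fscale fun_diff_def l2_sqnorm_def)
  have on: "H.orthonormal B \<longleftrightarrow>
      B \<subseteq> bergman_fns S \<and> (\<forall>f\<in>B. \<forall>g\<in>B. l2_inner S f g = (if f = g then 1 else 0))"
    by (rule H.orthonormal_def)
  have "H.onb B \<longleftrightarrow> H.orthonormal B \<and> (\<forall>f\<in>bergman_fns S. \<forall>e>0. \<exists>F c. finite F \<and> F \<subseteq> B \<and>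
      H.sq (f - (\<Sum>g\<in>F. fscale (c g) g)) < e)"
    by (rule H.onb_def)
  then show ?thesis
    by (simp only: bergman_onb_def on sq conj_assoc)
qed

text \<open>Extension by zero makes \<open>bergman_kernel S \<cdot> w\<close> an element of \<open>bergman_fns S\<close>.\<close>

definition kernel_fn :: "(complex^'n) set \<Rightarrow> complex^'n \<Rightarrow> complex^'n \<Rightarrow> complex" where
  "kernel_fn S w = (\<lambda>z. if z \<in> S then bergman_kernel S z w else 0)"

text \<open>Point evaluations are bounded and hence represented by vectors. Parseval's identity for two of
  these vectors, in the basis selected by the definition of the kernel, is the defining series.\<close>

theorem bergman_reproducing:
  fixes S :: "(complex^'n) set"
  assumes S: "open S" and w: "w \<in> S"
  shows kernel_fn_in_bergman_fns: "kernel_fn S w \<in> bergman_fns S"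
    and kernel_fn_reproduces: "\<And>f. f \<in> bergman_fns S \<Longrightarrow> l2_inner S f (kernel_fn S w) = f w"
proof -
  interpret H: hilbert_subspace fscale "bergman_fns S" "l2_inner S" by (rule hilbert_bergman[OF S])
  have rep: "\<exists>k\<in>bergman_fns S. \<forall>f\<in>bergman_fns S. f z = l2_inner S f k" if "z \<in> S" for z
  proof -
    obtain e where e: "e > 0" "cball z e \<subseteq> S" using S \<open>z \<in> S\<close> open_contains_cball by blast
    have v: "ball_vol TYPE('n) (e/2) > 0" using e by (intro ball_vol_pos) auto
    have "(cmod (f z))\<^sup>2 \<le> 1 / ball_vol TYPE('n) (e/2) * H.sq f" if "f \<in> bergman_fns S" for f
      using bergman_point_evaluation[OF that, of "e/2" z] e v by (simp add: sq_bergman[OF S] field_simps)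
    then obtain k where "k \<in> bergman_fns S" "\<And>f. f \<in> bergman_fns S \<Longrightarrow> f z = l2_inner S f k"
      using H.Riesz_representation[of "\<lambda>f. f z" "1 / ball_vol TYPE('n) (e/2)"]
      by (auto simp: fscale_def)
    then show ?thesis by blast
  qed
  then obtain k where kV: "\<And>z. z \<in> S \<Longrightarrow> k z \<in> bergman_fns S"
    and k: "\<And>z f. z \<in> S \<Longrightarrow> f \<in> bergman_fns S \<Longrightarrow> f z = l2_inner S f (k z)" by metis
  define B where "B = (SOME B. bergman_onb S B)"
  have "bergman_onb S B"
    unfolding B_def using H.onb_exists bergman_onb_iff[OF S] by (metis someI_ex)
  then have B: "H.onb B" "B \<subseteq> bergman_fns S"
    using bergman_onb_iff[OF S, of B] by (simp, simp add: bergman_onb_def)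
  have "bergman_kernel S z w = k w z" if z: "z \<in> S" for z
  proof -
    have "((\<lambda>g. l2_inner S (k w) g * cnj (l2_inner S (k z) g)) has_sum l2_inner S (k w) (k z)) B"
      by (rule H.Parseval[OF B(1) kV[OF w] kV[OF z]])
    moreover have "l2_inner S (k w) g * cnj (l2_inner S (k z) g) = g z * cnj (g w)" if "g \<in> B" for g
    proof -
      have g: "g \<in> bergman_fns S" using that B by blast
      show ?thesis using k[OF z g] k[OF w g] H.ip_cnj[OF g kV[OF z]] H.ip_cnj[OF g kV[OF w]]
        by (simp add: mult.commute)
    qed
    ultimately have "((\<lambda>g. g z * cnj (g w)) has_sum l2_inner S (k w) (k z)) B"
      using has_sum_cong by (metis (no_types, lifting))
    then have "bergman_kernel S z w = l2_inner S (k w) (k z)"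
      unfolding bergman_kernel_def B_def[symmetric] by (rule infsumI)
    then show ?thesis using k[OF z kV[OF w]] by simp
  qed
  moreover have "k w z = 0" if "z \<notin> S" for z using kV[OF w] that by (simp add: bergman_fns_def)
  ultimately have "kernel_fn S w = k w" by (auto simp: kernel_fn_def)
  then show "kernel_fn S w \<in> bergman_fns S" "\<And>f. f \<in> bergman_fns S \<Longrightarrow> l2_inner S f (kernel_fn S w) = f w"
    using kV[OF w] k[OF w] by auto
qed

lemma l2_inner_kernel_fn:
  assumes "open S" "z \<in> S" "w \<in> S"
  shows "l2_inner S (kernel_fn S w) (kernel_fn S z) = bergman_kernel S z w"
  using kernel_fn_reproduces[OF assms(1,2) kernel_fn_in_bergman_fns[OF assms(1,3)]] assms
  by (simp add: kernel_fn_def)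

lemma bergman_kernel_cnj:
  assumes "open S" "z \<in> S" "w \<in> S"
  shows "bergman_kernel S w z = cnj (bergman_kernel S z w)"
  using hilbert_subspace.ip_cnj[OF hilbert_bergman[OF assms(1)]] kernel_fn_in_bergman_fns assms
  by (metis l2_inner_kernel_fn)

lemma bergman_kernel_sesqui:
  assumes S: "open S" shows "sesqui_holo_on (bergman_kernel S) S"
  unfolding sesqui_holo_on_def antiholo_on_def
proof (intro conjI ballI)
  have hol: "holo_on (\<lambda>z. bergman_kernel S z w) S" if "w \<in> S" for w
  proof -
    have "holo_on (kernel_fn S w) S"
      using kernel_fn_in_bergman_fns[OF S that] by (simp add: bergman_fns_def)
    then show ?thesis
      using holo_on_cong[OF S, of "kernel_fn S w" "\<lambda>z. bergman_kernel S z w"] by (simp add: kernel_fn_def)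
  qed
  then show "\<And>w. w \<in> S \<Longrightarrow> holo_on (\<lambda>z. bergman_kernel S z w) S" .
  fix z assume z: "z \<in> S"
  show "holo_on (\<lambda>w. cnj (bergman_kernel S z w)) S"
    using holo_on_cong[OF S, of "\<lambda>w. bergman_kernel S w z" "\<lambda>w. cnj (bergman_kernel S z w)"]
      bergman_kernel_cnj[OF S z] hol[OF z] by simp
qed

text \<open>The kernel function of \<open>x\<close> has squared norm equal to its value at \<open>x\<close>, so the bound on point
  evaluations bounds that value; off the diagonal the Cauchy-Schwarz inequality applies.\<close>

lemma bergman_kernel_bound:
  fixes S :: "(complex^'n) set"
  assumes S: "open S" and r: "0 < r" and z: "cball z (2 * r) \<subseteq> S" and w: "cball w (2 * r) \<subseteq> S"
  shows "cmod (bergman_kernel S z w) \<le> 1 / ball_vol TYPE('n) r"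
proof -
  interpret H: hilbert_subspace fscale "bergman_fns S" "l2_inner S" by (rule hilbert_bergman[OF S])
  have v: "ball_vol TYPE('n) r > 0" by (rule ball_vol_pos[OF r])
  have diag: "l2_sqnorm S (kernel_fn S x) \<le> 1 / ball_vol TYPE('n) r" if "cball x (2 * r) \<subseteq> S" for x
  proof -
    have x: "x \<in> S" using that r by auto
    define q where "q = l2_sqnorm S (kernel_fn S x)"
    have "kernel_fn S x x = of_real q"
      using l2_inner_kernel_fn[OF S x x] x by (simp add: l2_inner_self q_def kernel_fn_def)
    then have "q\<^sup>2 * ball_vol TYPE('n) r \<le> q"
      using bergman_point_evaluation[OF kernel_fn_in_bergman_fns[OF S x] r that] by (simp add: q_def)
    then have "q * (q * ball_vol TYPE('n) r) \<le> q * 1" by (simp add: power2_eq_square mult.assoc)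
    moreover have "q \<ge> 0" by (simp add: q_def l2_sqnorm_nonneg)
    ultimately have "q * ball_vol TYPE('n) r \<le> 1" by (cases "q = 0") auto
    then show ?thesis using v by (simp add: q_def field_simps)
  qed
  have zw: "z \<in> S" "w \<in> S" using z w r by auto
  have "(cmod (bergman_kernel S z w))\<^sup>2 \<le> l2_sqnorm S (kernel_fn S w) * l2_sqnorm S (kernel_fn S z)"
    using H.Cauchy_Schwarz[OF kernel_fn_in_bergman_fns[OF S zw(2)] kernel_fn_in_bergman_fns[OF S zw(1)]]
    by (simp add: sq_bergman[OF S] l2_inner_kernel_fn[OF S zw])
  also have "\<dots> \<le> (1 / ball_vol TYPE('n) r) * (1 / ball_vol TYPE('n) r)"
    using v by (intro mult_mono diag z w l2_sqnorm_nonneg) auto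
  finally have "(cmod (bergman_kernel S z w))\<^sup>2 \<le> (1 / ball_vol TYPE('n) r)\<^sup>2"
    by (simp add: power2_eq_square)
  then show ?thesis by (rule power2_le_imp_le) (use v in simp)
qed

lemma psd_kernel_bergman:
  assumes S: "open S" and f: "f \<in> bergman_fns S"
  shows "psd_kernel (\<lambda>z w. of_real (l2_sqnorm S f) * bergman_kernel S z w - f z * cnj (f w)) S"
proof -
  interpret H: hilbert_subspace fscale "bergman_fns S" "l2_inner S" by (rule hilbert_bergman[OF S])
  show ?thesis
    by (rule psd_kernel_cong[OF _ H.psd_kernel_sq[OF f, of S "kernel_fn S"]])
      (auto simp: sq_bergman[OF S] l2_inner_kernel_fn[OF S] kernel_fn_reproduces[OF S _ f]
        kernel_fn_in_bergman_fns[OF S])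
qed

text \<open>The kernel functions of the points of a nonempty open set are total by the identity theorem.\<close>

lemma l2_sqnorm_le_if_psd_kernel:
  fixes S :: "(complex^'n) set"
  assumes S: "open S" "connected S" and f: "f \<in> bergman_fns S" and C: "0 \<le> C"
    and U: "open U" "U \<noteq> {}" "U \<subseteq> S"
    and psd: "psd_kernel (\<lambda>z w. of_real C * bergman_kernel S z w - f z * cnj (f w)) U"
  shows "l2_sqnorm S f \<le> C"
proof -
  interpret H: hilbert_subspace fscale "bergman_fns S" "l2_inner S" by (rule hilbert_bergman[OF S(1)])
  have "H.sq f \<le> C"
  proof (rule H.sq_le_if_psd_kernel[OF f _ C, of U "kernel_fn S"])
    show "kernel_fn S z \<in> bergman_fns S" if "z \<in> U" for z
      using that U kernel_fn_in_bergman_fns[OF S(1)] by blast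
    show "psd_kernel (\<lambda>z w. complex_of_real C * l2_inner S (kernel_fn S w) (kernel_fn S z) -
          l2_inner S f (kernel_fn S z) * cnj (l2_inner S f (kernel_fn S w))) U"
      using U by (intro psd_kernel_cong[OF _ psd])
        (auto simp: l2_inner_kernel_fn[OF S(1)] kernel_fn_reproduces[OF S(1) _ f] subset_iff)
    fix h assume h: "h \<in> bergman_fns S" and 0: "\<And>z. z \<in> U \<Longrightarrow> l2_inner S h (kernel_fn S z) = 0"
    have "h z = 0" if "z \<in> U" for z using 0[OF that] kernel_fn_reproduces[OF S(1) _ h] that U by auto
    then have "h z = 0" if "z \<in> S" for z
      using holo_on_identity[OF _ S U _ that, of h] h by (auto simp: bergman_fns_def)
    then show "h = 0" using h by (auto simp: bergman_fns_def fun_eq_iff)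
  qed
  then show ?thesis by (simp add: sq_bergman[OF S(1)])
qed

section \<open>Local polarization of a real-analytic function\<close>

lemma sesqui_holo_on_diff:
  "sesqui_holo_on F S \<Longrightarrow> sesqui_holo_on G S \<Longrightarrow> sesqui_holo_on (\<lambda>z w. F z w - G z w) S"
  unfolding sesqui_holo_on_def antiholo_on_def by (simp add: holo_on_diff)

lemma sesqui_holo_on_cmult:
  "sesqui_holo_on F S \<Longrightarrow> sesqui_holo_on (\<lambda>z w. c * F z w) S"
  unfolding sesqui_holo_on_def antiholo_on_def by (simp add: holo_on_cmult)

lemma sesqui_holo_on_rank_one:
  "holo_on p S \<Longrightarrow> sesqui_holo_on (\<lambda>z w. p z * cnj (p w)) S"
  unfolding sesqui_holo_on_def antiholo_on_def
  by (auto intro: holo_on_mult holo_on_const)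

lemma sesqui_eq_if_eq_on_diagonal:
  fixes F G :: "complex^'n \<Rightarrow> complex^'n \<Rightarrow> complex"
  assumes "sesqui_holo_on F S" "sesqui_holo_on G S" "open S" "convex S"
    and "\<And>z w. z \<in> S \<Longrightarrow> w \<in> S \<Longrightarrow> cmod (F z w) \<le> M"
    and "\<And>z w. z \<in> S \<Longrightarrow> w \<in> S \<Longrightarrow> cmod (G z w) \<le> N"
    and "\<And>z. z \<in> S \<Longrightarrow> F z z = G z z" "z \<in> S" "w \<in> S"
  shows "F z w = G z w"
proof -
  have "F z w - G z w = 0"
  proof (rule sesqui_zero_if_zero_on_diagonal[where F = "\<lambda>z w. F z w - G z w"])
    show "sesqui_holo_on (\<lambda>z w. F z w - G z w) S" using assms by (intro sesqui_holo_on_diff)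
    show "cmod (F z w - G z w) \<le> M + N" if "z \<in> S" "w \<in> S" for z w
      using norm_triangle_ineq4[of "F z w" "G z w"] assms(5,6)[OF that] by linarith
  qed (use assms in auto)
  then show ?thesis by simp
qed

text \<open>The real coordinate \<open>x \<bullet> b\<close> is the real part of the complex-linear function \<open>h b\<close>. Replacing
  \<open>(h b x + cnj (h b x)) / 2\<close> by \<open>(h b z + cnj (h b w)) / 2\<close> in the power series of \<open>K\<close> makes it
  sesqui-holomorphic; absolute convergence at one real point controls it on a small ball.\<close>

lemma real_analytic_sesqui_extension:
  fixes K :: "complex^'n \<Rightarrow> real"
  assumes K: "real_analytic_on K S" and a: "a \<in> S" and S: "open S"
  obtains s F M where "s > 0" "ball a s \<subseteq> S" "sesqui_holo_on F (ball a s)"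
    "\<And>z w. z \<in> ball a s \<Longrightarrow> w \<in> ball a s \<Longrightarrow> cmod (F z w) \<le> M"
    "\<And>z. z \<in> ball a s \<Longrightarrow> F z z = of_real (K z)"
proof -
  let ?A = "(Basis :: (complex^'n) set) \<rightarrow>\<^sub>E (UNIV :: nat set)"
  obtain c r where r: "r > 0" and c: "\<And>x. x \<in> ball a r \<Longrightarrow>
        ((\<lambda>\<alpha>. c \<alpha> * (\<Prod>b\<in>Basis. ((x - a) \<bullet> b) ^ \<alpha> b)) has_sum K x) ?A"
    using K a unfolding real_analytic_on_def by blast
  define t where "t = r / (2 * DIM(complex^'n))"
  have t: "t > 0" using r by (simp add: t_def)
  \<comment> \<open>all real coordinates of \<open>x0 - a\<close> equal \<open>t\<close>, so convergence at \<open>x0\<close> bounds the coefficients\<close>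
  define x0 where "x0 = a + (\<Sum>b\<in>Basis. t *\<^sub>R b)"
  have "norm (\<Sum>b\<in>(Basis :: (complex^'n) set). t *\<^sub>R b) \<le> (\<Sum>b\<in>(Basis :: (complex^'n) set). t)"
    using t by (intro sum_norm_le) simp
  also have "\<dots> < r" using r by (simp add: t_def)
  finally have x0: "x0 \<in> ball a r" by (simp add: x0_def dist_norm)
  have x0b: "(x0 - a) \<bullet> b = t" if "b \<in> Basis" for b
  proof -
    have "(x0 - a) \<bullet> b = (\<Sum>b'\<in>Basis. t * (b' \<bullet> b))" by (simp add: x0_def inner_sum_left)
    also have "\<dots> = (\<Sum>b'\<in>Basis. if b' = b then t else 0)"
      using that by (intro sum.cong refl) (auto simp: inner_Basis)
    also have "\<dots> = t" using that by simp
    finally show ?thesis .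
  qed
  have "((\<lambda>\<alpha>. c \<alpha> * (\<Prod>b\<in>Basis. t ^ \<alpha> b)) has_sum K x0) ?A"
  proof -
    have "(\<Prod>b\<in>Basis. ((x0 - a) \<bullet> b) ^ \<alpha> b) = (\<Prod>b\<in>Basis. t ^ \<alpha> b)" for \<alpha>
      by (intro prod.cong refl) (simp only: x0b)
    then show ?thesis using c[OF x0] by (simp only:)
  qed
  then have "(\<lambda>\<alpha>. c \<alpha> * (\<Prod>b\<in>Basis. t ^ \<alpha> b)) summable_on ?A" by (auto simp: summable_on_def)
  then have abs_summ: "(\<lambda>\<alpha>. norm (c \<alpha> * (\<Prod>b\<in>Basis. t ^ \<alpha> b))) summable_on ?A"
    by (rule summable_on_iff_abs_summable_on_real[THEN iffD1])
  have summ: "(\<lambda>\<alpha>. \<bar>c \<alpha>\<bar> * (\<Prod>b\<in>Basis. t ^ \<alpha> b)) summable_on ?A"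
  proof -
    have "\<bar>\<Prod>b\<in>(Basis :: (complex^'n) set). t ^ \<alpha> b\<bar> = (\<Prod>b\<in>Basis. t ^ \<alpha> b)" for \<alpha>
      using t by (intro abs_of_nonneg prod_nonneg) auto
    with abs_summ show ?thesis by (simp only: real_norm_def abs_mult)
  qed
  define h :: "complex^'n \<Rightarrow> complex^'n \<Rightarrow> complex" where "h b x = (\<Sum>i\<in>UNIV. x $ i * cnj (b $ i))" for b x
  have h_holo: "holo_on (\<lambda>z. h b (z - a)) T" for b T
    unfolding h_def vector_minus_component
    by (intro holo_on_sum holo_on_mult holo_on_const holo_on_diff holo_on_component)
  have h_norm: "cmod (h b x) \<le> norm x" if b: "b \<in> Basis" for b x
  proof -
    obtain i u where u: "u \<in> Basis" "b = axis i u" using b by (auto simp: Basis_vec_def)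
    have "h b x = (\<Sum>j\<in>UNIV. if j = i then x $ i * cnj u else 0)"
      unfolding h_def u axis_def by (intro sum.cong) auto
    then have "cmod (h b x) = cmod (x $ i) * cmod u" by (simp add: norm_mult)
    also have "cmod u = 1" using u by (auto simp: Basis_complex_def)
    finally show ?thesis using Finite_Cartesian_Product.norm_nth_le[of x i] by simp
  qed
  have h_Re: "x \<bullet> b = Re (h b x)" for x b
    by (simp add: h_def inner_vec_def inner_complex_def)
  define lin where "lin b z w = (h b (z - a) + cnj (h b (w - a))) / 2" for b z w
  have lin_diag: "lin b z z = of_real ((z - a) \<bullet> b)" for b z
    by (simp add: lin_def h_Re complex_add_cnj)
  have lin_norm: "cmod (lin b z w) \<le> t" if "b \<in> Basis" "z \<in> ball a t" "w \<in> ball a t" for b z w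
  proof -
    have "cmod (h b (z - a)) \<le> t" "cmod (h b (w - a)) \<le> t"
      using h_norm[OF that(1), of "z - a"] h_norm[OF that(1), of "w - a"] that
      by (auto simp: dist_norm norm_minus_commute)
    then have "cmod (h b (z - a) + cnj (h b (w - a))) \<le> t + t"
      by (intro order_trans[OF norm_triangle_ineq] add_mono) auto
    then show ?thesis by (simp add: lin_def norm_divide)
  qed
  define q where "q \<alpha> p = of_real (c \<alpha>) * (\<Prod>b\<in>Basis. lin b (fst p) (snd p) ^ \<alpha> b)" for \<alpha> p
  have q_norm: "norm (q \<alpha> p) \<le> \<bar>c \<alpha>\<bar> * (\<Prod>b\<in>Basis. t ^ \<alpha> b)" if "p \<in> ball a t \<times> ball a t" for \<alpha> p
    unfolding q_def norm_mult prod_norm[symmetric] norm_power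
    using that t by (intro mult_mono prod_mono power_mono conjI lin_norm prod_nonneg) auto
  define F where "F z w = (\<Sum>\<^sub>\<infinity>\<alpha>\<in>?A. q \<alpha> (z, w))" for z w
  have ulim: "uniform_limit (ball a t \<times> ball a t) (\<lambda>X p. \<Sum>\<alpha>\<in>X. q \<alpha> p) (\<lambda>p. \<Sum>\<^sub>\<infinity>\<alpha>\<in>?A. q \<alpha> p) (finite_subsets_at_top ?A)"
    by (rule Weierstrass_m_test_general[OF q_norm summ])
  then have approx: "\<exists>X. \<forall>z\<in>ball a t. \<forall>w\<in>ball a t. cmod ((\<Sum>\<alpha>\<in>X. q \<alpha> (z, w)) - F z w) < e"
    if "e > 0" for e
    using eventually_happens'[OF finite_subsets_at_top_neq_bot uniform_limitD[OF ulim that]]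
    unfolding F_def dist_norm by blast
  define s0 where "s0 = min t r"
  have "s0 > 0" using t r by (simp add: s0_def)
  obtain s1 where s1: "s1 > 0" "ball a s1 \<subseteq> S" using S a openE by blast
  define s where "s = min s0 s1"
  have s: "s > 0" "ball a s \<subseteq> ball a t" "ball a s \<subseteq> ball a r" "ball a s \<subseteq> S"
    using \<open>s0 > 0\<close> s1 by (auto simp: s_def s0_def)
  have "sesqui_holo_on F (ball a s)"
    unfolding sesqui_holo_on_def antiholo_on_def
  proof (intro conjI ballI)
    fix w assume w: "w \<in> ball a s"
    show "holo_on (\<lambda>z. F z w) (ball a s)"
    proof (rule holo_on_uniform_closure)
      fix e :: real assume "e > 0"
      then obtain X where X: "\<forall>z\<in>ball a t. \<forall>w\<in>ball a t. cmod ((\<Sum>\<alpha>\<in>X. q \<alpha> (z, w)) - F z w) < e"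
        using approx by blast
      have "holo_on (\<lambda>z. \<Sum>\<alpha>\<in>X. q \<alpha> (z, w)) (ball a s)"
        unfolding q_def lin_def fst_conv snd_conv divide_inverse
        by (intro holo_on_sum holo_on_mult holo_on_const holo_on_prod holo_on_power holo_on_add h_holo)
      then show "\<exists>g. holo_on g (ball a s) \<and> (\<forall>z\<in>ball a s. cmod (g z - F z w) \<le> e)"
        using X w s by (intro exI[of _ "\<lambda>z. \<Sum>\<alpha>\<in>X. q \<alpha> (z, w)"]) (auto simp: subset_iff less_imp_le)
    qed simp
  next
    fix z assume z: "z \<in> ball a s"
    show "holo_on (\<lambda>w. cnj (F z w)) (ball a s)"
    proof (rule holo_on_uniform_closure)
      fix e :: real assume "e > 0"
      then obtain X where X: "\<forall>z\<in>ball a t. \<forall>w\<in>ball a t. cmod ((\<Sum>\<alpha>\<in>X. q \<alpha> (z, w)) - F z w) < e"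
        using approx by blast
      have "holo_on (\<lambda>w. cnj (\<Sum>\<alpha>\<in>X. q \<alpha> (z, w))) (ball a s)"
        unfolding q_def lin_def fst_conv snd_conv divide_inverse cnj_sum cnj_prod complex_cnj_mult
          complex_cnj_power complex_cnj_add complex_cnj_cnj
        by (intro holo_on_sum holo_on_mult holo_on_const holo_on_prod holo_on_power holo_on_add h_holo)
      moreover have "cmod (cnj (\<Sum>\<alpha>\<in>X. q \<alpha> (z, w)) - cnj (F z w)) \<le> e" if "w \<in> ball a s" for w
      proof -
        have "z \<in> ball a t" "w \<in> ball a t" using z s(2) that by blast+
        then have "cmod ((\<Sum>\<alpha>\<in>X. q \<alpha> (z, w)) - F z w) < e" using X by blast
        then show ?thesis by (metis complex_cnj_diff complex_mod_cnj less_imp_le)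
      qed
      ultimately show "\<exists>g. holo_on g (ball a s) \<and> (\<forall>w\<in>ball a s. cmod (g w - cnj (F z w)) \<le> e)" by blast
    qed simp
  qed
  moreover have "\<exists>M. \<forall>z\<in>ball a s. \<forall>w\<in>ball a s. cmod (F z w) \<le> M"
  proof -
    obtain X where X: "\<forall>z\<in>ball a t. \<forall>w\<in>ball a t. cmod ((\<Sum>\<alpha>\<in>X. q \<alpha> (z, w)) - F z w) < 1"
      using approx[of 1] by auto
    have "cmod (F z w) \<le> (\<Sum>\<alpha>\<in>X. \<bar>c \<alpha>\<bar> * (\<Prod>b\<in>Basis. t ^ \<alpha> b)) + 1" if "z \<in> ball a s" "w \<in> ball a s" for z w
    proof -
      have zw: "z \<in> ball a t" "w \<in> ball a t" using that s by auto
      have "cmod (\<Sum>\<alpha>\<in>X. q \<alpha> (z, w)) \<le> (\<Sum>\<alpha>\<in>X. \<bar>c \<alpha>\<bar> * (\<Prod>b\<in>Basis. t ^ \<alpha> b))"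
        using zw by (intro sum_norm_le q_norm) auto
      moreover have "cmod ((\<Sum>\<alpha>\<in>X. q \<alpha> (z, w)) - F z w) < 1" using X zw by blast
      ultimately show ?thesis
        using norm_triangle_sub[of "F z w" "\<Sum>\<alpha>\<in>X. q \<alpha> (z, w)"] by (simp add: norm_minus_commute)
    qed
    then show ?thesis by blast
  qed
  moreover have "F z z = of_real (K z)" if "z \<in> ball a s" for z
  proof -
    have "((\<lambda>\<alpha>. complex_of_real (c \<alpha> * (\<Prod>b\<in>Basis. ((z - a) \<bullet> b) ^ \<alpha> b))) has_sum of_real (K z)) ?A"
      using c[of z] that s by (intro has_sum_of_real) auto
    then have "((\<lambda>\<alpha>. q \<alpha> (z, z)) has_sum of_real (K z)) ?A"
      by (simp only: q_def lin_diag fst_conv snd_conv of_real_mult of_real_prod of_real_power)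
    then show ?thesis unfolding F_def by (rule infsumI)
  qed
  ultimately show thesis using that s by blast
qed

section \<open>Transport of norms along the domain\<close>

lemma bergman_kernel_locally_bounded:
  fixes S :: "(complex^'n) set"
  assumes S: "open S" and a: "a \<in> S"
  obtains r M where "r > 0" "ball a r \<subseteq> S"
    "\<And>z w. z \<in> ball a r \<Longrightarrow> w \<in> ball a r \<Longrightarrow> cmod (bergman_kernel S z w) \<le> M"
proof -
  obtain e where e: "e > 0" "cball a e \<subseteq> S" using S a open_contains_cball by blast
  have r: "e / 3 > 0" using e by simp
  have sub: "cball z (2 * (e / 3)) \<subseteq> S" if "z \<in> ball a (e / 3)" for z
    using that by (intro order_trans[OF _ e(2)]) (auto simp: cball_subset_cball_iff dist_commute)
  have "ball a (e / 3) \<subseteq> S" using e by (auto simp: subset_iff)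
  then show thesis using that[OF r _ bergman_kernel_bound[OF S r]] sub by blast
qed

text \<open>The inequality \<open>\<parallel>p\<parallel>\<^sup>2 \<le> C\<close> is positivity of a kernel built from \<open>K\<close> and \<open>p\<close>, which may be
  tested near any point of the domain and, by analyticity of \<open>K\<close>, spreads from the points of \<open>D1\<close>
  to all points of the connected set \<open>D\<close>.\<close>

lemma l2_sqnorm_transport:
  fixes D D1 D2 :: "(complex^'n) set" and K :: "complex^'n \<Rightarrow> real"
  assumes D: "open D" "connected D" and K: "real_analytic_on K D"
    and D1: "open D1" "D1 \<noteq> {}" "D1 \<subseteq> D" and D2: "open D2" "connected D2" "D2 \<noteq> {}" "D2 \<subseteq> D"
    and k1: "0 < k1" "\<And>z. z \<in> D1 \<Longrightarrow> bergman_kernel D1 z z = of_real (k1 * K z)"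
    and k2: "0 < k2" "\<And>z. z \<in> D2 \<Longrightarrow> bergman_kernel D2 z z = of_real (k2 * K z)"
    and p: "holo_on p D"
    and p1: "p1 \<in> bergman_fns D1" "\<And>z. z \<in> D1 \<Longrightarrow> p1 z = p z"
    and p2: "p2 \<in> bergman_fns D2" "\<And>z. z \<in> D2 \<Longrightarrow> p2 z = p z"
  shows "k2 * l2_sqnorm D2 p2 \<le> k1 * l2_sqnorm D1 p1"
proof -
  \<comment> \<open>On \<open>D1\<close> the Bergman kernel is \<open>k1\<close> times the extension \<open>F\<close> of \<open>K\<close>; so positivity of \<open>G F\<close> means
    that the squared norm of \<open>p\<close> on \<open>D1\<close> is at most \<open>C / k1\<close>, and correspondingly on \<open>D2\<close>.\<close>
  define C where "C = k1 * l2_sqnorm D1 p1"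
  define G where "G F = (\<lambda>z w. complex_of_real C * F z w - p z * cnj (p w))" for F
  define ext where "ext F a s \<longleftrightarrow> ball a s \<subseteq> D \<and> sesqui_holo_on F (ball a s) \<and>
      (\<exists>M. \<forall>z\<in>ball a s. \<forall>w\<in>ball a s. cmod (F z w) \<le> M) \<and> (\<forall>z\<in>ball a s. F z z = of_real (K z))"
    for F a s
  define good where "good a \<longleftrightarrow> (\<exists>s>0. \<exists>F. ext F a s \<and> psd_kernel (G F) (ball a s))" for a
  have ext_mono: "ext F b s'" if "ext F a s" "ball b s' \<subseteq> ball a s" for F a s b s'
    using that sesqui_holo_on_subset unfolding ext_def by (meson order_trans subsetD)
  have ext_unique: "F z w = F' z w" if e: "ext F a s" "ext F' a s" and zw: "z \<in> ball a s" "w \<in> ball a s" for F F' a s z w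
  proof -
    obtain M where M: "\<And>z w. z \<in> ball a s \<Longrightarrow> w \<in> ball a s \<Longrightarrow> cmod (F z w) \<le> M"
      using e(1) unfolding ext_def by blast
    obtain M' where M': "\<And>z w. z \<in> ball a s \<Longrightarrow> w \<in> ball a s \<Longrightarrow> cmod (F' z w) \<le> M'"
      using e(2) unfolding ext_def by blast
    show ?thesis
      by (rule sesqui_eq_if_eq_on_diagonal[OF _ _ open_ball convex_ball M M' _ zw])
        (use e in \<open>simp_all add: ext_def\<close>)
  qed
  have ext_ex: "\<exists>s>0. \<exists>F. ext F a s" if a: "a \<in> D" for a
  proof -
    obtain s F M where "s > 0" "ball a s \<subseteq> D" "sesqui_holo_on F (ball a s)"
      "\<And>z w. z \<in> ball a s \<Longrightarrow> w \<in> ball a s \<Longrightarrow> cmod (F z w) \<le> M"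
      "\<And>z. z \<in> ball a s \<Longrightarrow> F z z = of_real (K z)"
      by (rule real_analytic_sesqui_extension[OF K a D(1)]) blast
    then show ?thesis unfolding ext_def by blast
  qed
  have kernel_ext: "\<exists>s>0. ball a s \<subseteq> D' \<and> ext (\<lambda>z w. bergman_kernel D' z w / of_real k) a s"
    if D': "open D'" "D' \<subseteq> D" "a \<in> D'" and k: "0 < k" "\<And>z. z \<in> D' \<Longrightarrow> bergman_kernel D' z z = of_real (k * K z)"
    for a D' k
  proof -
    obtain r M where r: "r > 0" "ball a r \<subseteq> D'"
      "\<And>z w. z \<in> ball a r \<Longrightarrow> w \<in> ball a r \<Longrightarrow> cmod (bergman_kernel D' z w) \<le> M"
      by (rule bergman_kernel_locally_bounded[OF D'(1,3)]) blast
    have "sesqui_holo_on (\<lambda>z w. (1 / of_real k) * bergman_kernel D' z w) (ball a r)"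
      by (intro sesqui_holo_on_cmult sesqui_holo_on_subset[OF bergman_kernel_sesqui[OF D'(1)] r(2)])
    then have "sesqui_holo_on (\<lambda>z w. bergman_kernel D' z w / of_real k) (ball a r)" by simp
    moreover have "cmod (bergman_kernel D' z w / of_real k) \<le> M / k" if "z \<in> ball a r" "w \<in> ball a r" for z w
      using r(3)[OF that] k by (simp add: norm_divide divide_right_mono)
    moreover have "bergman_kernel D' z z / of_real k = of_real (K z)" if "z \<in> ball a r" for z
    proof -
      have "z \<in> D'" using that r by blast
      then show ?thesis using k by simp
    qed
    ultimately have "ext (\<lambda>z w. bergman_kernel D' z w / of_real k) a r"
      using r(2) D'(2) unfolding ext_def by blast
    then show ?thesis using r by blast
  qed
  have start: "good a" if a: "a \<in> D1" for a
  proof -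
    obtain s where s: "s > 0" "ball a s \<subseteq> D1" "ext (\<lambda>z w. bergman_kernel D1 z w / of_real k1) a s"
      using kernel_ext[OF D1(1,3) a k1] by blast
    have "psd_kernel (\<lambda>z w. of_real (l2_sqnorm D1 p1) * bergman_kernel D1 z w - p1 z * cnj (p1 w)) (ball a s)"
      using psd_kernel_subset[OF psd_kernel_bergman[OF D1(1) p1(1)] s(2)] .
    then have "psd_kernel (G (\<lambda>z w. bergman_kernel D1 z w / of_real k1)) (ball a s)"
      by (rule psd_kernel_cong[rotated]) (use s(2) p1(2) k1(1) in \<open>auto simp: G_def C_def subset_iff\<close>)
    then show ?thesis using s unfolding good_def by blast
  qed
  \<comment> \<open>If positivity holds near one point of a ball in which \<open>K\<close> has an extension, it holds near all
    points of a concentric smaller ball.\<close>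
  have nbhd: "\<exists>T. openin (top_of_set D) T \<and> a \<in> T \<and> (\<forall>b\<in>T. \<forall>b'\<in>T. good b \<longrightarrow> good b')" if a: "a \<in> D" for a
  proof -
    obtain s0 F where s0: "s0 > 0" "ext F a s0" using ext_ex[OF a] by blast
    define s where "s = s0 / 2"
    have s: "s > 0" "ext F a s" using s0 ext_mono[OF s0(2), of a s] by (auto simp: s_def subset_ball)
    have "cball a s \<subseteq> ball a s0" using s0 by (auto simp: s_def)
    then have csub: "cball a s \<subseteq> D" using s0 by (auto simp: ext_def)
    obtain Mp where Mp0: "0 \<le> Mp" and Mp: "\<And>z. z \<in> cball a s \<Longrightarrow> cmod (p z) \<le> Mp"
      by (rule continuous_on_compact_bound[OF compact_cball
            continuous_on_subset[OF holo_on_imp_continuous_on[OF p] csub]]) blast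
    obtain M where M: "\<And>z w. z \<in> ball a s \<Longrightarrow> w \<in> ball a s \<Longrightarrow> cmod (F z w) \<le> M"
      using s(2) unfolding ext_def by blast
    have Gs: "sesqui_holo_on (G F) (ball a s)"
      unfolding G_def using s(2) csub
      by (intro sesqui_holo_on_diff sesqui_holo_on_cmult sesqui_holo_on_rank_one holo_on_subset[OF p])
        (auto simp: ext_def)
    have GM: "cmod (G F z w) \<le> \<bar>C\<bar> * M + Mp * Mp" if "z \<in> ball a s" "w \<in> ball a s" for z w
    proof -
      have pz: "cmod (p z) \<le> Mp" "cmod (p w) \<le> Mp" using Mp that by auto
      then have "cmod (p z * cnj (p w)) \<le> Mp * Mp" using Mp0 by (simp add: norm_mult mult_mono)
      moreover have "cmod (of_real C * F z w) \<le> \<bar>C\<bar> * M"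
        using M[OF that] by (simp add: norm_mult mult_left_mono)
      ultimately show ?thesis unfolding G_def
        using norm_triangle_ineq4[of "of_real C * F z w" "p z * cnj (p w)"] by linarith
    qed
    have trans_good: "good b'" if b: "b \<in> ball a (s/4)" "good b" and b': "b' \<in> ball a (s/4)" for b b'
    proof -
      obtain t F' where t: "t > 0" "ext F' b t" "psd_kernel (G F') (ball b t)"
        using b(2) by (auto simp: good_def)
      have sub: "ball b (s/2) \<subseteq> ball a s"
        using b(1) s(1) by (auto simp: ball_subset_ball_iff dist_commute)
      define t' where "t' = min t (s/2)"
      have t': "t' > 0" "ball b t' \<subseteq> ball b t" "ball b t' \<subseteq> ball b (s/2)" using t s by (auto simp: t'_def)
      have ext': "ext F' b t'" "ext F b t'"
        using ext_mono[OF t(2) t'(2)] ext_mono[OF s(2) order_trans[OF t'(3) sub]] .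
      have eq: "F' z w = F z w" if "z \<in> ball b t'" "w \<in> ball b t'" for z w
        by (rule ext_unique[OF ext' that])
      have "psd_kernel (G F) (ball b t')"
        by (rule psd_kernel_cong[OF _ psd_kernel_subset[OF t(3) t'(2)]]) (use eq in \<open>auto simp: G_def\<close>)
      moreover have "cmod (G F z w) \<le> \<bar>C\<bar> * M + Mp * Mp" if "z \<in> ball b (s/2)" "w \<in> ball b (s/2)" for z w
        by (rule GM) (use that sub in blast)+
      ultimately have big: "psd_kernel (G F) (ball b (s/2))"
        by (intro psd_kernel_ball_extend[OF sesqui_holo_on_subset[OF Gs sub] _ _ t'(1)])
      have dbb': "dist b b' < s/2" using b(1) b' dist_triangle[of b b' a] by (auto simp: dist_commute)
      define u where "u = s/2 - dist b b'"
      have u: "u > 0" using dbb' by (simp add: u_def)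
      have usub: "ball b' u \<subseteq> ball b (s/2)"
        by (auto simp: ball_subset_ball_iff u_def dist_commute)
      have "ext F b' u" by (rule ext_mono[OF s(2) order_trans[OF usub sub]])
      moreover have "psd_kernel (G F) (ball b' u)" by (rule psd_kernel_subset[OF big usub])
      ultimately show ?thesis using u unfolding good_def by blast
    qed
    have "openin (top_of_set D) (ball a (s/4))"
      using csub s(1) by (intro open_subset order_trans[OF _ csub]) auto
    moreover have "a \<in> ball a (s/4)" using s(1) by simp
    ultimately show ?thesis using trans_good by blast
  qed
  obtain a where a: "a \<in> D1" using D1(2) by blast
  have all_good: "good b" if b: "b \<in> D" for b
    by (rule connected_induction_simple[OF D(2) _ b start[OF a] nbhd]) (use a D1(3) in blast)
  obtain b where b: "b \<in> D2" using D2 by blast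
  then have "good b" using D2 all_good by blast
  then obtain t F where t: "t > 0" "ext F b t" "psd_kernel (G F) (ball b t)" by (auto simp: good_def)
  obtain s where s: "s > 0" "ball b s \<subseteq> D2" "ext (\<lambda>z w. bergman_kernel D2 z w / of_real k2) b s"
    using kernel_ext[OF D2(1,4) b k2] by blast
  define u where "u = min t s"
  have u: "u > 0" "ball b u \<subseteq> ball b t" "ball b u \<subseteq> ball b s" using t s by (auto simp: u_def)
  have eq: "F z w = bergman_kernel D2 z w / of_real k2" if "z \<in> ball b u" "w \<in> ball b u" for z w
    by (rule ext_unique[OF ext_mono[OF t(2) u(2)] ext_mono[OF s(3) u(3)] that])
  have "psd_kernel (\<lambda>z w. of_real (C / k2) * bergman_kernel D2 z w - p2 z * cnj (p2 w)) (ball b u)"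
  proof (rule psd_kernel_cong[OF _ psd_kernel_subset[OF t(3) u(2)]])
    fix z w assume zw: "z \<in> ball b u" "w \<in> ball b u"
    then have "z \<in> D2" "w \<in> D2" using u s by auto
    then show "G F z w = of_real (C / k2) * bergman_kernel D2 z w - p2 z * cnj (p2 w)"
      using eq[OF zw] p2(2) by (simp add: G_def)
  qed
  then have "l2_sqnorm D2 p2 \<le> C / k2"
    using u s(2) k1(1) k2(1) l2_sqnorm_nonneg[of D1 p1]
    by (intro l2_sqnorm_le_if_psd_kernel[OF D2(1,2) p2(1), of _ "ball b u"]) (auto simp: C_def)
  then show ?thesis using k2(1) by (simp add: C_def field_simps)
qed

section \<open>The two measures coincide\<close>

definition restr :: "'a set \<Rightarrow> ('a \<Rightarrow> complex) \<Rightarrow> 'a \<Rightarrow> complex" where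
  "restr S f = (\<lambda>z. if z \<in> S then f z else 0)"

lemma l2_sqnorm_cong:
  assumes "open S" "\<And>z. z \<in> S \<Longrightarrow> f z = g z" shows "l2_sqnorm S f = l2_sqnorm S g"
  unfolding l2_sqnorm_def using assms by (intro set_lebesgue_integral_cong) auto

lemma l2_inner_cong:
  assumes "open S" "\<And>z. z \<in> S \<Longrightarrow> f z = f' z" "\<And>z. z \<in> S \<Longrightarrow> g z = g' z"
  shows "l2_inner S f g = l2_inner S f' g'"
  unfolding l2_inner_def using assms by (intro set_lebesgue_integral_cong) auto

lemma restr_in_bergman_fns:
  fixes p :: "complex^'n \<Rightarrow> complex"
  assumes D: "open D" "bounded D" and p: "holo_on p UNIV"
  shows "restr D p \<in> bergman_fns D"
proof (rule bergman_fnsI_nn_integral[OF D(1)])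
  show "holo_on (restr D p) D"
    using holo_on_cong[OF D(1), of "restr D p" p] holo_on_subset[OF p] by (simp add: restr_def)
  show "restr D p z = 0" if "z \<notin> D" for z using that by (simp add: restr_def)
  have "compact (closure D)" using D(2) by (simp only: compact_closure)
  then obtain M where "0 \<le> M" and M: "\<And>z. z \<in> closure D \<Longrightarrow> cmod (p z) \<le> M"
    by (rule continuous_on_compact_bound[OF _
          continuous_on_subset[OF holo_on_imp_continuous_on[OF p] subset_UNIV]]) blast
  have "(\<integral>\<^sup>+z\<in>D. ennreal ((cmod (restr D p z))\<^sup>2) \<partial>lborel) \<le> (\<integral>\<^sup>+z\<in>D. ennreal (M\<^sup>2) \<partial>lborel)"
  proof (intro nn_integral_mono)
    fix z
    show "ennreal ((cmod (restr D p z))\<^sup>2) * indicator D z \<le> ennreal (M\<^sup>2) * indicator D z"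
      using M[of z] closure_subset[of D]
      by (auto simp: restr_def indicator_def intro!: ennreal_leI power_mono)
  qed
  also have "\<dots> = ennreal (M\<^sup>2) * emeasure lborel D"
    using D by (subst nn_integral_cmult_indicator) auto
  also have "\<dots> < \<infinity>" using emeasure_bounded_finite[OF D(2)] by (simp add: ennreal_mult_less_top)
  finally show "(\<integral>\<^sup>+z\<in>D. ennreal ((cmod (restr D p z))\<^sup>2) \<partial>lborel) < \<infinity>" .
qed

text \<open>These are the functions whose integrals are determined by inner products of entire functions.
  They form an algebra, which contains the real polynomials in the real and imaginary parts of the
  coordinates.\<close>

inductive sesqui_entire :: "(complex^'n \<Rightarrow> complex) \<Rightarrow> bool" where
  product: "holo_on p UNIV \<Longrightarrow> holo_on q UNIV \<Longrightarrow> sesqui_entire (\<lambda>z. p z * cnj (q z))"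
| sum: "sesqui_entire f \<Longrightarrow> sesqui_entire g \<Longrightarrow> sesqui_entire (\<lambda>z. f z + g z)"

lemma sesqui_entire_mult:
  assumes "sesqui_entire f" "sesqui_entire g" shows "sesqui_entire (\<lambda>z. f z * g z)"
  using assms
proof (induction f)
  case (product p q)
  from product(3) show ?case
  proof (induction g)
    case (product p' q')
    have "sesqui_entire (\<lambda>z. (p z * p' z) * cnj (q z * q' z))"
      using product \<open>holo_on p UNIV\<close> \<open>holo_on q UNIV\<close>
      by (intro sesqui_entire.product holo_on_mult)
    then show ?case by (simp add: mult_ac)
  next
    case (sum f g)
    then show ?case using sesqui_entire.sum by (simp add: distrib_left)
  qed
next
  case (sum f1 f2)
  then show ?case using sesqui_entire.sum by (simp add: distrib_right)
qed

text \<open>A real-linear functional is the real part of the complex-linear functional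
  \<open>x \<mapsto> l x - \<i> l (\<i> x)\<close>.\<close>

lemma sesqui_entire_real_linear:
  fixes l :: "complex^'n \<Rightarrow> real"
  assumes l: "bounded_linear l"
  shows "sesqui_entire (\<lambda>z. of_real (l z))"
proof -
  interpret l: bounded_linear l by (rule l)
  define L where "L z = complex_of_real (l z) - \<i> * of_real (l (\<i> *s z))" for z
  have lin: "linear (\<lambda>z::complex^'n. \<i> *s z)"
    by (rule linearI) (auto simp: vec_eq_iff algebra_simps)
  have "bounded_linear (\<lambda>z. l (\<i> *s z))"
    using bounded_linear_compose[OF l] lin linear_conv_bounded_linear by blast
  then have bl: "bounded_linear L"
    unfolding L_def
    by (intro bounded_linear_sub bounded_linear_const_mult
        bounded_linear_compose[OF bounded_linear_of_real] l)
  have Lc: "L (c *s v) = c * L v" for c v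
  proof -
    have dec: "c *s v = Re c *\<^sub>R v + Im c *\<^sub>R (\<i> *s v)"
      by (simp add: vec_eq_iff complex_eq_iff)
    have dec': "\<i> *s (c *s v) = Re c *\<^sub>R (\<i> *s v) - Im c *\<^sub>R v"
      by (simp add: vec_eq_iff complex_eq_iff)
    have 1: "l (c *s v) = Re c * l v + Im c * l (\<i> *s v)"
      unfolding dec by (simp add: l.add l.scaleR)
    have 2: "l (\<i> *s (c *s v)) = Re c * l (\<i> *s v) - Im c * l v"
      unfolding dec' by (simp add: l.diff l.scaleR)
    show ?thesis unfolding L_def 1 2 by (simp add: complex_eq_iff algebra_simps)
  qed
  have L: "holo_on L UNIV" by (rule holo_on_linear[OF bl Lc])
  have "sesqui_entire (\<lambda>z. (1/2 * L z) * cnj 1 + 1/2 * cnj (L z))"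
    by (intro sesqui_entire.sum sesqui_entire.product holo_on_cmult L holo_on_const)
  moreover have "(1/2 * L z) * cnj 1 + 1/2 * cnj (L z) = of_real (l z)" for z
    by (simp add: L_def complex_eq_iff)
  ultimately show ?thesis by simp
qed

lemma sesqui_entire_real_polynomial:
  fixes g :: "complex^'n \<Rightarrow> real"
  assumes "real_polynomial_function g"
  shows "sesqui_entire (\<lambda>z. of_real (g z))"
  using assms
proof (induction g)
  case (linear f)
  then show ?case by (rule sesqui_entire_real_linear)
next
  case (const c)
  have "sesqui_entire (\<lambda>z::complex^'n. of_real c * cnj 1)"
    by (intro sesqui_entire.product holo_on_const)
  then show ?case by simp
next
  case (add f g)
  then show ?case using sesqui_entire.sum by simp
next
  case (mult f g)
  then show ?case using sesqui_entire_mult by simp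
qed

lemma sesqui_entire_set_integrable:
  fixes h :: "complex^'n \<Rightarrow> complex"
  assumes D: "open D" "bounded D" and h: "sesqui_entire h"
  shows "set_integrable lborel D h"
  using h
proof induction
  case (product p q)
  have "set_integrable lborel D (\<lambda>z. restr D p z * cnj (restr D q z))"
    by (intro bergman_fns_set_integrable restr_in_bergman_fns D product)
  then show ?case by (subst set_integrable_cong[OF refl refl]) (auto simp: restr_def)
next
  case (sum f g)
  then show ?case by (intro set_integral_add)
qed

lemma set_integrable_continuous_bounded:
  fixes f :: "'a::euclidean_space \<Rightarrow> real"
  assumes D: "open D" "bounded D" and f: "continuous_on UNIV f"
  shows "set_integrable lborel D f"
proof (rule set_integrable_subset)
  show "set_integrable lborel (closure D) f"
    unfolding set_integrable_def
    using D f by (intro borel_integrable_compact) (auto intro: continuous_on_subset)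
qed (use D closure_subset in auto)

lemma set_integral_diff_le:
  fixes f g :: "'a::euclidean_space \<Rightarrow> real"
  assumes D: "open D" "bounded D" and f: "set_integrable lborel D f" and g: "set_integrable lborel D g"
    and e: "\<And>x. x \<in> D \<Longrightarrow> \<bar>f x - g x\<bar> \<le> e"
  shows "\<bar>(LINT x:D|lborel. f x) - (LINT x:D|lborel. g x)\<bar> \<le> e * measure lborel D"
proof -
  have fin: "emeasure lborel D < \<infinity>" by (rule emeasure_bounded_finite[OF D(2)])
  have fg: "set_integrable lborel D (\<lambda>x. f x - g x)" by (intro set_integral_diff f g)
  have ind: "integrable lborel (\<lambda>x. indicator D x *\<^sub>R e)"
    using fin D by (intro integrable_scaleR_left integrable_real_indicator) auto
  have "\<bar>(LINT x:D|lborel. f x) - (LINT x:D|lborel. g x)\<bar> = norm (LINT x:D|lborel. f x - g x)"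
    using f g by (simp add: set_integral_diff)
  also have "\<dots> \<le> (LINT x|lborel. norm (indicator D x *\<^sub>R (f x - g x)))"
    unfolding set_lebesgue_integral_def by (rule integral_norm_bound)
  also have "\<dots> \<le> (LINT x|lborel. indicator D x *\<^sub>R e)"
    using fg e by (intro integral_mono ind integrable_norm) (auto simp: set_integrable_def indicator_def)
  also have "\<dots> = e * measure lborel D" using D fin by (simp add: mult.commute)
  finally show ?thesis .
qed

text \<open>Giving a factor to both kernels makes the situation symmetric in the two domains.\<close>

locale proportional_kernels =
  fixes D D1 D2 :: "(complex^'n) set" and K :: "complex^'n \<Rightarrow> real" and k1 k2 :: real
  assumes D: "open D" "connected D" and K: "real_analytic_on K D"
    and D1: "open D1" "connected D1" "D1 \<noteq> {}" "D1 \<subseteq> D" "bounded D1"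
    and D2: "open D2" "connected D2" "D2 \<noteq> {}" "D2 \<subseteq> D" "bounded D2"
    and k1: "0 < k1" "\<And>z. z \<in> D1 \<Longrightarrow> bergman_kernel D1 z z = of_real (k1 * K z)"
    and k2: "0 < k2" "\<And>z. z \<in> D2 \<Longrightarrow> bergman_kernel D2 z z = of_real (k2 * K z)"
begin

lemma entire_sqnorm_eq:
  assumes p: "holo_on p UNIV"
  shows "k1 * l2_sqnorm D1 (restr D1 p) = k2 * l2_sqnorm D2 (restr D2 p)"
proof (rule antisym)
  have pD: "holo_on p D" using holo_on_subset[OF p] by blast
  have r1: "restr D1 p \<in> bergman_fns D1" by (rule restr_in_bergman_fns[OF D1(1,5) p])
  have r2: "restr D2 p \<in> bergman_fns D2" by (rule restr_in_bergman_fns[OF D2(1,5) p])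
  show "k2 * l2_sqnorm D2 (restr D2 p) \<le> k1 * l2_sqnorm D1 (restr D1 p)"
    by (rule l2_sqnorm_transport[OF D K D1(1,3,4) D2(1-4) k1 k2 pD r1 _ r2]) (simp_all add: restr_def)
  show "k1 * l2_sqnorm D1 (restr D1 p) \<le> k2 * l2_sqnorm D2 (restr D2 p)"
    by (rule l2_sqnorm_transport[OF D K D2(1,3,4) D1(1-4) k2 k1 pD r2 _ r1]) (simp_all add: restr_def)
qed

text \<open>Polarization; the imaginary part for \<open>q\<close> is the real part for \<open>\<i> q\<close>.\<close>

lemma entire_inner_eq:
  assumes p: "holo_on p UNIV" and q: "holo_on q UNIV"
  shows "of_real k1 * l2_inner D1 p q = of_real k2 * l2_inner D2 p q"
proof -
  have polar: "2 * Re (l2_inner S p q)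
      = l2_sqnorm S (restr S (\<lambda>z. p z + q z)) - l2_sqnorm S (restr S p) - l2_sqnorm S (restr S q)"
    if S: "open S" "bounded S" and "holo_on p UNIV" "holo_on q UNIV" for S p q
  proof -
    interpret H: hilbert_subspace fscale "bergman_fns S" "l2_inner S" by (rule hilbert_bergman[OF S(1)])
    have "restr S p \<in> bergman_fns S" "restr S q \<in> bergman_fns S"
      using that by (auto intro: restr_in_bergman_fns)
    from H.sq_add[OF this] have "l2_sqnorm S (restr S p + restr S q) =
        l2_sqnorm S (restr S p) + 2 * Re (l2_inner S (restr S p) (restr S q)) + l2_sqnorm S (restr S q)"
      by (simp only: sq_bergman[OF S(1)])
    moreover have "restr S p + restr S q = restr S (\<lambda>z. p z + q z)" by (auto simp: restr_def)
    moreover have "l2_inner S (restr S p) (restr S q) = l2_inner S p q"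
      using S by (intro l2_inner_cong) (auto simp: restr_def)
    ultimately show ?thesis by simp
  qed
  have Re_eq: "k1 * Re (l2_inner D1 p q) = k2 * Re (l2_inner D2 p q)"
    if "holo_on p UNIV" "holo_on q UNIV" for p q
  proof -
    have "k1 * (2 * Re (l2_inner D1 p q)) = k2 * (2 * Re (l2_inner D2 p q))"
      unfolding polar[OF D1(1,5) that] polar[OF D2(1,5) that]
      using entire_sqnorm_eq[OF that(1)] entire_sqnorm_eq[OF that(2)]
        entire_sqnorm_eq[OF holo_on_add[OF that]]
      by (simp add: right_diff_distrib)
    then show ?thesis by simp
  qed
  have i: "l2_inner S p (\<lambda>z. \<i> * q z) = - \<i> * l2_inner S p q" for S
  proof -
    have "l2_inner S p (\<lambda>z. \<i> * q z) = (LINT z:S|lborel. - \<i> * (p z * cnj (q z)))"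
      unfolding l2_inner_def by (simp add: mult_ac)
    also have "\<dots> = - \<i> * l2_inner S p q" unfolding l2_inner_def by (rule set_integral_mult_right)
    finally show ?thesis .
  qed
  have "k1 * Im (l2_inner D1 p q) = k2 * Im (l2_inner D2 p q)"
    using Re_eq[OF p holo_on_cmult[OF q, of \<i>]] by (simp add: i)
  then show ?thesis using Re_eq[OF p q] by (simp add: complex_eq_iff)
qed

text \<open>Polynomials approximate \<open>f\<close> uniformly on the compact closure of the union of the domains.\<close>

lemma integral_continuous_eq:
  fixes f :: "complex^'n \<Rightarrow> real"
  assumes f: "continuous_on UNIV f"
  shows "k1 * (LINT z:D1|lborel. f z) = k2 * (LINT z:D2|lborel. f z)"
proof -
  have poly: "of_real k1 * (LINT z:D1|lborel. h z) = of_real k2 * (LINT z:D2|lborel. h z)"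
    if "sesqui_entire h" for h :: "complex^'n \<Rightarrow> complex"
    using that
  proof induction
    case (product p q)
    then show ?case using entire_inner_eq by (simp add: l2_inner_def)
  next
    case (sum f g)
    then show ?case
      using sesqui_entire_set_integrable[OF D1(1,5)] sesqui_entire_set_integrable[OF D2(1,5)]
      by (simp add: set_integral_add distrib_left)
  qed
  have poly': "k1 * (LINT z:D1|lborel. g z) = k2 * (LINT z:D2|lborel. g z)"
    if "real_polynomial_function g" for g :: "complex^'n \<Rightarrow> real"
  proof -
    have "(LINT z:S|lborel. complex_of_real (g z)) = of_real (LINT z:S|lborel. g z)" for S
      by (rule set_integral_complex_of_real)
    then have "complex_of_real (k1 * (LINT z:D1|lborel. g z)) = of_real (k2 * (LINT z:D2|lborel. g z))"
      using poly[OF sesqui_entire_real_polynomial[OF that]] by simp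
    then show ?thesis by (simp only: of_real_eq_iff)
  qed
  define c where "c = k1 * measure lborel D1 + k2 * measure lborel D2"
  have c: "c \<ge> 0" using k1 k2 by (simp add: c_def)
  have close: "\<bar>k1 * (LINT z:D1|lborel. f z) - k2 * (LINT z:D2|lborel. f z)\<bar> \<le> e * c" if e: "e > 0" for e
  proof -
    have "bounded (D1 \<union> D2)" using D1 D2 by simp
    then have "compact (closure (D1 \<union> D2))" by (simp only: compact_closure)
    then obtain g where g: "real_polynomial_function g"
      "\<And>x. x \<in> closure (D1 \<union> D2) \<Longrightarrow> \<bar>f x - g x\<bar> < e"
      using Stone_Weierstrass_real_polynomial_function[OF _ continuous_on_subset[OF f subset_UNIV] e]
      by metis
    have gc: "continuous_on UNIV g"
      using g(1) continuous_on_polymonial_function real_polynomial_function_eq by blast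
    have fg: "\<bar>f x - g x\<bar> \<le> e" if "x \<in> D1 \<or> x \<in> D2" for x
      using g(2)[of x] closure_subset[of "D1 \<union> D2"] that by (auto intro: less_imp_le)
    have "\<bar>(LINT z:D1|lborel. f z) - (LINT z:D1|lborel. g z)\<bar> \<le> e * measure lborel D1"
      using fg by (intro set_integral_diff_le set_integrable_continuous_bounded D1 f gc) auto
    then have 1: "\<bar>k1 * ((LINT z:D1|lborel. f z) - (LINT z:D1|lborel. g z))\<bar> \<le> k1 * (e * measure lborel D1)"
      using k1 by (simp add: abs_mult)
    have "\<bar>(LINT z:D2|lborel. f z) - (LINT z:D2|lborel. g z)\<bar> \<le> e * measure lborel D2"
      using fg by (intro set_integral_diff_le set_integrable_continuous_bounded D2 f gc) auto
    then have 2: "\<bar>k2 * ((LINT z:D2|lborel. f z) - (LINT z:D2|lborel. g z))\<bar> \<le> k2 * (e * measure lborel D2)"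
      using k2 by (simp add: abs_mult)
    have "e * c = k1 * (e * measure lborel D1) + k2 * (e * measure lborel D2)"
      by (simp add: c_def algebra_simps)
    then show ?thesis using 1 2 poly'[OF g(1)] unfolding right_diff_distrib by linarith
  qed
  have "((\<lambda>e. e * c) \<longlongrightarrow> 0 * c) (at_right 0)" by (intro tendsto_intros)
  then have "\<bar>k1 * (LINT z:D1|lborel. f z) - k2 * (LINT z:D2|lborel. f z)\<bar> \<le> 0 * c"
    by (rule tendsto_lowerbound)
      (use close in \<open>auto simp: eventually_at_right_field intro!: exI[of _ 1]\<close>)
  then show ?thesis by simp
qed

text \<open>The indicator function of \<open>C\<close> is a decreasing limit of continuous functions.\<close>

lemma measure_closed_eq:
  assumes C: "closed C"
  shows "k1 * measure lborel (D1 \<inter> C) = k2 * measure lborel (D2 \<inter> C)"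
proof (cases "C = {}")
  case False
  define f where "f n z = max 0 (1 - real n * infdist z C)" for n z
  have fc: "continuous_on UNIV (f n)" for n
    unfolding f_def by (intro continuous_intros)
  have lim: "(\<lambda>n. f n z) \<longlonglongrightarrow> indicator C z" for z
  proof (cases "z \<in> C")
    case True
    then show ?thesis by (simp add: f_def)
  next
    case False
    then have pos: "infdist z C > 0"
      using C \<open>C \<noteq> {}\<close> in_closed_iff_infdist_zero[of C z] infdist_nonneg[of z C] by linarith
    obtain N where N: "1 / infdist z C < real N" using reals_Archimedean2 by blast
    have "f n z = 0" if "n \<ge> N" for n
    proof -
      have "1 / infdist z C \<le> real n" using N that by linarith
      then show ?thesis using pos by (simp add: f_def field_simps)
    qed
    then have "\<forall>\<^sub>F n in sequentially. f n z = 0" by (auto simp: eventually_sequentially)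
    then show ?thesis using False by (simp add: tendsto_eventually)
  qed
  have int_lim: "(\<lambda>n. LINT z:S|lborel. f n z) \<longlonglongrightarrow> measure lborel (S \<inter> C)" if S: "open S" "bounded S" for S
  proof -
    have fin: "emeasure lborel S < \<infinity>" by (rule emeasure_bounded_finite[OF S(2)])
    have [measurable]: "S \<in> sets borel" "C \<in> sets borel" using S C by auto
    have [measurable]: "f n \<in> borel_measurable borel" for n
      using fc by (rule borel_measurable_continuous_onI)
    have "(\<lambda>n. LINT z|lborel. indicator S z *\<^sub>R f n z) \<longlonglongrightarrow> (LINT z|lborel. indicator S z *\<^sub>R indicator C z)"
    proof (rule integral_dominated_convergence[where w = "indicator S"])
      show "integrable lborel (indicator S :: _ \<Rightarrow> real)"
        using fin by (intro integrable_real_indicator) auto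
      show "AE z in lborel. (\<lambda>n. indicator S z *\<^sub>R f n z) \<longlonglongrightarrow> indicator S z *\<^sub>R indicator C z"
        by (intro AE_I2 tendsto_intros lim)
      show "AE z in lborel. norm (indicator S z *\<^sub>R f n z) \<le> indicator S z" for n
        by (intro AE_I2) (auto simp: f_def indicator_def infdist_nonneg)
    qed measurable
    moreover have "(LINT z|lborel. indicator S z *\<^sub>R indicator C z) = measure lborel (S \<inter> C)"
      by (simp flip: indicator_inter_arith)
    ultimately show ?thesis by (simp add: set_lebesgue_integral_def)
  qed
  have "(\<lambda>n. k1 * (LINT z:D1|lborel. f n z)) \<longlonglongrightarrow> k1 * measure lborel (D1 \<inter> C)"
    by (intro tendsto_intros int_lim D1)
  moreover have "(\<lambda>n. k2 * (LINT z:D2|lborel. f n z)) \<longlonglongrightarrow> k2 * measure lborel (D2 \<inter> C)"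
    by (intro tendsto_intros int_lim D2)
  ultimately show ?thesis
    using integral_continuous_eq[OF fc] LIMSEQ_unique by simp
qed simp

text \<open>The complement of either domain is a closed set that this domain does not charge.\<close>

lemma null_differences:
  shows "emeasure lborel (D1 - D2) = 0" and "emeasure lborel (D2 - D1) = 0"
proof -
  have *: "emeasure lborel S = 0" if "bounded S" "measure lborel S = 0" for S :: "(complex^'n) set"
    using that emeasure_bounded_finite[of S] by (auto simp: measure_def enn2real_eq_0_iff)
  have "k1 * measure lborel (D1 \<inter> - D2) = k2 * measure lborel (D2 \<inter> - D2)"
    using D2 by (intro measure_closed_eq) (auto simp: closed_Compl)
  then have "measure lborel (D1 - D2) = 0" using k1 by (simp add: Diff_eq)
  then show "emeasure lborel (D1 - D2) = 0" using D1 by (intro *) (auto intro: bounded_subset)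
  have "k1 * measure lborel (D1 \<inter> - D1) = k2 * measure lborel (D2 \<inter> - D1)"
    using D1 by (intro measure_closed_eq) (auto simp: closed_Compl)
  then have "measure lborel (D2 - D1) = 0" using k2 by (simp add: Diff_eq)
  then show "emeasure lborel (D2 - D1) = 0" using D2 by (intro *) (auto intro: bounded_subset)
qed

lemma factors_eq: "k1 = k2"
proof -
  have "k1 * measure lborel (D1 \<inter> UNIV) = k2 * measure lborel (D2 \<inter> UNIV)"
    by (rule measure_closed_eq) simp
  moreover have "measure lborel D1 = measure lborel (D1 \<inter> D2)"
    using D1 D2 null_differences
    by (intro measure_eq_AE AE_I'[of "D1 - D2"]) (auto simp: null_sets_def)
  moreover have "measure lborel D2 = measure lborel (D1 \<inter> D2)"
    using D1 D2 null_differences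
    by (intro measure_eq_AE AE_I'[of "D2 - D1"]) (auto simp: null_sets_def)
  moreover have "measure lborel D1 > 0"
  proof -
    obtain x where "x \<in> D1" using D1(3) by auto
    obtain e where x: "e > 0" "ball x e \<subseteq> D1" by (rule openE[OF D1(1) \<open>x \<in> D1\<close>])
    have fm: "D1 \<in> fmeasurable lborel"
      using emeasure_bounded_finite[OF D1(5)] D1(1) by (intro fmeasurableI) auto
    have "measure lborel (ball x e) \<le> measure lborel D1"
      by (rule measure_mono_fmeasurable[OF x(2) _ fm]) simp
    then show ?thesis using content_ball_pos[OF x(1), of x] by linarith
  qed
  ultimately show ?thesis by simp
qed

end

section \<open>Extension of square-integrable holomorphic functions\<close>

text \<open>Without a bound, Baire's theorem provides a ball on which the function is bounded: the sets
  of parameters \<open>w\<close> with \<open>\<bar>F z w\<bar> \<le> m\<close> for all \<open>z\<close> in a compact ball are closed and exhaust it.\<close>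

theorem sesqui_zero_if_zero_on_diagonal_connected:
  fixes F :: "complex^'n \<Rightarrow> complex^'n \<Rightarrow> complex"
  assumes F: "sesqui_holo_on F S" and S: "open S" "connected S"
    and diag: "\<And>z. z \<in> S \<Longrightarrow> F z z = 0" and zw: "z \<in> S" "w \<in> S"
  shows "F z w = 0"
proof -
  obtain e where e: "e > 0" "cball z e \<subseteq> S" using S zw open_contains_cball by blast
  define B where "B = cball z e"
  have F1: "holo_on (\<lambda>x. F x y) S" if "y \<in> S" for y using F that by (simp add: sesqui_holo_on_def)
  have F2: "holo_on (\<lambda>y. cnj (F x y)) S" if "x \<in> S" for x
    using F that by (simp add: sesqui_holo_on_def antiholo_on_def)
  have BS: "B \<subseteq> S" using e by (simp add: B_def)
  have cont2: "continuous_on B (\<lambda>y. cmod (F x y))" if "x \<in> B" for x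
  proof -
    have "continuous_on B (\<lambda>y. cnj (F x y))"
      using holo_on_imp_continuous_on[OF F2] that BS continuous_on_subset by blast
    then have "continuous_on B (\<lambda>y. cmod (cnj (F x y)))" by (rule continuous_on_norm)
    then show ?thesis by (simp only: complex_mod_cnj)
  qed
  define E where "E m = (\<Inter>x\<in>B. {y\<in>B. cmod (F x y) \<le> real m})" for m :: nat
  have clE: "closed (E m)" for m
    unfolding E_def
  proof (intro closed_INT ballI)
    fix x assume "x \<in> B"
    have "closed (B \<inter> (\<lambda>y. cmod (F x y)) -` {..real m})"
      by (rule continuous_closed_preimage[OF cont2[OF \<open>x \<in> B\<close>]]) (simp_all add: B_def)
    moreover have "B \<inter> (\<lambda>y. cmod (F x y)) -` {..real m} = {y \<in> B. cmod (F x y) \<le> real m}" by auto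
    ultimately show "closed {y \<in> B. cmod (F x y) \<le> real m}" by simp
  qed
  have "z \<in> B" using e by (simp add: B_def)
  then have EB: "E m \<subseteq> B" for m unfolding E_def by blast
  have cover: "\<exists>m. y \<in> E m" if y: "y \<in> B" for y
  proof -
    have "continuous_on B (\<lambda>x. F x y)"
      using holo_on_imp_continuous_on[OF F1] y BS continuous_on_subset by blast
    then obtain M where "0 \<le> M" and M: "\<And>x. x \<in> B \<Longrightarrow> cmod (F x y) \<le> M"
      unfolding B_def by (rule continuous_on_compact_bound[OF compact_cball]) blast
    obtain m where "M \<le> real m" using real_arch_simple by blast
    then have "y \<in> E m" using M y by (force simp: E_def intro: order_trans)
    then show ?thesis by blast
  qed
  have "\<exists>m. \<not> B \<subseteq> closure (B - E m)"
  proof (rule ccontr)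
    assume "\<nexists>m. \<not> B \<subseteq> closure (B - E m)"
    then have all: "B \<subseteq> closure (B - E m)" for m by blast
    have "B \<subseteq> closure (\<Inter>(range (\<lambda>m. B - E m)))"
    proof (rule Baire)
      show "closed B" by (simp add: B_def)
      fix T assume "T \<in> range (\<lambda>m. B - E m)"
      then obtain m where "T = B - E m" by blast
      then show "openin (top_of_set B) T \<and> B \<subseteq> closure T"
        using all[of m] openin_diff[OF openin_subtopology_self closed_subset[OF EB[of m] clE[of m]]]
        by simp
    qed auto
    moreover have "\<Inter>(range (\<lambda>m. B - E m)) = {}" using cover by blast
    ultimately have "B \<subseteq> closure {}" by (simp only:)
    then show False using \<open>z \<in> B\<close> by simp
  qed
  then obtain m x where x: "x \<in> B" "x \<notin> closure (B - E m)" by blast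
  then obtain d where d0: "d > 0" "\<forall>y\<in>B - E m. \<not> dist y x < d"
    unfolding closure_approachable by blast
  then have d: "d > 0" "ball x d \<inter> (B - E m) = {}" by (auto simp: dist_commute)
  have "x \<in> closure (ball z e)" using x e by (simp add: B_def)
  then obtain x' where x': "x' \<in> ball z e" "dist x' x < d" using d(1) closure_approachable by blast
  have "open (ball x d \<inter> ball z e)" by blast
  moreover have "x' \<in> ball x d \<inter> ball z e" using x' by (simp add: dist_commute)
  ultimately obtain t where t: "t > 0" "ball x' t \<subseteq> ball x d \<inter> ball z e" by (rule openE)
  have tB: "ball x' t \<subseteq> B" using t(2) ball_subset_cball by (auto simp: B_def)
  have tE: "ball x' t \<subseteq> E m" using t(2) d(2) tB by blast
  have zero: "F p q = 0" if "p \<in> ball x' t" "q \<in> ball x' t" for p q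
  proof (rule sesqui_zero_if_zero_on_diagonal[OF sesqui_holo_on_subset[OF F] open_ball convex_ball])
    show "ball x' t \<subseteq> S" using tB BS by blast
    show "cmod (F p q) \<le> real m" if "p \<in> ball x' t" "q \<in> ball x' t" for p q
    proof -
      have "p \<in> B" "q \<in> E m" using that tB tE by blast+
      then show ?thesis unfolding E_def by blast
    qed
    show "F p p = 0" if "p \<in> ball x' t" for p using that tB BS diag by blast
  qed (use that in auto)
  have tS: "ball x' t \<subseteq> S" "ball x' t \<noteq> {}" using tB BS t by auto
  have zero1: "F p q = 0" if "p \<in> S" "q \<in> ball x' t" for p q
  proof -
    have "q \<in> S" using that tS by blast
    show ?thesis
      by (rule holo_on_identity[OF F1[OF \<open>q \<in> S\<close>] S open_ball tS(2,1) _ that(1)]) (rule zero[OF _ that(2)])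
  qed
  have "cnj (F z w) = 0"
    by (rule holo_on_identity[OF F2[OF zw(1)] S open_ball tS(2,1) _ zw(2)])
      (simp add: zero1[OF zw(1)] del: mem_ball)
  then show ?thesis by simp
qed

lemma null_difference_AE:
  assumes "S1 \<subseteq> S" "open S1" "open S" "emeasure lborel (S - S1) = 0"
  shows "AE z in lborel. indicator S z = (indicator S1 z :: 'b::zero_neq_one)"
  using assms by (intro AE_I'[of "S - S1"]) (auto simp: null_sets_def indicator_def)

lemma nn_integral_null_difference:
  assumes "S1 \<subseteq> S" "open S1" "open S" "emeasure lborel (S - S1) = 0"
  shows "(\<integral>\<^sup>+z\<in>S. f z \<partial>lborel) = (\<integral>\<^sup>+z\<in>S1. f z \<partial>lborel)"
  by (rule nn_integral_cong_AE) (use null_difference_AE[OF assms, where ?'b = ennreal] in eventually_elim, simp)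

lemma set_integral_null_difference:
  fixes f :: "_ \<Rightarrow> 'b::{banach, second_countable_topology}"
  assumes "S1 \<subseteq> S" "open S1" "open S" "emeasure lborel (S - S1) = 0" and [measurable]: "f \<in> borel_measurable borel"
  shows "(LINT z:S|lborel. f z) = (LINT z:S1|lborel. f z)"
  unfolding set_lebesgue_integral_def
proof (rule integral_cong_AE)
  have [measurable]: "S \<in> sets borel" "S1 \<in> sets borel" using assms by auto
  show "(\<lambda>x. indicat_real S x *\<^sub>R f x) \<in> borel_measurable lborel"
    "(\<lambda>x. indicat_real S1 x *\<^sub>R f x) \<in> borel_measurable lborel" by measurable
  show "AE x in lborel. indicat_real S x *\<^sub>R f x = indicat_real S1 x *\<^sub>R f x"
    using null_difference_AE[OF assms(1-4), where ?'b = real] by eventually_elim simp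
qed

lemma l2_sqnorm_null_difference:
  assumes "S1 \<subseteq> S" "open S1" "open S" "emeasure lborel (S - S1) = 0" and f: "f \<in> bergman_fns S"
  shows "l2_sqnorm S f = l2_sqnorm S1 f"
proof -
  have [measurable]: "f \<in> borel_measurable borel" by (rule bergman_fns_measurable[OF f assms(3)])
  show ?thesis unfolding l2_sqnorm_def by (intro set_integral_null_difference assms) measurable
qed

lemma l2_inner_null_difference:
  assumes "S1 \<subseteq> S" "open S1" "open S" "emeasure lborel (S - S1) = 0"
    and f: "f \<in> bergman_fns S" and g: "g \<in> bergman_fns S"
  shows "l2_inner S f g = l2_inner S1 f g"
proof -
  have [measurable]: "f \<in> borel_measurable borel" by (rule bergman_fns_measurable[OF f assms(3)])
  have [measurable]: "g \<in> borel_measurable borel" by (rule bergman_fns_measurable[OF g assms(3)])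
  have [measurable]: "(\<lambda>z. cnj (g z)) \<in> borel_measurable borel"
    by (rule measurable_compose[of g _ borel]) (auto intro!: borel_measurable_continuous_onI continuous_intros)
  show ?thesis unfolding l2_inner_def by (intro set_integral_null_difference assms) measurable
qed

lemma restr_subset_bergman_fns:
  assumes S: "S1 \<subseteq> S" "open S1" "open S" and f: "f \<in> bergman_fns S"
  shows "restr S1 f \<in> bergman_fns S1"
proof (rule bergman_fnsI_nn_integral[OF S(2)])
  show "holo_on (restr S1 f) S1"
    using holo_on_cong[OF S(2), of "restr S1 f" f] holo_on_subset[of f S S1] f S(1)
    by (simp add: restr_def bergman_fns_def)
  show "restr S1 f z = 0" if "z \<notin> S1" for z using that by (simp add: restr_def)
  have "(\<integral>\<^sup>+z\<in>S1. ennreal ((cmod (restr S1 f z))\<^sup>2) \<partial>lborel) \<le> (\<integral>\<^sup>+z\<in>S. ennreal ((cmod (f z))\<^sup>2) \<partial>lborel)"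
    using S(1) by (intro nn_integral_mono) (auto simp: restr_def indicator_def)
  also have "\<dots> < \<infinity>" using nn_integral_eq_l2_sqnorm[OF f] by simp
  finally show "(\<integral>\<^sup>+z\<in>S1. ennreal ((cmod (restr S1 f z))\<^sup>2) \<partial>lborel) < \<infinity>" .
qed

text \<open>Finite combinations of kernel functions extend, extension preserves the norm because the
  added set is null, and both spaces are complete.\<close>

theorem bergman_fns_extend:
  fixes S S1 :: "(complex^'n) set"
  assumes S: "S1 \<subseteq> S" "open S1" "open S" and null: "emeasure lborel (S - S1) = 0"
    and ext: "\<And>w. w \<in> S1 \<Longrightarrow> \<exists>G. holo_on G S \<and> (\<forall>z\<in>S1. G z = bergman_kernel S1 z w)"
    and f: "f \<in> bergman_fns S1"
  obtains g where "g \<in> bergman_fns S" "restr S1 g = f"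
proof -
  interpret H: hilbert_subspace fscale "bergman_fns S1" "l2_inner S1" by (rule hilbert_bergman[OF S(2)])
  have sq: "H.sq = l2_sqnorm S1" using sq_bergman[OF S(2)] by auto
  have kV: "kernel_fn S1 ` S1 \<subseteq> bergman_fns S1" using kernel_fn_in_bergman_fns[OF S(2)] by blast
  have total: "h = 0" if h: "h \<in> bergman_fns S1"
    and 0: "\<And>z. z \<in> S1 \<Longrightarrow> l2_inner S1 h (kernel_fn S1 z) = 0" for h
    using 0 kernel_fn_reproduces[OF S(2) _ h] h by (auto simp: bergman_fns_def fun_eq_iff)
  obtain u where u: "\<And>n::nat. u n \<in> H.span (kernel_fn S1 ` S1)" "\<And>n. u n \<in> bergman_fns S1"
    "(\<lambda>n. H.sq (u n - f)) \<longlonglongrightarrow> 0"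
    using H.span_approximation[OF f kV total] by blast
  have "\<exists>G. holo_on G S \<and> (\<forall>z\<in>S1. G z = v z)" if "v \<in> H.span (kernel_fn S1 ` S1)" for v
    using that
  proof (induction rule: H.span_induct_alt)
    case base
    show ?case by (intro exI[of _ "\<lambda>_. 0"]) (simp add: holo_on_const)
  next
    case (step c x y)
    then obtain w G' where w: "w \<in> S1" "x = kernel_fn S1 w" and G': "holo_on G' S" "\<forall>z\<in>S1. G' z = y z" by blast
    obtain G where G: "holo_on G S" "\<forall>z\<in>S1. G z = bergman_kernel S1 z w" using ext[OF w(1)] by blast
    show ?case
      using w G G'
      by (intro exI[of _ "\<lambda>z. c * G z + G' z"]) (auto simp: fscale_def kernel_fn_def intro: holo_on_add holo_on_cmult)
  qed
  then have "\<forall>n. \<exists>G. holo_on G S \<and> (\<forall>z\<in>S1. G z = u n z)" using u(1) by blast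
  then obtain G where G: "\<And>n. holo_on (G n) S" "\<And>n z. z \<in> S1 \<Longrightarrow> G n z = u n z" by metis
  define v where "v n = restr S (G n)" for n
  have vu: "v n z = u n z" if "z \<in> S1" for n z using that G(2) S(1) by (auto simp: v_def restr_def)
  have v: "v n \<in> bergman_fns S" for n
  proof (rule bergman_fnsI_nn_integral[OF S(3)])
    show "holo_on (v n) S" using holo_on_cong[OF S(3), of "v n" "G n"] G(1) by (simp add: v_def restr_def)
    show "v n z = 0" if "z \<notin> S" for z using that by (simp add: v_def restr_def)
    have "(\<integral>\<^sup>+z\<in>S. ennreal ((cmod (v n z))\<^sup>2) \<partial>lborel) = (\<integral>\<^sup>+z\<in>S1. ennreal ((cmod (v n z))\<^sup>2) \<partial>lborel)"
      by (rule nn_integral_null_difference[OF S null])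
    also have "\<dots> = (\<integral>\<^sup>+z\<in>S1. ennreal ((cmod (u n z))\<^sup>2) \<partial>lborel)"
      by (intro nn_integral_cong) (auto simp: indicator_def vu)
    also have "\<dots> < \<infinity>" using nn_integral_eq_l2_sqnorm[OF u(2)] by simp
    finally show "(\<integral>\<^sup>+z\<in>S. ennreal ((cmod (v n z))\<^sup>2) \<partial>lborel) < \<infinity>" .
  qed
  have d1: "l2_sqnorm S1 (\<lambda>z. u m z - u n z) \<le> 2 * H.sq (u m - f) + 2 * H.sq (u n - f)" for m n
  proof -
    have "H.sq ((u m - f) + (f - u n)) \<le> 2 * H.sq (u m - f) + 2 * H.sq (f - u n)"
      using u f by (intro H.sq_add_le H.V_diff)
    moreover have "(u m - f) + (f - u n) = (\<lambda>z. u m z - u n z)" by (simp add: fun_eq_iff)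
    ultimately show ?thesis using H.sq_diff_commute[OF f u(2), of n] by (simp add: sq)
  qed
  have Cauchy: "\<exists>N. \<forall>m\<ge>N. \<forall>n\<ge>N. l2_sqnorm S (\<lambda>z. v m z - v n z) < e" if e: "e > 0" for e
  proof -
    obtain N where N: "\<And>n. n \<ge> N \<Longrightarrow> H.sq (u n - f) < e / 4"
      using order_tendstoD(2)[OF u(3), of "e/4"] e by (auto simp: eventually_sequentially)
    have "l2_sqnorm S (\<lambda>z. v m z - v n z) < e" if "m \<ge> N" "n \<ge> N" for m n
    proof -
      have "l2_sqnorm S (\<lambda>z. v m z - v n z) = l2_sqnorm S1 (\<lambda>z. v m z - v n z)"
        by (intro l2_sqnorm_null_difference S null bergman_fns_diff v)
      also have "\<dots> = l2_sqnorm S1 (\<lambda>z. u m z - u n z)" by (intro l2_sqnorm_cong S) (simp add: vu)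
      also have "\<dots> < e" using d1[of m n] N[OF that(1)] N[OF that(2)] by linarith
      finally show ?thesis .
    qed
    then show ?thesis by blast
  qed
  obtain g where g: "g \<in> bergman_fns S" "(\<lambda>n. l2_sqnorm S (\<lambda>z. v n z - g z)) \<longlonglongrightarrow> 0"
    by (rule bergman_fns_complete[OF S(3) v Cauchy])
  define g1 where "g1 = restr S1 g"
  have g1: "g1 \<in> bergman_fns S1" unfolding g1_def by (rule restr_subset_bergman_fns[OF S g(1)])
  have vg: "l2_sqnorm S (\<lambda>z. v n z - g z) = H.sq (u n - g1)" for n
  proof -
    have "l2_sqnorm S (\<lambda>z. v n z - g z) = l2_sqnorm S1 (\<lambda>z. v n z - g z)"
      by (intro l2_sqnorm_null_difference S null bergman_fns_diff v g)
    also have "\<dots> = l2_sqnorm S1 (u n - g1)"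
      by (intro l2_sqnorm_cong S) (simp add: vu g1_def restr_def)
    finally show ?thesis by (simp add: sq)
  qed
  have "H.sq (g1 - f) \<le> 0"
  proof (rule LIMSEQ_le_const)
    have "(\<lambda>n. 2 * H.sq (u n - g1) + 2 * H.sq (u n - f)) \<longlonglongrightarrow> 2 * 0 + 2 * 0"
      using g(2) u(3) unfolding vg by (intro tendsto_intros)
    then show "(\<lambda>n. 2 * H.sq (u n - g1) + 2 * H.sq (u n - f)) \<longlonglongrightarrow> 0" by simp
    have "H.sq (g1 - f) \<le> 2 * H.sq (u n - g1) + 2 * H.sq (u n - f)" for n
    proof -
      have "H.sq ((g1 - u n) + (u n - f)) \<le> 2 * H.sq (g1 - u n) + 2 * H.sq (u n - f)"
        using u f g1 by (intro H.sq_add_le H.V_diff)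
      then show ?thesis using H.sq_diff_commute[OF g1 u(2), of n] by simp
    qed
    then show "\<exists>N. \<forall>n\<ge>N. H.sq (g1 - f) \<le> 2 * H.sq (u n - g1) + 2 * H.sq (u n - f)" by blast
  qed
  then have "H.sq (g1 - f) = 0" using H.sq_nonneg[OF H.V_diff[OF g1 f]] by linarith
  then have "g1 - f = 0" using H.sq_eq_0[OF H.V_diff[OF g1 f]] by blast
  then show thesis using that[OF g(1)] by (simp add: g1_def)
qed

section \<open>Domains as complex manifolds\<close>

lemma second_countable_top_of_set: "second_countable (top_of_set (S :: 'a::second_countable_topology set))"
proof -
  obtain B :: "'a set set" where B: "countable B" "\<And>b. b \<in> B \<Longrightarrow> open b"
    "\<And>U. open U \<Longrightarrow> \<exists>B'\<subseteq>B. U = \<Union>B'"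
    using univ_second_countable by metis
  have "second_countable (euclidean :: 'a topology)"
    unfolding second_countable_def
  proof (intro exI[of _ B] conjI allI impI ballI)
    fix U and x :: 'a assume U: "openin euclidean U \<and> x \<in> U"
    then obtain B' where "B' \<subseteq> B" "U = \<Union>B'" using B(3)[of U] by auto
    then show "\<exists>V\<in>B. x \<in> V \<and> V \<subseteq> U" using U by blast
  qed (use B in auto)
  then show ?thesis by (rule second_countable_subtopology)
qed

lemma pts_domain_mfd: "pts (domain_mfd S) = S" by (simp add: domain_mfd_def)

lemma atlas_domain_mfd: "atlas (domain_mfd S) = {(S, \<lambda>z. z)}" by (simp add: domain_mfd_def)

lemma chart_inv_id: "z \<in> S \<Longrightarrow> chart_inv (S, \<lambda>z. z) z = z"
  using f_inv_into_f[of z "\<lambda>z. z" S] by (simp add: chart_inv_def)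

lemma holo_vec_on_id_on:
  assumes "open S" "\<And>z. z \<in> S \<Longrightarrow> F z = z"
  shows "holo_vec_on F S"
  unfolding holo_vec_on_def
proof
  fix i
  show "holo_on (\<lambda>z. F z $ i) S"
    using holo_on_cong[OF assms(1), of "\<lambda>z. F z $ i" "\<lambda>z. z $ i"] assms(2) holo_on_component by simp
qed

lemma complex_manifold_domain_mfd:
  fixes S :: "(complex^'n) set"
  assumes "cdomain S" shows "complex_manifold (domain_mfd S)"
proof -
  have S: "S \<noteq> {}" "open S" "connected S" using assms by (auto simp: cdomain_def)
  have "is_chart (top_of_set S) (S, \<lambda>z. z)"
    using S(2) by (simp add: is_chart_def subtopology_subtopology homeomorphic_map_id[unfolded id_def])
  moreover have "holo_vec_on (transition (S, \<lambda>z. z) (S, \<lambda>z. z)) S"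
    using S(2) by (intro holo_vec_on_id_on) (simp_all add: transition_def chart_inv_id)
  ultimately show ?thesis
    using S by (auto simp: complex_manifold_def domain_mfd_def second_countable_top_of_set
        Hausdorff_space_subtopology connected_space_subtopology)
qed

lemma biholomorphic_refl_domain:
  assumes "open S" shows "biholomorphic (domain_mfd S) (domain_mfd S)"
proof -
  have "holo_mfd_map (domain_mfd S) (domain_mfd S) (\<lambda>z. z)"
    using assms unfolding holo_mfd_map_def domain_mfd_def
    by (auto intro!: holo_vec_on_id_on simp: chart_inv_id)
  moreover have "homeomorphic_maps (mtop (domain_mfd S)) (mtop (domain_mfd S)) (\<lambda>z. z) (\<lambda>z. z)"
    by (simp add: homeomorphic_maps_def)
  ultimately show ?thesis unfolding biholomorphic_def by blast
qed

lemma open_submfd_domain: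
  assumes "S' \<subseteq> S" shows "open_submfd (domain_mfd S) S' = domain_mfd S'"
  using assms by (simp add: open_submfd_def domain_mfd_def subtopology_subtopology Int_absorb1)

text \<open>The coefficients of the form \<open>g dz\<^sub>1 \<and> \<dots> \<and> dz\<^sub>n\<close> on \<open>S\<close>.\<close>

definition domain_form :: "(complex^'n) set \<Rightarrow> (complex^'n \<Rightarrow> complex) \<Rightarrow> (complex^'n, 'n::finite) nform" where
  "domain_form S g = (\<lambda>c z. if c = (S, \<lambda>z. z) then g z else 0)"

lemma domain_form_inject: "domain_form S f = domain_form S g \<longleftrightarrow> f = g"
proof
  assume eq: "domain_form S f = domain_form S g"
  show "f = g"
  proof
    fix z
    show "f z = g z"
      using fun_cong[OF fun_cong[OF eq, of "(S, \<lambda>z. z)"], of z] by (simp add: domain_form_def)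
  qed
qed simp

lemma chart_seq_domain: "chart_seq (domain_mfd S) = (\<lambda>_. (S, \<lambda>z. z))"
  for S :: "(complex^'n) set"
  unfolding chart_seq_def atlas_domain_mfd pts_domain_mfd
proof (rule some_equality)
  fix c :: "nat \<Rightarrow> (complex^'n, 'n) chart"
  assume "(\<forall>i. c i \<in> {(S, \<lambda>z. z)}) \<and> (\<Union>i. fst (c i)) = S"
  then show "c = (\<lambda>_. (S, \<lambda>z. z))" by auto
qed auto

lemma chart_piece_domain: "chart_piece (domain_mfd S) i = (if i = 0 then S else {})"
  by (auto simp: chart_piece_def chart_seq_domain)

lemma nform_inner_domain_form:
  "nform_inner (domain_mfd S) (domain_form S f) (domain_form S g) = 2 ^ CARD('n) * l2_inner S f g"
  for S :: "(complex^'n) set"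
proof -
  have "(\<Sum>i. LINT z:chart_piece (domain_mfd S) i|lborel. f z * cnj (g z))
      = (\<Sum>i\<in>{0}. LINT z:chart_piece (domain_mfd S) i|lborel. f z * cnj (g z))"
    by (rule suminf_finite) (auto simp: chart_piece_domain set_lebesgue_integral_def)
  then show ?thesis
    by (simp add: nform_inner_def chart_seq_domain domain_form_def chart_piece_domain l2_inner_def)
qed

lemma holo_jacobian_transition_id:
  fixes z :: "complex^'n"
  assumes "open S" "z \<in> S"
  shows "holo_jacobian (transition (S, \<lambda>z. z) (S, \<lambda>z. z)) z = 1"
proof -
  let ?t = "transition (S, \<lambda>z. z) (S, \<lambda>z::complex^'n. z)"
  have "((\<lambda>z. z) has_derivative (\<lambda>h. h)) (at z)" by (rule has_derivative_ident)
  then have "(?t has_derivative (\<lambda>h. h)) (at z)"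
    by (rule has_derivative_transform_within_open[OF _ assms])
      (simp add: transition_def chart_inv_id)
  then have "frechet_derivative ?t (at z) = (\<lambda>h. h)" by (rule frechet_derivative_at[symmetric])
  moreover have "matrix (\<lambda>h::complex^'n. h) = mat 1"
    by (simp add: matrix_def mat_def vec_eq_iff axis_def)
  ultimately show ?thesis by (simp add: holo_jacobian_def)
qed

lemma bergman_forms_domain:
  fixes S :: "(complex^'n) set"
  assumes S: "open S"
  shows "bergman_forms (domain_mfd S) = domain_form S ` bergman_fns S"
proof -
  let ?c = "(S, \<lambda>z::complex^'n. z)"
  have int: "(\<Sum>i. \<integral>\<^sup>+z\<in>chart_piece (domain_mfd S) i. ennreal ((cmod (f (chart_seq (domain_mfd S) i) z))\<^sup>2) \<partial>lborel)
     = (\<integral>\<^sup>+z\<in>S. ennreal ((cmod (f ?c z))\<^sup>2) \<partial>lborel)" for f :: "(complex^'n, 'n) nform"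
  proof -
    have "(\<Sum>i. \<integral>\<^sup>+z\<in>chart_piece (domain_mfd S) i. ennreal ((cmod (f ?c z))\<^sup>2) \<partial>lborel)
      = (\<Sum>i\<in>{0}. \<integral>\<^sup>+z\<in>chart_piece (domain_mfd S) i. ennreal ((cmod (f ?c z))\<^sup>2) \<partial>lborel)"
      by (rule suminf_finite) (auto simp: chart_piece_domain)
    then show ?thesis by (simp add: chart_seq_domain chart_piece_domain)
  qed
  have im: "chart_image ?c = S" by (simp add: chart_image_def)
  show ?thesis
  proof (intro equalityI subsetI)
    fix f assume "f \<in> bergman_forms (domain_mfd S)"
    then have f: "holo_nform (domain_mfd S) f" "(\<integral>\<^sup>+z\<in>S. ennreal ((cmod (f ?c z))\<^sup>2) \<partial>lborel) < \<infinity>"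
      by (auto simp: bergman_forms_def int)
    then have "f ?c \<in> bergman_fns S"
      by (intro bergman_fnsI_nn_integral S) (auto simp: holo_nform_def atlas_domain_mfd im)
    moreover have "f = domain_form S (f ?c)"
    proof (intro ext)
      fix c z
      show "f c z = domain_form S (f ?c) c z"
      proof (cases "c = ?c")
        case False
        then have "c \<notin> atlas (domain_mfd S)" by (simp add: atlas_domain_mfd)
        then have "f c z = 0" using f(1) unfolding holo_nform_def by blast
        then show ?thesis using False by (simp add: domain_form_def)
      qed (simp add: domain_form_def)
    qed
    ultimately show "f \<in> domain_form S ` bergman_fns S" by blast
  next
    fix f assume "f \<in> domain_form S ` bergman_fns S"
    then obtain g where g: "g \<in> bergman_fns S" "f = domain_form S g" by blast
    have fc: "f ?c = g" by (simp add: g domain_form_def)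
    have "holo_nform (domain_mfd S) f"
      unfolding holo_nform_def
    proof (intro conjI ballI allI impI)
      fix c assume "c \<in> atlas (domain_mfd S)"
      then show "holo_on (f c) (chart_image c)"
        using g(1) by (simp add: atlas_domain_mfd fc im bergman_fns_def)
    next
      fix c c' z assume "c \<in> atlas (domain_mfd S)" "c' \<in> atlas (domain_mfd S)" "z \<in> snd c ` (fst c \<inter> fst c')"
      then show "f c z = f c' (transition c c' z) * holo_jacobian (transition c c') z"
      proof -
        have cz: "c = ?c" "c' = ?c" "z \<in> S"
          using \<open>c \<in> _\<close> \<open>c' \<in> _\<close> \<open>z \<in> _\<close> by (auto simp: atlas_domain_mfd)
        have "transition ?c ?c z = z" using cz(3) by (simp add: transition_def chart_inv_id)
        then show ?thesis unfolding cz(1,2) using holo_jacobian_transition_id[OF S cz(3)] by simp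
      qed
    next
      fix c z assume "c \<notin> atlas (domain_mfd S) \<or> z \<notin> chart_image c"
      then show "f c z = 0"
        using g by (auto simp: atlas_domain_mfd im domain_form_def bergman_fns_def)
    qed
    moreover have "(\<integral>\<^sup>+z\<in>S. ennreal ((cmod (f ?c z))\<^sup>2) \<partial>lborel) < \<infinity>"
      using nn_integral_eq_l2_sqnorm[OF g(1)] by (simp add: fc)
    ultimately show "f \<in> bergman_forms (domain_mfd S)" by (simp add: bergman_forms_def int)
  qed
qed

lemma nontrivial_bergman_domain:
  fixes S :: "(complex^'n) set"
  assumes S: "open S" "bounded S" "S \<noteq> {}"
  shows "nontrivial_bergman (domain_mfd S)"
proof -
  have "restr S (\<lambda>_. 1) \<in> bergman_fns S" by (intro restr_in_bergman_fns S holo_on_const)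
  then have "domain_form S (restr S (\<lambda>_. 1)) \<in> bergman_forms (domain_mfd S)"
    by (simp add: bergman_forms_domain[OF S(1)])
  moreover have "domain_form S (restr S (\<lambda>_. 1)) \<noteq> (\<lambda>_ _. 0)"
  proof
    obtain z where "z \<in> S" using S by blast
    assume "domain_form S (restr S (\<lambda>_. 1)) = (\<lambda>_ _. 0)"
    then have "domain_form S (restr S (\<lambda>_. 1)) (S, \<lambda>z. z) z = 0" by simp
    then show False using \<open>z \<in> S\<close> by (simp add: domain_form_def restr_def)
  qed
  ultimately show ?thesis unfolding nontrivial_bergman_def by blast
qed

lemma restrict_nform_domain:
  fixes S S' :: "(complex^'n) set"
  assumes "S' \<subseteq> S"
  shows "restrict_nform (domain_mfd S) S' (domain_form S g) = domain_form S' (restr S' g)"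
proof (intro ext)
  fix c :: "(complex^'n, 'n) chart" and z
  obtain V \<phi> where c: "c = (V, \<phi>)" by (cases c)
  show "restrict_nform (domain_mfd S) S' (domain_form S g) c z = domain_form S' (restr S' g) c z"
  proof (cases "c = (S', \<lambda>z. z)")
    case True
    have "(SOME c. c \<in> atlas (domain_mfd S) \<and> fst c \<inter> S' = S' \<and> snd c = (\<lambda>z. z)) = (S, \<lambda>z. z)"
      using assms by (intro some_equality) (auto simp: atlas_domain_mfd)
    then show ?thesis using True assms
      by (simp add: restrict_nform_def open_submfd_domain atlas_domain_mfd domain_form_def restr_def)
  next
    case False
    then have "(V, \<phi>) \<notin> atlas (open_submfd (domain_mfd S) S')"
      by (simp add: open_submfd_domain[OF assms] atlas_domain_mfd c)
    then have "restrict_nform (domain_mfd S) S' (domain_form S g) c z = 0"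
      unfolding c restrict_nform_def by simp
    then show ?thesis using False by (simp add: domain_form_def)
  qed
qed

text \<open>A subdomain whose complement is null is related to the larger domain as soon as all
  square-integrable holomorphic functions extend; restriction is injective by the identity theorem.\<close>

lemma bergman_le_subdomain:
  fixes S S1 :: "(complex^'n) set"
  assumes S1: "cdomain S1" and S: "cdomain S" "bounded S" and sub: "S1 \<subseteq> S"
    and null: "emeasure lborel (S - S1) = 0"
    and ext: "\<And>f. f \<in> bergman_fns S1 \<Longrightarrow> \<exists>g\<in>bergman_fns S. restr S1 g = f"
  shows "domain_mfd S1 \<preceq>\<^sub>B domain_mfd S"
proof -
  have o: "open S1" "open S" "S1 \<noteq> {}" "connected S" "S \<noteq> {}" "bounded S1"
    using S1 S sub bounded_subset by (auto simp: cdomain_def)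
  have diff: "pts (domain_mfd S) - (S - S1) = S1" using sub by (auto simp: pts_domain_mfd)
  have "bij_betw (restrict_nform (domain_mfd S) S1) (bergman_forms (domain_mfd S)) (bergman_forms (domain_mfd S1))"
    unfolding bij_betw_def
  proof
    show "inj_on (restrict_nform (domain_mfd S) S1) (bergman_forms (domain_mfd S))"
    proof (rule inj_onI)
      fix F G assume "F \<in> bergman_forms (domain_mfd S)" "G \<in> bergman_forms (domain_mfd S)"
        and eq: "restrict_nform (domain_mfd S) S1 F = restrict_nform (domain_mfd S) S1 G"
      then obtain f g where fg: "f \<in> bergman_fns S" "g \<in> bergman_fns S" "F = domain_form S f" "G = domain_form S g"
        by (auto simp: bergman_forms_domain[OF o(2)])
      then have "restr S1 f = restr S1 g"
        using eq by (simp add: restrict_nform_domain[OF sub] domain_form_inject)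
      then have zero: "f z - g z = 0" if "z \<in> S1" for z using that by (simp add: restr_def fun_eq_iff) metis
      have "holo_on (\<lambda>z. f z - g z) S" using fg by (intro holo_on_diff) (auto simp: bergman_fns_def)
      then have "f z - g z = 0" if "z \<in> S" for z
        by (rule holo_on_identity[OF _ o(2,4,1,3) sub zero that])
      moreover have "f z - g z = 0" if "z \<notin> S" for z using fg(1,2) that by (simp add: bergman_fns_def)
      ultimately have "f z - g z = 0" for z by (cases "z \<in> S") simp_all
      then have "f = g" by (simp add: fun_eq_iff)
      then show "F = G" using fg by simp
    qed
    show "restrict_nform (domain_mfd S) S1 ` bergman_forms (domain_mfd S) = bergman_forms (domain_mfd S1)"
    proof (intro equalityI subsetI)
      fix F assume "F \<in> restrict_nform (domain_mfd S) S1 ` bergman_forms (domain_mfd S)"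
      then obtain g where "g \<in> bergman_fns S" "F = domain_form S1 (restr S1 g)"
        by (auto simp: bergman_forms_domain[OF o(2)] restrict_nform_domain[OF sub])
      then show "F \<in> bergman_forms (domain_mfd S1)"
        using restr_subset_bergman_fns[OF sub o(1,2)] by (simp add: bergman_forms_domain[OF o(1)])
    next
      fix F assume "F \<in> bergman_forms (domain_mfd S1)"
      then obtain f where f: "f \<in> bergman_fns S1" "F = domain_form S1 f"
        by (auto simp: bergman_forms_domain[OF o(1)])
      then obtain g where g: "g \<in> bergman_fns S" "restr S1 g = f" using ext by blast
      then have "F = restrict_nform (domain_mfd S) S1 (domain_form S g)"
        using f by (simp add: restrict_nform_domain[OF sub])
      then show "F \<in> restrict_nform (domain_mfd S) S1 ` bergman_forms (domain_mfd S)"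
        using g by (auto simp: bergman_forms_domain[OF o(2)])
    qed
  qed
  moreover have "nform_inner (domain_mfd S1) (restrict_nform (domain_mfd S) S1 F) (restrict_nform (domain_mfd S) S1 G)
      = nform_inner (domain_mfd S) F G" if FG: "F \<in> bergman_forms (domain_mfd S)" "G \<in> bergman_forms (domain_mfd S)" for F G
  proof -
    obtain f g where fg: "f \<in> bergman_fns S" "g \<in> bergman_fns S" "F = domain_form S f" "G = domain_form S g"
      using FG by (auto simp: bergman_forms_domain[OF o(2)])
    have "l2_inner S1 (restr S1 f) (restr S1 g) = l2_inner S1 f g"
      using o(1) by (intro l2_inner_cong) (auto simp: restr_def)
    then show ?thesis
      by (simp add: fg restrict_nform_domain[OF sub] nform_inner_domain_form
          l2_inner_null_difference[OF sub o(1,2) null fg(1,2)])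
  qed
  moreover have "closedin (top_of_set S) (S - S1)"
    using o(1) sub by (intro closedin_diff) (auto simp: open_subset)
  moreover have "S - S1 \<noteq> S" using o(3) sub by blast
  ultimately have "bergman_negligible (domain_mfd S) (S - S1)"
    using nontrivial_bergman_domain[OF o(2) S(2) o(5)]
    unfolding bergman_negligible_def diff open_submfd_domain[OF sub]
    by (simp add: domain_mfd_def)
  moreover have "biholomorphic (domain_mfd S1) (open_submfd (domain_mfd S) (pts (domain_mfd S) - (S - S1)))"
    unfolding diff open_submfd_domain[OF sub] by (rule biholomorphic_refl_domain[OF o(1)])
  ultimately show ?thesis
    unfolding bergman_le_def
    using complex_manifold_domain_mfd[OF S1] complex_manifold_domain_mfd[OF S(1)]
      nontrivial_bergman_domain[OF o(1,6,3)] nontrivial_bergman_domain[OF o(2) S(2) o(5)]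
    by blast
qed

lemma bergman_equiv_if_common_upper_bound:
  fixes M M' N :: "(complex^'n, 'n::finite) cmfd"
  assumes "M \<preceq>\<^sub>B N" "M' \<preceq>\<^sub>B N"
  shows "bergman_equiv M M'"
proof -
  have "\<forall>j. Suc j < length [M, N, M'] \<longrightarrow>
      [M, N, M'] ! j \<preceq>\<^sub>B [M, N, M'] ! Suc j \<or> [M, N, M'] ! Suc j \<preceq>\<^sub>B [M, N, M'] ! j"
    using assms by (auto simp: less_Suc_eq)
  moreover have "complex_manifold M" "complex_manifold N" "complex_manifold M'"
    "nontrivial_bergman M" "nontrivial_bergman M'"
    using assms by (auto simp: bergman_le_def)
  ultimately show ?thesis
    unfolding bergman_equiv_def by (intro conjI exI[of _ "[M, N, M']"]) auto
qed

section \<open>Domains with the same Bergman kernel\<close>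

text \<open>The domains meet because \<open>D2 - D1\<close> is null and \<open>D2\<close> is not; therefore the union is connected.
  Its Bergman space is that of \<open>D1\<close> because \<open>Kt\<close> extends the kernel functions.\<close>

lemma bergman_le_union:
  fixes D1 D2 :: "(complex^'n) set"
  assumes D1: "cdomain D1" "bounded D1" and D2: "cdomain D2" "bounded D2"
    and null: "emeasure lborel (D2 - D1) = 0"
    and Kt: "sesqui_holo_on Kt D" "D1 \<union> D2 \<subseteq> D"
    and diag: "\<And>z. z \<in> D1 \<Longrightarrow> Kt z z = bergman_kernel D1 z z"
  shows "domain_mfd D1 \<preceq>\<^sub>B domain_mfd (D1 \<union> D2)"
proof -
  have o: "open D1" "open D2" "D1 \<noteq> {}" "D2 \<noteq> {}" "connected D1" "connected D2"
    using D1 D2 by (auto simp: cdomain_def)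
  have "D1 \<inter> D2 \<noteq> {}"
  proof
    assume "D1 \<inter> D2 = {}"
    then have "D2 - D1 = D2" by blast
    moreover obtain x where "x \<in> D2" using o by blast
    then obtain e where e: "e > 0" "ball x e \<subseteq> D2" by (rule openE[OF o(2)])
    moreover have "emeasure lborel (ball x e) \<le> emeasure lborel D2"
      using e o(2) by (intro emeasure_mono) auto
    ultimately have "emeasure lborel (ball x e) = 0" using null by simp
    then show False using content_ball_pos[OF e(1), of x] by (simp add: measure_def)
  qed
  then have dom: "cdomain (D1 \<union> D2)" using o by (auto simp: cdomain_def intro: connected_Un)
  have null': "emeasure lborel ((D1 \<union> D2) - D1) = 0" using null by (simp add: Un_Diff)
  have Kt_eq: "Kt z w = bergman_kernel D1 z w" if zw: "z \<in> D1" "w \<in> D1" for z w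
  proof -
    have "sesqui_holo_on (\<lambda>z w. Kt z w - bergman_kernel D1 z w) D1"
      using Kt by (intro sesqui_holo_on_diff bergman_kernel_sesqui o sesqui_holo_on_subset[OF Kt(1)]) auto
    then have "Kt z w - bergman_kernel D1 z w = 0"
      by (rule sesqui_zero_if_zero_on_diagonal_connected[OF _ o(1,5) _ zw]) (simp add: diag)
    then show ?thesis by simp
  qed
  have "\<exists>G. holo_on G (D1 \<union> D2) \<and> (\<forall>z\<in>D1. G z = bergman_kernel D1 z w)" if w: "w \<in> D1" for w
  proof (intro exI conjI ballI)
    have "holo_on (\<lambda>z. Kt z w) D" using Kt w by (auto simp: sesqui_holo_on_def)
    then show "holo_on (\<lambda>z. Kt z w) (D1 \<union> D2)" using Kt(2) by (rule holo_on_subset)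
    show "Kt z w = bergman_kernel D1 z w" if "z \<in> D1" for z by (rule Kt_eq[OF that w])
  qed
  then have "\<exists>g\<in>bergman_fns (D1 \<union> D2). restr D1 g = f" if "f \<in> bergman_fns D1" for f
    using bergman_fns_extend[OF Un_upper1 o(1) open_Un[OF o(1,2)] null' _ that] by metis
  then show ?thesis
    using D1 D2 null' by (intro bergman_le_subdomain[OF D1(1) dom]) auto
qed

theorem theorem1p3:
  fixes D1 D2 Dhat :: "(complex^'n) set"
    and K :: "complex^'n \<Rightarrow> real"
    and lam :: real
  assumes "cdomain D1" and "bounded D1"
    and "cdomain D2" and "bounded D2"
    and "cdomain Dhat" and "D1 \<union> D2 \<subseteq> Dhat"
    and "real_analytic_on K Dhat" and "\<forall>z\<in>Dhat. 0 < K z"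
    and "0 < lam"
    and "kaehler_form_on (i_ddbar (\<lambda>z. ln (K z))) Dhat"
    and "\<forall>z\<in>D1. bergman_kernel D1 z z = complex_of_real (K z)"
    and "\<forall>z\<in>D2. bergman_kernel D2 z z = complex_of_real (lam * K z)"
  shows "lam = 1 \<and>
    (D1 - D2) \<union> (D2 - D1) \<in> null_sets lebesgue \<and>
    ((\<exists>Kt. sesqui_holo_on Kt Dhat \<and> (\<forall>z\<in>Dhat. Kt z z = complex_of_real (K z))) \<longrightarrow>
       domain_mfd D1 \<preceq>\<^sub>B domain_mfd (D1 \<union> D2) \<and>
       domain_mfd D2 \<preceq>\<^sub>B domain_mfd (D1 \<union> D2) \<and>
       bergman_equiv (domain_mfd D1) (domain_mfd D2))"
proof -
  interpret proportional_kernels Dhat D1 D2 K 1 lam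
    using assms by unfold_locales (auto simp: cdomain_def)
  have lam: "lam = 1" using factors_eq by simp
  have "(D1 - D2) \<union> (D2 - D1) \<in> null_sets lborel"
    using null_differences D1(1) D2(1) by (intro null_sets.Un) (auto simp: null_sets_def)
  then have null: "(D1 - D2) \<union> (D2 - D1) \<in> null_sets lebesgue"
    by (rule null_sets_completionI)
  have le: "domain_mfd D1 \<preceq>\<^sub>B domain_mfd (D1 \<union> D2)" "domain_mfd D2 \<preceq>\<^sub>B domain_mfd (D1 \<union> D2)"
    if Kt: "sesqui_holo_on Kt Dhat" "\<forall>z\<in>Dhat. Kt z z = complex_of_real (K z)" for Kt
  proof -
    show "domain_mfd D1 \<preceq>\<^sub>B domain_mfd (D1 \<union> D2)"
      by (rule bergman_le_union[OF assms(1-4) null_differences(2) Kt(1) assms(6)])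
        (use Kt(2) D1(4) k1(2) in auto)
    have sub: "D2 \<union> D1 \<subseteq> Dhat" using assms(6) by blast
    have "domain_mfd D2 \<preceq>\<^sub>B domain_mfd (D2 \<union> D1)"
      by (rule bergman_le_union[OF assms(3,4,1,2) null_differences(1) Kt(1) sub])
        (use Kt(2) D2(4) k2(2) lam in auto)
    then show "domain_mfd D2 \<preceq>\<^sub>B domain_mfd (D1 \<union> D2)" by (simp only: Un_commute)
  qed
  show ?thesis using lam null le bergman_equiv_if_common_upper_bound by blast
qed

end
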